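(* Let $\mathcal A\subset\mathcal D'_{L^\infty}(\mathbb R,X)$ be real-linear, positive-invariant and $C^\infty$-uniformly closed, with $\mathcal A*\mathcal D(\mathbb R,\mathbb K)\subset\mathcal A$ and $\mathcal A\subset\mathcal M\mathcal A$, and suppose that $(\Delta_1)$ holds for $\mathcal A$. Then $$\mathcal D'_{\mathcal A}(\mathbb R,X)=\bigcup_{n=0}^{\infty}\widetilde{\mathcal M}^n\mathcal A .$$
   Context: $X$ is a Banach space over $\mathbb K=\mathbb R$ or $\mathbb C$. $\mathcal D(\mathbb R,\mathbb K)$: Schwartz test functions; $\mathcal D'(\mathbb R,X)$: linear continuous maps $\mathcal D(\mathbb R,\mathbb K)\to X$; locally Bochner integrable functions are identified with the distributions they define. $(T*\varphi)(x)=T(y\mapsto\varphi(x-y))$. For $\mathcal B\subset\mathcal D'(\mathbb R,X)$, $\mathcal D'_{\mathcal B}(\mathbb R,X)=\{T\in\mathcal D'(\mathbb R,X):T*\varphi\in\mathcal B\ \forall\varphi\in\mathcal D(\mathbb R,\mathbb K)\}$; $\mathcal D'_{L^\infty}$ is the case $\mathcal B=L^\infty(\mathbb R,X)$. $\mathcal A*\mathcal D(\mathbb R,\mathbb K)=\{T*\varphi:T\in\mathcal A,\varphi\in\mathcal D(\mathbb R,\mathbb K)\}$. Translates: $f_a(t)=f(t+a)$ and $T_a(\varphi)=T(\varphi_{-a})$; $\Delta_sf=f_s-f$. Real-linear: $sF+tG\in\mathcal A$ for $F,G\in\mathcal A$, $s,t\in\mathbb R$. Positive-invariant: $F_a\in\mathcal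 A$ for $F\in\mathcal A$, $a\ge0$. $C^\infty$-uniformly closed: if $(\phi_n)\subset\mathcal A\cap C^\infty(\mathbb R,X)$ and $\phi_n\to\phi$ uniformly on $\mathbb R$, then $\phi\in\mathcal A$. Means: for $h\neq0$, $M_hf(t)=\frac1h\int_0^hf(t+s)\,ds$; $\mathcal M\mathcal A=\{f\in L^1_{loc}(\mathbb R,X):M_hf\in\mathcal A\ \forall h>0\}$. For $T\in\mathcal D'(\mathbb R,X)$, $\widetilde M_hT(\varphi)=T(M_{-h}\varphi)$; $\widetilde{\mathcal M}\mathcal A=\{T\in\mathcal D'(\mathbb R,X):\widetilde M_hT\in\mathcal A\ \forall h>0\}$, $\widetilde{\mathcal M}^0\mathcal A=\mathcal A$, $\widetilde{\mathcal M}^n\mathcal A=\widetilde{\mathcal M}(\widetilde{\mathcal M}^{n-1}\mathcal A)$. $(\Delta_1)$ for $\mathcal A$: whenever $\phi\in L^1_{loc}(\mathbb R,X)$ satisfies $\Delta_s\phi\in\mathcal A$ for all $s>0$, then $\phi-M_1\phi\in\mathcal A$. *)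

theory Defs
  imports "HOL-Analysis.Analysis"
begin

section \<open>Scalars and Banach spaces\<close>

text \<open>
  The scalar field is a type \<open>'k\<close> of sort \<open>{real_normed_field, euclidean_space}\<close>.  Besides the
  instances \<open>real\<close> and \<open>complex\<close>, this sort has no models up to isometric isomorphism, by the
  theorem of Frobenius.  A Banach space over \<open>'k\<close> is a type \<open>'x\<close> of class \<open>banach\<close> (so complete
  over the reals) together with a scalar multiplication that extends \<open>(*\<^sub>R)\<close>.
\<close>

definition normed_space_over :: "('k::real_normed_field \<Rightarrow> 'x::real_normed_vector \<Rightarrow> 'x) \<Rightarrow> bool" where
  "normed_space_over scaleK \<longleftrightarrow>
     vector_space scaleK \<and>
     (\<forall>r x. scaleK (of_real r) x = r *\<^sub>R x) \<and>
     (\<forall>c x. norm (scaleK c x) = norm c * norm x)"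


section \<open>Bochner integral\<close>

text \<open>
  The library restricts \<open>has_bochner_integral\<close> to second countable (hence separable) spaces.
  The following is the same definition without that restriction.  In a non-separable space the
  existence of the approximating simple functions forces \<open>f\<close> to be almost separably valued, so that
  this is integrability of strongly measurable functions.
\<close>

definition bochner_has_integral :: "'a measure \<Rightarrow> ('a \<Rightarrow> 'b::real_normed_vector) \<Rightarrow> 'b \<Rightarrow> bool" where
  "bochner_has_integral M f x \<longleftrightarrow>
     f \<in> borel_measurable M \<and>
     (\<exists>s. (\<forall>i. Bochner_Integration.simple_bochner_integrable M (s i)) \<and>
          (\<lambda>i. \<integral>\<^sup>+t. norm (f t - s i t) \<partial>M) \<longlonglongrightarrow> 0 \<and>
          (\<lambda>i::nat. Bochner_Integration.simple_bochner_integral M (s i)) \<longlonglongrightarrow> x)"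

lemma bochner_has_integral_eq_library:
  fixes f :: "'a \<Rightarrow> 'b::{real_normed_vector, second_countable_topology}"
  shows "bochner_has_integral M f x \<longleftrightarrow> has_bochner_integral M f x"
  unfolding bochner_has_integral_def has_bochner_integral.simps by blast

definition bochner_integrable :: "'a measure \<Rightarrow> ('a \<Rightarrow> 'b::real_normed_vector) \<Rightarrow> bool" where
  "bochner_integrable M f \<longleftrightarrow> (\<exists>x. bochner_has_integral M f x)"

definition bochner_integral :: "'a measure \<Rightarrow> ('a \<Rightarrow> 'b::real_normed_vector) \<Rightarrow> 'b" where
  "bochner_integral M f = (THE x. bochner_has_integral M f x)"

definition oriented_integral :: "real \<Rightarrow> real \<Rightarrow> (real \<Rightarrow> 'b::real_normed_vector) \<Rightarrow> 'b" where
  "oriented_integral a b f =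
     (if a \<le> b then bochner_integral lebesgue (\<lambda>t. indicator {a..b} t *\<^sub>R f t)
      else - bochner_integral lebesgue (\<lambda>t. indicator {b..a} t *\<^sub>R f t))"

definition locally_bochner :: "(real \<Rightarrow> 'b::real_normed_vector) \<Rightarrow> bool" where
  "locally_bochner f \<longleftrightarrow>
     (\<forall>K. compact K \<longrightarrow> bochner_integrable lebesgue (\<lambda>t. indicator K t *\<^sub>R f t))"


section \<open>Translates, differences and means of functions\<close>

definition translate :: "real \<Rightarrow> (real \<Rightarrow> 'b) \<Rightarrow> real \<Rightarrow> 'b" where
  "translate a f = (\<lambda>t. f (t + a))"

definition difference :: "real \<Rightarrow> (real \<Rightarrow> 'b::minus) \<Rightarrow> real \<Rightarrow> 'b" where
  "difference s f = (\<lambda>t. translate s f t - f t)"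

definition mean :: "real \<Rightarrow> (real \<Rightarrow> 'b::real_normed_vector) \<Rightarrow> real \<Rightarrow> 'b" where
  "mean h f = (\<lambda>t. (1 / h) *\<^sub>R oriented_integral 0 h (\<lambda>s. f (t + s)))"


section \<open>Test functions\<close>

definition iter_deriv :: "nat \<Rightarrow> (real \<Rightarrow> 'b::real_normed_vector) \<Rightarrow> real \<Rightarrow> 'b" where
  "iter_deriv n f = ((\<lambda>g t. vector_derivative g (at t)) ^^ n) f"

definition smooth :: "(real \<Rightarrow> 'b::real_normed_vector) \<Rightarrow> bool" where
  "smooth f \<longleftrightarrow> (\<forall>n t. iter_deriv n f differentiable (at t))"

definition test_functions :: "(real \<Rightarrow> 'k::real_normed_field) set" where
  "test_functions = {\<phi>. smooth \<phi> \<and> compact (closure {t. \<phi> t \<noteq> 0})}"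

definition test_functions_on :: "real set \<Rightarrow> (real \<Rightarrow> 'k::real_normed_field) set" where
  "test_functions_on K = {\<phi> \<in> test_functions. closure {t. \<phi> t \<noteq> 0} \<subseteq> K}"

text \<open>
  The topology of the test functions is the locally convex inductive limit of the Frechet spaces
  \<open>test_functions_on K\<close>, \<open>K\<close> compact: a base of neighbourhoods of zero is given by the absolutely
  convex sets whose trace on each \<open>test_functions_on K\<close> is a neighbourhood of zero there.
\<close>

definition test_zero_nhd :: "(real \<Rightarrow> 'k::real_normed_field) set \<Rightarrow> bool" where
  "test_zero_nhd V \<longleftrightarrow>
     V \<subseteq> test_functions \<and>
     (\<forall>\<phi>\<in>V. \<forall>\<psi>\<in>V. \<forall>a b. norm a + norm b \<le> 1 \<longrightarrow> (\<lambda>t. a * \<phi> t + b * \<psi> t) \<in> V) \<and>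
     (\<forall>K. compact K \<longrightarrow>
        (\<exists>m. \<exists>\<delta>>0. \<forall>\<phi>\<in>test_functions_on K.
           (\<forall>k\<le>m. \<forall>t. norm (iter_deriv k \<phi> t) < \<delta>) \<longrightarrow> \<phi> \<in> V))"

definition test_topology :: "(real \<Rightarrow> 'k::real_normed_field) topology" where
  "test_topology = topology (\<lambda>U. U \<subseteq> test_functions \<and>
     (\<forall>\<phi>\<in>U. \<exists>V. test_zero_nhd V \<and> (\<forall>\<psi>\<in>V. (\<lambda>t. \<phi> t + \<psi> t) \<in> U)))"

lemma test_zero_nhd_Int:
  assumes "test_zero_nhd V" "test_zero_nhd W"
  shows "test_zero_nhd (V \<inter> W)"
proof -
  have "\<exists>m. \<exists>\<delta>>0. \<forall>\<phi>\<in>test_functions_on K.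
           (\<forall>k\<le>m. \<forall>t. norm (iter_deriv k \<phi> t) < \<delta>) \<longrightarrow> \<phi> \<in> V \<inter> W" if "compact K" for K
  proof -
    have ex: "\<exists>m. \<exists>\<delta>>0. \<forall>\<phi>\<in>test_functions_on K.
        (\<forall>k\<le>m. \<forall>t. norm (iter_deriv k \<phi> t) < \<delta>) \<longrightarrow> \<phi> \<in> U" if "test_zero_nhd U" for U
      using that \<open>compact K\<close> by (simp add: test_zero_nhd_def)
    obtain m \<delta> where 1: "\<delta> > 0" "\<forall>\<phi>\<in>test_functions_on K.
        (\<forall>k\<le>m. \<forall>t. norm (iter_deriv k \<phi> t) < \<delta>) \<longrightarrow> \<phi> \<in> V"
      using ex[OF assms(1)] by blast
    obtain n \<epsilon> where 2: "\<epsilon> > 0" "\<forall>\<phi>\<in>test_functions_on K.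
        (\<forall>k\<le>n. \<forall>t. norm (iter_deriv k \<phi> t) < \<epsilon>) \<longrightarrow> \<phi> \<in> W"
      using ex[OF assms(2)] by blast
    show ?thesis
      using 1 2 by (intro exI[of _ "max m n"] exI[of _ "min \<delta> \<epsilon>"]) auto
  qed
  moreover have "(\<lambda>t. a * \<phi> t + b * \<psi> t) \<in> V \<inter> W"
    if "\<phi> \<in> V \<inter> W" "\<psi> \<in> V \<inter> W" "norm a + norm b \<le> 1" for \<phi> \<psi> a b
    using assms that unfolding test_zero_nhd_def by simp
  moreover have "V \<inter> W \<subseteq> test_functions"
    using assms(1) unfolding test_zero_nhd_def by blast
  ultimately show ?thesis
    unfolding test_zero_nhd_def by simp
qed

lemma openin_test_topology:
  fixes U :: "(real \<Rightarrow> 'k::real_normed_field) set"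
  shows "openin test_topology U \<longleftrightarrow> U \<subseteq> test_functions \<and>
     (\<forall>\<phi>\<in>U. \<exists>V. test_zero_nhd V \<and> (\<forall>\<psi>\<in>V. (\<lambda>t. \<phi> t + \<psi> t) \<in> U))"
proof -
  have "istopology (\<lambda>U :: (real \<Rightarrow> 'k) set. U \<subseteq> test_functions \<and>
     (\<forall>\<phi>\<in>U. \<exists>V. test_zero_nhd V \<and> (\<forall>\<psi>\<in>V. (\<lambda>t. \<phi> t + \<psi> t) \<in> U)))"
    unfolding istopology_def
  proof (intro conjI allI impI ballI)
    fix S T and \<phi> :: "real \<Rightarrow> 'k"
    assume S: "S \<subseteq> test_functions \<and>
        (\<forall>\<phi>\<in>S. \<exists>V. test_zero_nhd V \<and> (\<forall>\<psi>\<in>V. (\<lambda>t. \<phi> t + \<psi> t) \<in> S))"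
      and T: "T \<subseteq> test_functions \<and>
        (\<forall>\<phi>\<in>T. \<exists>V. test_zero_nhd V \<and> (\<forall>\<psi>\<in>V. (\<lambda>t. \<phi> t + \<psi> t) \<in> T))"
      and "\<phi> \<in> S \<inter> T"
    then obtain V W where "test_zero_nhd V" "\<forall>\<psi>\<in>V. (\<lambda>t. \<phi> t + \<psi> t) \<in> S"
      and "test_zero_nhd W" "\<forall>\<psi>\<in>W. (\<lambda>t. \<phi> t + \<psi> t) \<in> T"
      by blast
    then show "\<exists>V. test_zero_nhd V \<and> (\<forall>\<psi>\<in>V. (\<lambda>t. \<phi> t + \<psi> t) \<in> S \<inter> T)"
      using test_zero_nhd_Int by (intro exI[of _ "V \<inter> W"]) auto
  next
    fix \<K> and \<phi> :: "real \<Rightarrow> 'k"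
    assume K: "\<forall>K\<in>\<K>. K \<subseteq> test_functions \<and>
        (\<forall>\<phi>\<in>K. \<exists>V. test_zero_nhd V \<and> (\<forall>\<psi>\<in>V. (\<lambda>t. \<phi> t + \<psi> t) \<in> K))"
      and "\<phi> \<in> \<Union>\<K>"
    then obtain K where "K \<in> \<K>" "\<phi> \<in> K" by blast
    with K obtain V where "test_zero_nhd V" "\<forall>\<psi>\<in>V. (\<lambda>t. \<phi> t + \<psi> t) \<in> K" by blast
    with \<open>K \<in> \<K>\<close> show "\<exists>V. test_zero_nhd V \<and> (\<forall>\<psi>\<in>V. (\<lambda>t. \<phi> t + \<psi> t) \<in> \<Union>\<K>)"
      by blast
  qed auto
  then show ?thesis
    unfolding test_topology_def by (simp add: topology_inverse')
qed

lemma iter_deriv_lincomb: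
  fixes \<phi> \<psi> :: "real \<Rightarrow> 'k::real_normed_field"
  assumes "smooth \<phi>" "smooth \<psi>"
  shows "iter_deriv n (\<lambda>t. a * \<phi> t + b * \<psi> t) = (\<lambda>t. a * iter_deriv n \<phi> t + b * iter_deriv n \<psi> t)"
proof (induction n)
  case 0
  show ?case by (simp add: iter_deriv_def)
next
  case (Suc n)
  have *: "(iter_deriv n f has_vector_derivative iter_deriv (Suc n) f t) (at t)"
    if "smooth f" for f :: "real \<Rightarrow> 'k" and t
    using that unfolding smooth_def iter_deriv_def
    by (simp add: vector_derivative_works[symmetric])
  have "vector_derivative (iter_deriv n (\<lambda>t. a * \<phi> t + b * \<psi> t)) (at t) =
      a * iter_deriv (Suc n) \<phi> t + b * iter_deriv (Suc n) \<psi> t" for t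
    unfolding Suc.IH
    by (rule vector_derivative_at)
       (intro has_vector_derivative_add has_vector_derivative_mult_right * assms)
  then show ?case by (simp add: iter_deriv_def)
qed

lemma test_functions_lincomb:
  assumes "\<phi> \<in> test_functions" "\<psi> \<in> test_functions"
  shows "(\<lambda>t. a * \<phi> t + b * \<psi> t) \<in> test_functions"
proof -
  have "smooth (\<lambda>t. a * \<phi> t + b * \<psi> t)"
    using assms unfolding smooth_def
    by (auto simp: iter_deriv_lincomb test_functions_def smooth_def)
  moreover have "compact (closure {t. a * \<phi> t + b * \<psi> t \<noteq> 0})"
  proof -
    have "bounded ({t. \<phi> t \<noteq> 0} \<union> {t. \<psi> t \<noteq> 0})"
      using assms by (simp add: test_functions_def compact_closure)
    then have "bounded {t. a * \<phi> t + b * \<psi> t \<noteq> 0}"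
      by (rule bounded_subset) auto
    then show ?thesis by (simp add: compact_closure)
  qed
  ultimately show ?thesis
    by (simp add: test_functions_def)
qed

lemma topspace_test_topology: 
  "topspace test_topology = (test_functions :: (real \<Rightarrow> 'k::real_normed_field) set)"
proof -
  have nhd: "test_zero_nhd (test_functions :: (real \<Rightarrow> 'k) set)"
    unfolding test_zero_nhd_def using test_functions_lincomb zero_less_one
    by (auto simp: test_functions_on_def intro!: exI[of _ "1::real"])
  have "(\<lambda>t. \<phi> t + \<psi> t) \<in> test_functions"
    if "\<phi> \<in> test_functions" "\<psi> \<in> test_functions" for \<phi> \<psi> :: "real \<Rightarrow> 'k"
    using test_functions_lincomb[OF that, of 1 1] by simp
  then have "openin test_topology (test_functions :: (real \<Rightarrow> 'k) set)"
    using nhd by (auto simp: openin_test_topology)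
  then show ?thesis
    unfolding topspace_def by (auto simp: openin_test_topology)
qed


section \<open>Vector-valued distributions\<close>

text \<open>
  Distributions are \<open>undefined\<close> outside the test functions, so that equality of distributions is
  equality in HOL.
\<close>

definition distributions ::
  "('k::{real_normed_field,euclidean_space} \<Rightarrow> 'x::banach \<Rightarrow> 'x) \<Rightarrow> ((real \<Rightarrow> 'k) \<Rightarrow> 'x) set" where
  "distributions scaleK = {T \<in> extensional test_functions.
     (\<forall>\<phi>\<in>test_functions. \<forall>\<psi>\<in>test_functions. \<forall>a b.
        T (\<lambda>t. a * \<phi> t + b * \<psi> t) = scaleK a (T \<phi>) + scaleK b (T \<psi>)) \<and>
     continuous_map test_topology euclidean T}"

definition dist_of ::
  "('k::{real_normed_field,euclidean_space} \<Rightarrow> 'x::banach \<Rightarrow> 'x) \<Rightarrow> (real \<Rightarrow> 'x) \<Rightarrow> (real \<Rightarrow> 'k) \<Rightarrow> 'x" where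
  "dist_of scaleK f = (\<lambda>\<phi>\<in>test_functions. bochner_integral lebesgue (\<lambda>t. scaleK (\<phi> t) (f t)))"

definition convolution ::
  "((real \<Rightarrow> 'k::{real_normed_field,euclidean_space}) \<Rightarrow> 'x::banach) \<Rightarrow> (real \<Rightarrow> 'k) \<Rightarrow> real \<Rightarrow> 'x" where
  "convolution T \<phi> = (\<lambda>x. T (\<lambda>y. \<phi> (x - y)))"

definition dist_translate ::
  "real \<Rightarrow> ((real \<Rightarrow> 'k::{real_normed_field,euclidean_space}) \<Rightarrow> 'x::banach) \<Rightarrow> (real \<Rightarrow> 'k) \<Rightarrow> 'x" where
  "dist_translate a T = (\<lambda>\<phi>\<in>test_functions. T (translate (- a) \<phi>))"

definition dist_mean ::
  "real \<Rightarrow> ((real \<Rightarrow> 'k::{real_normed_field,euclidean_space}) \<Rightarrow> 'x::banach) \<Rightarrow> (real \<Rightarrow> 'k) \<Rightarrow> 'x" where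
  "dist_mean h T = (\<lambda>\<phi>\<in>test_functions. T (mean (- h) \<phi>))"


section \<open>Classes of distributions\<close>

text \<open>
  A class of functions or distributions is a set of distributions; a function \<open>f\<close> belongs to it if
  \<open>dist_of scaleK f\<close> does.
\<close>

definition Linf ::
  "('k::{real_normed_field,euclidean_space} \<Rightarrow> 'x::banach \<Rightarrow> 'x) \<Rightarrow> ((real \<Rightarrow> 'k) \<Rightarrow> 'x) set" where
  "Linf scaleK = {dist_of scaleK f | f.
     locally_bochner f \<and> (\<exists>C. AE t in lebesgue. norm (f t) \<le> C)}"

definition distributional_class ::
  "('k::{real_normed_field,euclidean_space} \<Rightarrow> 'x::banach \<Rightarrow> 'x) \<Rightarrow>
    ((real \<Rightarrow> 'k) \<Rightarrow> 'x) set \<Rightarrow> ((real \<Rightarrow> 'k) \<Rightarrow> 'x) set" where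
  "distributional_class scaleK B = {T \<in> distributions scaleK.
     \<forall>\<phi>\<in>test_functions. dist_of scaleK (convolution T \<phi>) \<in> B}"

definition convolution_set ::
  "('k::{real_normed_field,euclidean_space} \<Rightarrow> 'x::banach \<Rightarrow> 'x) \<Rightarrow>
    ((real \<Rightarrow> 'k) \<Rightarrow> 'x) set \<Rightarrow> ((real \<Rightarrow> 'k) \<Rightarrow> 'x) set" where
  "convolution_set scaleK A = {dist_of scaleK (convolution T \<phi>) | T \<phi>. T \<in> A \<and> \<phi> \<in> test_functions}"

definition real_linear :: "((real \<Rightarrow> 'k::{real_normed_field,euclidean_space}) \<Rightarrow> 'x::banach) set \<Rightarrow> bool" where
  "real_linear A \<longleftrightarrow>
     (\<forall>F\<in>A. \<forall>G\<in>A. \<forall>s t::real. (\<lambda>\<phi>\<in>test_functions. s *\<^sub>R F \<phi> + t *\<^sub>R G \<phi>) \<in> A)"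

definition positive_invariant ::
  "((real \<Rightarrow> 'k::{real_normed_field,euclidean_space}) \<Rightarrow> 'x::banach) set \<Rightarrow> bool" where
  "positive_invariant A \<longleftrightarrow> (\<forall>F\<in>A. \<forall>a\<ge>0. dist_translate a F \<in> A)"

definition smooth_uniformly_closed ::
  "('k::{real_normed_field,euclidean_space} \<Rightarrow> 'x::banach \<Rightarrow> 'x) \<Rightarrow>
    ((real \<Rightarrow> 'k) \<Rightarrow> 'x) set \<Rightarrow> bool" where
  "smooth_uniformly_closed scaleK A \<longleftrightarrow>
     (\<forall>f g. (\<forall>n. smooth (f n) \<and> dist_of scaleK (f n) \<in> A) \<and> uniform_limit UNIV f g sequentially
        \<longrightarrow> dist_of scaleK g \<in> A)"

definition mean_class ::
  "('k::{real_normed_field,euclidean_space} \<Rightarrow> 'x::banach \<Rightarrow> 'x) \<Rightarrow>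
    ((real \<Rightarrow> 'k) \<Rightarrow> 'x) set \<Rightarrow> ((real \<Rightarrow> 'k) \<Rightarrow> 'x) set" where
  "mean_class scaleK A = {dist_of scaleK f | f.
     locally_bochner f \<and> (\<forall>h>0. dist_of scaleK (mean h f) \<in> A)}"

definition dist_mean_class ::
  "('k::{real_normed_field,euclidean_space} \<Rightarrow> 'x::banach \<Rightarrow> 'x) \<Rightarrow>
    ((real \<Rightarrow> 'k) \<Rightarrow> 'x) set \<Rightarrow> ((real \<Rightarrow> 'k) \<Rightarrow> 'x) set" where
  "dist_mean_class scaleK A = {T \<in> distributions scaleK. \<forall>h>0. dist_mean h T \<in> A}"

definition Delta1 ::
  "('k::{real_normed_field,euclidean_space} \<Rightarrow> 'x::banach \<Rightarrow> 'x) \<Rightarrow>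
    ((real \<Rightarrow> 'k) \<Rightarrow> 'x) set \<Rightarrow> bool" where
  "Delta1 scaleK A \<longleftrightarrow>
     (\<forall>f. locally_bochner f \<and> (\<forall>s>0. dist_of scaleK (difference s f) \<in> A)
        \<longrightarrow> dist_of scaleK (\<lambda>t. f t - mean 1 f t) \<in> A)"

end

theory Submission
  imports Defs
begin

text \<open>
  Write \<open>\<D>'\<^sub>A\<close> for \<open>distributional_class scaleK A\<close> and \<open>M\<^sub>h\<close> for the mean over an interval of length
  \<open>h\<close>. Everything rests on the fact that \<open>T\<close> commutes with integrals of test functions that depend
  continuously on a parameter (\<open>dist_integral\<close>). In particular \<open>(M\<^sub>h T) * \<phi> = M\<^sub>h (T * \<phi>) = T * M\<^sub>h \<phi>\<close>,
  and \<open>T * \<phi>\<close> is smooth with derivative \<open>T * \<phi>'\<close>.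

  From right to left it suffices that \<open>T\<close> lies in \<open>\<D>'\<^sub>A\<close> as soon as all \<open>M\<^sub>h T\<close> do, because \<open>A \<subseteq> \<D>'\<^sub>A\<close>. Let
  \<open>f = T * \<phi>\<close>. The difference \<open>\<Delta>\<^sub>s f\<close> is \<open>s\<close> times \<open>M\<^sub>s f' = (M\<^sub>s T) * \<phi>'\<close> and hence belongs to \<open>A\<close>, so that
  condition \<open>\<Delta>\<^sub>1\<close> gives \<open>f - M\<^sub>1 f \<in> A\<close>; and \<open>M\<^sub>1 f = (M\<^sub>1 T) * \<phi>\<close> belongs to \<open>A\<close> as well
  (\<open>dist_mean_class_distributional_class\<close>).

  From left to right, let \<open>T \<in> \<D>'\<^sub>A\<close>. Since \<open>T * \<phi> \<in> A\<close> and the members of \<open>A\<close> have bounded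
  regularisations, \<open>(T * \<phi>) * \<psi>\<close> is bounded for all test functions \<open>\<phi>\<close> and \<open>\<psi>\<close>. By the Baire
  category theorem (\<open>bilinear_uniform_boundedness\<close>) there is an order \<open>m\<close> such that its supremum is
  controlled by the first \<open>m\<close> derivatives of \<open>\<phi>\<close> and of \<open>\<psi>\<close>, for supports in a fixed interval. If
  \<open>\<rho>\<^sub>i\<close> is a sequence of mollifiers, then \<open>m + 2\<close> successive means of \<open>\<rho>\<^sub>i\<close> form a Cauchy sequence in
  \<open>C\<^sup>m\<close> (\<open>means_deriv_bound\<close>): the limit is a spline of that smoothness. Distributing \<open>2 (m + 2)\<close> means
  evenly over two mollifiers, one finds that \<open>(T * M \<dots> M \<rho>\<^sub>i) * (M \<dots> M \<rho>\<^sub>i)\<close> converges uniformly. These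
  are smooth members of \<open>A\<close>, so their limit is in \<open>A\<close>; as a distribution, the limit is the iterated
  mean of \<open>T\<close> (\<open>distributional_class_iterated_means\<close>).

  For the supports to stay in the fixed interval, the lengths \<open>h\<close> must be small. The others are
  reached by doubling: \<open>M\<^sub>2\<^sub>h\<close> is the average of \<open>M\<^sub>h\<close> and its translate by \<open>h\<close>
  (\<open>dist_mean_class_small\<close>), and this is where invariance under positive translations enters.
\<close>

section \<open>Smooth functions\<close>

lemma smooth_tower:
  fixes F :: "nat \<Rightarrow> real \<Rightarrow> 'b::real_normed_vector"
  assumes "\<And>n t. (F n has_vector_derivative F (Suc n) t) (at t)"
  shows "smooth (F 0)" "iter_deriv n (F 0) = F n"
proof -
  have *: "iter_deriv n (F 0) = F n" for n
    by (induction n) (auto simp: iter_deriv_def vector_derivative_at[OF assms])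
  then show "iter_deriv n (F 0) = F n" .
  show "smooth (F 0)"
    unfolding smooth_def * using assms differentiableI_vector by blast
qed

lemma smooth_derivative:
  assumes "smooth f"
  shows "(iter_deriv n f has_vector_derivative iter_deriv (Suc n) f t) (at t)"
  using assms unfolding smooth_def iter_deriv_def
  by (simp add: vector_derivative_works[symmetric])

lemma iter_deriv_0 [simp]: "iter_deriv 0 f = f"
  by (simp add: iter_deriv_def)

lemma iter_deriv_iter_deriv: "iter_deriv n (iter_deriv k f) = iter_deriv (n + k) f"
  by (simp add: iter_deriv_def funpow_add)

lemma smooth_iter_deriv: "smooth f \<Longrightarrow> smooth (iter_deriv k f)"
  by (simp add: smooth_def iter_deriv_iter_deriv)

lemma continuous_on_iter_deriv: "smooth f \<Longrightarrow> continuous_on S (iter_deriv n f)"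
  using smooth_derivative[of f n] has_vector_derivative_continuous
  by (metis continuous_at_imp_continuous_on)

lemma continuous_on_smooth: "smooth f \<Longrightarrow> continuous_on S f"
  using continuous_on_iter_deriv[of f S 0] by simp

lemma smooth_bounded_linear:
  assumes f: "smooth f" and L: "bounded_linear L"
  shows "smooth (\<lambda>t. L (f t))" "iter_deriv n (\<lambda>t. L (f t)) = (\<lambda>t. L (iter_deriv n f t))"
  using smooth_tower[of "\<lambda>n t. L (iter_deriv n f t)"]
    bounded_linear.has_vector_derivative[OF L smooth_derivative[OF f]] by auto

lemma smooth_affine:
  assumes f: "smooth f"
  shows "smooth (\<lambda>t. f (c * t + a))"
    "iter_deriv n (\<lambda>t. f (c * t + a)) = (\<lambda>t. c ^ n *\<^sub>R iter_deriv n f (c * t + a))"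
proof -
  have "((\<lambda>t. c ^ n *\<^sub>R iter_deriv n f (c * t + a)) has_vector_derivative
      c ^ Suc n *\<^sub>R iter_deriv (Suc n) f (c * t + a)) (at t)" for n t
  proof -
    have "((\<lambda>t. c * t + a) has_vector_derivative c) (at t)"
      unfolding has_real_derivative_iff_has_vector_derivative[symmetric]
      by (auto intro!: derivative_eq_intros)
    then have "((\<lambda>t. iter_deriv n f (c * t + a)) has_vector_derivative
        c *\<^sub>R iter_deriv (Suc n) f (c * t + a)) (at t)"
      using vector_diff_chain_at[of "\<lambda>t. c * t + a" c t "iter_deriv n f"] smooth_derivative[OF f]
      by (auto simp: o_def)
    from has_vector_derivative_scaleR[OF DERIV_const this, of "c ^ n"]
    show ?thesis by (simp add: mult.commute)
  qed
  from smooth_tower[of "\<lambda>n t. c ^ n *\<^sub>R iter_deriv n f (c * t + a)", OF this]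
  show "smooth (\<lambda>t. f (c * t + a))"
    "iter_deriv n (\<lambda>t. f (c * t + a)) = (\<lambda>t. c ^ n *\<^sub>R iter_deriv n f (c * t + a))"
    by simp_all
qed

lemma smooth_translate:
  assumes "smooth f"
  shows "smooth (\<lambda>t. f (t + a))" "iter_deriv n (\<lambda>t. f (t + a)) = (\<lambda>t. iter_deriv n f (t + a))"
  using smooth_affine[OF assms, where c = 1 and a = a] by simp_all

lemma smooth_reflect:
  assumes "smooth f"
  shows "smooth (\<lambda>t. f (a - t))"
    "iter_deriv n (\<lambda>t. f (a - t)) = (\<lambda>t. (- 1) ^ n *\<^sub>R iter_deriv n f (a - t))"
  using smooth_affine[OF assms, where c = "-1" and a = a] by simp_all

lemma smooth_add:
  assumes "smooth f" "smooth g"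
  shows "smooth (\<lambda>t. f t + g t)"
    "iter_deriv n (\<lambda>t. f t + g t) = (\<lambda>t. iter_deriv n f t + iter_deriv n g t)"
  using smooth_tower[of "\<lambda>n t. iter_deriv n f t + iter_deriv n g t"]
    has_vector_derivative_add[OF smooth_derivative smooth_derivative, OF assms] by auto

lemma smooth_diff:
  assumes "smooth f" "smooth g"
  shows "smooth (\<lambda>t. f t - g t)"
    "iter_deriv n (\<lambda>t. f t - g t) = (\<lambda>t. iter_deriv n f t - iter_deriv n g t)"
  using smooth_tower[of "\<lambda>n t. iter_deriv n f t - iter_deriv n g t"]
    has_vector_derivative_diff[OF smooth_derivative smooth_derivative, OF assms] by auto

lemmas smooth_scaleR = smooth_bounded_linear[OF _ bounded_linear_scaleR_right]

lemma smooth_zero: "smooth (\<lambda>t. 0)" "iter_deriv n (\<lambda>t. 0) = (\<lambda>t. 0)"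
  using smooth_tower[of "\<lambda>n t. 0"] by auto

text \<open>\<open>n\<close>-fold differentiability by recursion: products are treated by induction on \<open>n\<close>,
  without a formula for the derivatives of a product.\<close>

fun differentiable_times :: "nat \<Rightarrow> (real \<Rightarrow> 'b::real_normed_vector) \<Rightarrow> bool" where
  "differentiable_times 0 f \<longleftrightarrow> True"
| "differentiable_times (Suc n) f \<longleftrightarrow>
     (\<exists>f'. (\<forall>t. (f has_vector_derivative f' t) (at t)) \<and> differentiable_times n f')"

lemma differentiable_times_imp:
  "differentiable_times (Suc n) f \<Longrightarrow> iter_deriv n f differentiable (at t)"
proof (induction n arbitrary: f)
  case 0
  then show ?case by (auto intro: differentiableI_vector)
next
  case (Suc n)
  then obtain f' where f': "\<And>t. (f has_vector_derivative f' t) (at t)"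
    and d: "differentiable_times (Suc n) f'" by auto
  have "iter_deriv 1 f = f'" using vector_derivative_at[OF f'] by (auto simp: iter_deriv_def)
  then have "iter_deriv (Suc n) f = iter_deriv n f'"
    using iter_deriv_iter_deriv[of n 1 f] by simp
  then show ?case using Suc.IH[OF d] by simp
qed

lemma smooth_iff_differentiable_times: "smooth f \<longleftrightarrow> (\<forall>n. differentiable_times n f)"
proof
  assume f: "smooth f"
  have "differentiable_times n (iter_deriv k f)" for n k
    using smooth_derivative[OF f] by (induction n arbitrary: k) auto
  from this[of _ 0] show "\<forall>n. differentiable_times n f" by simp
next
  assume "\<forall>n. differentiable_times n f"
  then show "smooth f" unfolding smooth_def using differentiable_times_imp by blast
qed

lemma differentiable_times_Suc: "differentiable_times (Suc n) f \<Longrightarrow> differentiable_times n f"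
  by (induction n arbitrary: f) (simp, metis differentiable_times.simps(2))

lemma differentiable_times_add:
  "differentiable_times n f \<Longrightarrow> differentiable_times n g \<Longrightarrow> differentiable_times n (\<lambda>t. f t + g t)"
proof (induction n arbitrary: f g)
  case (Suc n)
  then obtain f' g' where "\<And>t. (f has_vector_derivative f' t) (at t)" "differentiable_times n f'"
    "\<And>t. (g has_vector_derivative g' t) (at t)" "differentiable_times n g'" by auto
  then show ?case using Suc.IH
    by (auto intro!: exI[of _ "\<lambda>t. f' t + g' t"] has_vector_derivative_add)
qed auto

lemma differentiable_times_mult:
  fixes f g :: "real \<Rightarrow> real"
  shows "differentiable_times n f \<Longrightarrow> differentiable_times n g \<Longrightarrow> differentiable_times n (\<lambda>t. f t * g t)"
proof (induction n arbitrary: f g)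
  case (Suc n)
  then obtain f' g' where "\<And>t. (f has_vector_derivative f' t) (at t)" "differentiable_times n f'"
    "\<And>t. (g has_vector_derivative g' t) (at t)" "differentiable_times n g'" by auto
  moreover have "differentiable_times n f" "differentiable_times n g"
    using Suc.prems differentiable_times_Suc by blast+
  ultimately show ?case using Suc.IH
    by (auto intro!: exI[of _ "\<lambda>t. f t * g' t + f' t * g t"] has_vector_derivative_mult
        differentiable_times_add)
qed auto

lemma smooth_mult:
  fixes f g :: "real \<Rightarrow> real"
  shows "smooth f \<Longrightarrow> smooth g \<Longrightarrow> smooth (\<lambda>t. f t * g t)"
  by (simp add: smooth_iff_differentiable_times differentiable_times_mult)

lemma smooth_primitive:
  assumes F: "\<And>t. (F has_vector_derivative f t) (at t)" and f: "smooth f"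
  shows "smooth F" "iter_deriv (Suc n) F = iter_deriv n f"
proof -
  have "((case n of 0 \<Rightarrow> F | Suc k \<Rightarrow> iter_deriv k f) has_vector_derivative
      (case Suc n of 0 \<Rightarrow> F | Suc k \<Rightarrow> iter_deriv k f) t) (at t)" for n t
    using F smooth_derivative[OF f] by (cases n) auto
  from smooth_tower[of "\<lambda>n. case n of 0 \<Rightarrow> F | Suc k \<Rightarrow> iter_deriv k f", OF this]
  show "smooth F" "iter_deriv (Suc n) F = iter_deriv n f" by auto
qed

lemma continuous_has_primitive:
  fixes f :: "real \<Rightarrow> 'b::banach"
  assumes "continuous_on UNIV f"
  obtains F where "\<And>t. (F has_vector_derivative f t) (at t)"
proof -
  define F where "F = (\<lambda>t. if t \<ge> 0 then integral {0..t} f else - integral {t..0} f)"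
  have int: "f integrable_on {a..b}" for a b
    using assms continuous_on_subset integrable_continuous_real by blast
  have F: "F t = integral {a..t} f - integral {a..0} f" if "a \<le> 0" "a \<le> t" for a t
    using that unfolding F_def
    by (auto simp: algebra_simps Henstock_Kurzweil_Integration.integral_combine[OF _ _ int, symmetric, of a t 0]
        Henstock_Kurzweil_Integration.integral_combine[OF _ _ int, symmetric, of a 0 t])
  have "(F has_vector_derivative f t) (at t)" for t
  proof -
    define a where "a = min 0 t - 1"
    have a: "a \<le> 0" "a < t" unfolding a_def by auto
    have c: "continuous_on {a..t+1} f" using assms continuous_on_subset by blast
    have "((\<lambda>u. integral {a..u} f) has_vector_derivative f t) (at t within {a..t+1})"
      using integral_has_vector_derivative[OF c, of t] a by auto
    then have "((\<lambda>u. integral {a..u} f) has_vector_derivative f t) (at t)"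
      using a by (simp add: at_within_Icc_at)
    then have "((\<lambda>u. integral {a..u} f - integral {a..0} f) has_vector_derivative f t) (at t)"
      by (auto intro!: derivative_eq_intros)
    then show ?thesis
      using a by (rule_tac has_vector_derivative_transform_within_open[of _ _ _ "{a<..}"]) (auto simp: F)
  qed
  then show ?thesis using that by blast
qed

lemma integral_primitive:
  fixes F :: "real \<Rightarrow> 'b::banach"
  assumes "\<And>t. (F has_vector_derivative f t) (at t)" "a \<le> b"
  shows "integral {a..b} f = F b - F a"
  using fundamental_theorem_of_calculus[of a b F f] assms
  by (meson has_vector_derivative_at_within integral_unique)

text \<open>The family is closed under differentiation, and all its members tend to zero at the origin;
  together this makes them smooth.\<close>

definition flat_exp :: "real poly \<Rightarrow> real \<Rightarrow> real" where
  "flat_exp p t = (if t > 0 then poly p (1 / t) * exp (- (1 / t)) else 0)"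

lemma flat_exp_tendsto_0: "(flat_exp p \<longlongrightarrow> 0) (at 0)"
proof -
  have "((\<lambda>x. poly p x * exp (- x)) \<longlongrightarrow> 0) at_top"
  proof (induction p)
    case (pCons a p)
    have "((\<lambda>x. poly p x / exp x) \<longlongrightarrow> 0) at_top" for p :: "real poly"
    proof -
      have "((\<lambda>x. \<Sum>i\<le>degree p. coeff p i * (x ^ i / exp x)) \<longlongrightarrow> (\<Sum>i\<le>degree p. coeff p i * 0)) at_top"
        by (intro tendsto_intros tendsto_power_div_exp_0)
      then show ?thesis by (simp add: poly_altdef sum_divide_distrib)
    qed
    from this[of "pCons a p"] show ?case by (simp add: exp_minus field_simps)
  qed auto
  then have "((\<lambda>t. poly p (1 / t) * exp (- (1 / t))) \<longlongrightarrow> 0) (at_right 0)"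
    by (rule filterlim_compose) (simp add: filterlim_inverse_at_top_right flip: inverse_eq_divide)
  then have "(flat_exp p \<longlongrightarrow> 0) (at_right 0)"
    by (rule tendsto_cong[THEN iffD1, rotated])
      (auto simp: flat_exp_def eventually_at_right_less intro: eventually_mono[OF eventually_at_right_less[of 0]])
  moreover have "(flat_exp p \<longlongrightarrow> 0) (at_left 0)"
    by (rule tendsto_eventually) (auto simp: flat_exp_def eventually_at_left_field intro: exI[of _ "-1"])
  ultimately show ?thesis by (simp add: filterlim_split_at)
qed

lemma flat_exp_derivative:
  "(flat_exp p has_vector_derivative flat_exp ([:0,0,1:] * (p - pderiv p)) t) (at t)"
proof -
  consider "t > 0" | "t < 0" | "t = 0" by linarith
  then have "(flat_exp p has_real_derivative flat_exp ([:0,0,1:] * (p - pderiv p)) t) (at t)"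
  proof cases
    case 1
    have "((\<lambda>t. poly p (1 / t) * exp (- (1 / t))) has_real_derivative
        flat_exp ([:0,0,1:] * (p - pderiv p)) t) (at t)"
      using 1 by (auto intro!: derivative_eq_intros DERIV_chain2[where f = "poly p"] poly_DERIV
          simp: flat_exp_def field_simps power2_eq_square)
    then show ?thesis
      using 1 by (rule_tac has_field_derivative_transform_within_open[of _ _ _ "{0<..}"])
        (auto simp: flat_exp_def)
  next
    case 2
    have "((\<lambda>t. 0) has_real_derivative 0) (at t)" by simp
    then show ?thesis
      using 2 by (rule_tac has_field_derivative_transform_within_open[of "\<lambda>t. 0" _ _ "{..<0}"])
        (auto simp: flat_exp_def)
  next
    case 3
    have eq: "(flat_exp p h - flat_exp p 0) / h = flat_exp ([:0,1:] * p) h" for h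
      by (auto simp: flat_exp_def field_simps)
    have "((\<lambda>h. (flat_exp p (0 + h) - flat_exp p 0) / h) \<longlongrightarrow> 0) (at 0)"
      using flat_exp_tendsto_0[of "[:0,1:] * p"] by (simp add: eq del: mult_pCons_left)
    then show ?thesis using 3 by (simp add: DERIV_def flat_exp_def)
  qed
  then show ?thesis by (simp add: has_real_derivative_iff_has_vector_derivative)
qed

lemma smooth_flat_exp: "smooth (flat_exp p)"
proof -
  define q where "q n = ((\<lambda>p. [:0,0,1:] * (p - pderiv p)) ^^ n) p" for n
  have "(flat_exp (q n) has_vector_derivative flat_exp (q (Suc n)) t) (at t)" for n t
    unfolding q_def using flat_exp_derivative by simp
  from smooth_tower(1)[of "\<lambda>n. flat_exp (q n)", OF this] show ?thesis
    by (simp add: q_def)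
qed

text \<open>The second primitive serves to compare bumps of different widths: shrinking the bump shrinks the
  distance of the second primitive to the positive part of the identity in proportion.\<close>

lemma ex_bump:
  obtains b B1 B2 :: "real \<Rightarrow> real" and c where
    "smooth B2" "\<And>t. (B2 has_vector_derivative B1 t) (at t)" "\<And>t. (B1 has_vector_derivative b t) (at t)"
    "smooth b" "\<And>t. b t \<ge> 0" "\<And>t. \<bar>t\<bar> \<ge> 1 \<Longrightarrow> b t = 0" "integral {-1..1} b = 1"
    "\<And>t. \<bar>B2 t - max 0 t\<bar> \<le> c"
proof -
  define e where "e t = flat_exp [:1:] (t + 1) * flat_exp [:1:] (1 - t)" for t :: real
  have e: "smooth e" unfolding e_def
    by (intro smooth_mult smooth_translate smooth_reflect smooth_flat_exp)
  have e0: "e t \<ge> 0" "\<bar>t\<bar> \<ge> 1 \<Longrightarrow> e t = 0" "\<bar>t\<bar> < 1 \<Longrightarrow> e t > 0" for t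
    by (auto simp: e_def flat_exp_def)
  have ce: "continuous_on S e" for S using e by (rule continuous_on_smooth)
  define I where "I = integral {-1..1} e"
  have "I \<noteq> 0"
    using integral_eq_0_iff[of "-1" 1 e] ce e0(1) e0(3)[of 0] unfolding I_def by force
  moreover have "I \<ge> 0" unfolding I_def by (rule integral_nonneg) (auto simp: e0 intro: integrable_continuous_real ce)
  ultimately have I: "I > 0" by simp
  define b where "b t = e t / I" for t
  have b_eq: "b = (\<lambda>t. (1 / I) *\<^sub>R e t)" by (auto simp: b_def)
  have b: "smooth b" unfolding b_eq by (rule smooth_scaleR(1)[OF e])
  have b0: "b t \<ge> 0" "\<bar>t\<bar> \<ge> 1 \<Longrightarrow> b t = 0" for t using e0[of t] I by (auto simp: b_def)
  have bI: "integral {-1..1} b = 1" unfolding b_def using I by (simp add: I_def)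
  have cb: "continuous_on UNIV b" using b by (rule continuous_on_smooth)
  obtain G where G: "\<And>t. (G has_vector_derivative b t) (at t)"
    using continuous_has_primitive[OF cb] by blast
  define B1 where "B1 t = G t - G (-1)" for t
  have B1: "(B1 has_vector_derivative b t) (at t)" for t
    unfolding B1_def using G by (auto intro!: derivative_eq_intros)
  have sB1: "smooth B1" by (rule smooth_primitive[OF B1 b])
  obtain H where H: "\<And>t. (H has_vector_derivative B1 t) (at t)"
    using continuous_has_primitive[OF continuous_on_smooth[OF sB1]] by blast
  define B2 where "B2 t = H t - H (-1)" for t
  have B2: "(B2 has_vector_derivative B1 t) (at t)" for t
    unfolding B2_def using H by (auto intro!: derivative_eq_intros)
  have sB2: "smooth B2" by (rule smooth_primitive[OF B2 sB1])
  have z: "integral {u..v} b = 0" if "\<And>t. t \<in> {u..v} \<Longrightarrow> \<bar>t\<bar> \<ge> 1" for u v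
    using integral_cong[of "{u..v}" b "\<lambda>_. 0"] that b0(2) by simp
  have B1l: "B1 t = 0" if "t \<le> -1" for t
    using integral_primitive[OF B1 that] z[of t "-1"] by (auto simp: B1_def)
  have B1r: "B1 t = 1" if "t \<ge> 1" for t
    using integral_primitive[OF B1 that] z[of 1 t] integral_primitive[OF B1, of "-1" 1] bI B1l[of "-1"] by auto
  have B2l: "B2 t = 0" if "t \<le> -1" for t
    using integral_primitive[OF B2 that] integral_cong[of "{t..-1}" B1 "\<lambda>_. 0"] B1l by (auto simp: B2_def)
  have B2r: "B2 t = B2 1 + (t - 1)" if "t \<ge> 1" for t
    using integral_primitive[OF B2 that] integral_cong[of "{1..t}" B1 "\<lambda>_. 1"] B1r that by auto
  have "continuous_on {-1..1} (\<lambda>t. B2 t - max 0 t)"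
    by (intro continuous_intros continuous_on_smooth[OF sB2])
  then have "compact ((\<lambda>t. B2 t - max 0 t) ` {-1..1})" by (rule compact_continuous_image) simp
  then obtain c where c: "\<And>t. t \<in> {-1..1} \<Longrightarrow> \<bar>B2 t - max 0 t\<bar> \<le> c"
    using compact_imp_bounded[of "(\<lambda>t. B2 t - max 0 t) ` {-1..1}"] unfolding bounded_iff by force
  have c2: "\<bar>B2 t - max 0 t\<bar> \<le> c" for t
    using c[of t] c[of 1] c[of "-1"] B2l[of t] B2l[of "-1"] B2r[of t]
    by (cases "t < -1"; cases "t > 1") auto
  show ?thesis using that[OF sB2 B2 B1 b b0 bI c2] by simp
qed

section \<open>Test functions\<close>

abbreviation test_on :: "real \<Rightarrow> (real \<Rightarrow> 'k::real_normed_field) set" where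
  "test_on R \<equiv> test_functions_on {-R..R}"

lemma test_on_iff: "\<phi> \<in> test_on R \<longleftrightarrow> smooth \<phi> \<and> (\<forall>t. \<bar>t\<bar> > R \<longrightarrow> \<phi> t = 0)"
proof -
  have "closure {t. \<phi> t \<noteq> 0} \<subseteq> {-R..R} \<longleftrightarrow> (\<forall>t. \<bar>t\<bar> > R \<longrightarrow> \<phi> t = 0)"
  proof
    assume "\<forall>t. \<bar>t\<bar> > R \<longrightarrow> \<phi> t = 0"
    then have "{t. \<phi> t \<noteq> 0} \<subseteq> {-R..R}" by (force simp: not_less)
    then show "closure {t. \<phi> t \<noteq> 0} \<subseteq> {-R..R}" by (simp add: closure_minimal)
  next
    assume "closure {t. \<phi> t \<noteq> 0} \<subseteq> {-R..R}"
    then have "{t. \<phi> t \<noteq> 0} \<subseteq> {-R..R}" by (rule order_trans[OF closure_subset])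
    then show "\<forall>t. \<bar>t\<bar> > R \<longrightarrow> \<phi> t = 0" unfolding subset_iff by (auto simp: abs_le_iff not_le[symmetric])
  qed
  moreover have "compact (closure {t. \<phi> t \<noteq> 0})" if "closure {t. \<phi> t \<noteq> 0} \<subseteq> {-R..R}"
    using that by (meson bounded_closed_interval bounded_subset closed_closure compact_eq_bounded_closed)
  ultimately show ?thesis
    by (auto simp: test_functions_on_def test_functions_def)
qed

lemma test_on_outside:
  assumes "\<phi> \<in> test_on R" "t \<notin> {-R..R}"
  shows "\<phi> t = 0"
proof -
  have "\<bar>t\<bar> > R" using assms(2) by auto
  then show ?thesis using assms(1) by (simp add: test_on_iff)
qed

lemma test_functions_iff: "\<phi> \<in> test_functions \<longleftrightarrow> (\<exists>R. \<phi> \<in> test_on R)"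
proof
  assume \<phi>: "\<phi> \<in> test_functions"
  then have "bounded (closure {t. \<phi> t \<noteq> 0})"
    by (simp add: test_functions_def compact_imp_bounded)
  then obtain R where "\<And>t. t \<in> closure {t. \<phi> t \<noteq> 0} \<Longrightarrow> \<bar>t\<bar> \<le> R"
    unfolding bounded_real by blast
  then have "closure {t. \<phi> t \<noteq> 0} \<subseteq> {-R..R}" by (metis abs_le_D1 abs_le_D2 atLeastAtMost_iff minus_le_iff subsetI)
  with \<phi> show "\<exists>R. \<phi> \<in> test_on R"
    unfolding test_functions_on_def by blast
next
  assume "\<exists>R. \<phi> \<in> test_on R"
  then show "\<phi> \<in> test_functions" unfolding test_functions_on_def by blast
qed

lemma test_on_mono: "\<phi> \<in> test_on R \<Longrightarrow> R \<le> S \<Longrightarrow> \<phi> \<in> test_on S"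
  unfolding test_on_iff by (meson le_less_trans)

lemma test_on_test: "\<phi> \<in> test_on R \<Longrightarrow> \<phi> \<in> test_functions"
  unfolding test_functions_iff by blast

lemma test_functionsE:
  assumes "\<phi> \<in> test_functions"
  obtains R where "R \<ge> r" "\<phi> \<in> test_on R"
proof -
  obtain S where "\<phi> \<in> test_on S" using assms test_functions_iff by blast
  then show ?thesis using that[of "max r S"] test_on_mono[of \<phi> S "max r S"] by simp
qed

lemma test_smooth: "\<phi> \<in> test_functions \<Longrightarrow> smooth \<phi>"
  by (simp add: test_functions_def)

lemma test_on_iter_deriv:
  assumes "\<phi> \<in> test_on R"
  shows "iter_deriv k \<phi> \<in> test_on R"
proof -
  have \<phi>: "smooth \<phi>" "\<And>t. \<bar>t\<bar> > R \<Longrightarrow> \<phi> t = 0" using assms by (auto simp: test_on_iff)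
  have "iter_deriv k \<phi> t = 0" if "\<bar>t\<bar> > R" for t
    using that
  proof (induction k arbitrary: t)
    case (Suc k)
    have "open {t. \<bar>t\<bar> > R}" by (intro open_Collect_less continuous_intros)
    then have "((\<lambda>_. 0) has_vector_derivative iter_deriv (Suc k) \<phi> t) (at t)"
      by (rule has_vector_derivative_transform_within_open[OF smooth_derivative[OF \<phi>(1)]])
        (use Suc in auto)
    then show ?case using vector_derivative_at by fastforce
  qed (simp add: \<phi>)
  then show ?thesis by (simp add: test_on_iff smooth_iter_deriv[OF \<phi>(1)])
qed

lemma test_iter_deriv: "\<phi> \<in> test_functions \<Longrightarrow> iter_deriv k \<phi> \<in> test_functions"
  using test_on_iter_deriv unfolding test_functions_iff by blast

lemma test_bounded:
  assumes "\<phi> \<in> test_functions"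
  obtains M where "M > 0" "\<And>t. norm (\<phi> t) \<le> M"
proof -
  obtain R where R: "\<phi> \<in> test_on R" using assms test_functions_iff by blast
  have "compact (\<phi> ` {-R..R})"
    by (intro compact_continuous_image continuous_on_smooth test_smooth assms) simp
  then obtain M where M: "\<And>t. t \<in> {-R..R} \<Longrightarrow> norm (\<phi> t) \<le> M"
    using compact_imp_bounded[of "\<phi> ` {-R..R}"] unfolding bounded_iff by (metis imageI)
  have "norm (\<phi> t) \<le> max M 1" for t
  proof (cases "\<bar>t\<bar> > R")
    case True
    then show ?thesis using R by (simp add: test_on_iff)
  next
    case False
    then have "t \<in> {-R..R}" by auto
    then show ?thesis using M[of t] by simp
  qed
  then show ?thesis using that[of "max M 1"] by simp
qed

lemma test_bounded_upto:
  assumes "\<phi> \<in> test_functions"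
  obtains M where "M > 0" "\<And>k t. k \<le> m \<Longrightarrow> norm (iter_deriv k \<phi> t) \<le> M"
proof -
  have "\<exists>M>0. \<forall>k\<le>m. \<forall>t. norm (iter_deriv k \<phi> t) \<le> M"
  proof (induction m)
    case 0
    then show ?case using test_bounded[OF assms] by auto
  next
    case (Suc m)
    then obtain M where M: "M > 0" "\<And>k t. k \<le> m \<Longrightarrow> norm (iter_deriv k \<phi> t) \<le> M" by blast
    obtain M' where M': "M' > 0" "\<And>t. norm (iter_deriv (Suc m) \<phi> t) \<le> M'"
      using test_bounded[OF test_iter_deriv[OF assms]] by blast
    show ?case
      using M M' by (intro exI[of _ "max M M'"]) (auto simp: le_Suc_eq le_max_iff_disj)
  qed
  then show ?thesis using that by blast
qed

lemma smooth_lipschitz: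
  assumes f: "smooth f" and M: "\<And>t. norm (iter_deriv (Suc 0) f t) \<le> M"
  shows "norm (f s - f t) \<le> M * \<bar>s - t\<bar>"
proof -
  have "norm (f s - f t) \<le> M * norm (s - t)"
  proof (rule differentiable_bound[of UNIV f "\<lambda>x h. h *\<^sub>R iter_deriv (Suc 0) f x"])
    show "onorm (\<lambda>h. h *\<^sub>R iter_deriv (Suc 0) f x) \<le> M" for x
      by (intro onorm_le) (simp add: mult.commute[of M] mult_left_mono M)
    show "(f has_derivative (\<lambda>h. h *\<^sub>R iter_deriv (Suc 0) f x)) (at x within UNIV)" for x
      using smooth_derivative[OF f, of 0 x] by (simp add: has_vector_derivative_def)
  qed simp_all
  then show ?thesis by simp
qed

lemma test_uniformly_continuous:
  assumes "\<phi> \<in> test_functions" "\<epsilon> > 0"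
  obtains \<eta> where "\<eta> > 0" "\<And>s t. \<bar>s - t\<bar> \<le> \<eta> \<Longrightarrow> norm (\<phi> s - \<phi> t) \<le> \<epsilon>"
proof -
  obtain M where M: "M > 0" "\<And>t. norm (iter_deriv (Suc 0) \<phi> t) \<le> M"
    using test_bounded[OF test_iter_deriv[OF assms(1)]] by blast
  have "norm (\<phi> s - \<phi> t) \<le> \<epsilon>" if "\<bar>s - t\<bar> \<le> \<epsilon> / M" for s t
  proof -
    have "norm (\<phi> s - \<phi> t) \<le> M * \<bar>s - t\<bar>"
      by (rule smooth_lipschitz[OF test_smooth[OF assms(1)] M(2)])
    also have "\<dots> \<le> M * (\<epsilon> / M)" using that M(1) by (intro mult_left_mono) auto
    finally show ?thesis using M by simp
  qed
  then show ?thesis using that[of "\<epsilon> / M"] M(1) assms(2) by simp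
qed

lemma test_on_lincomb:
  assumes "\<phi> \<in> test_on R" "\<psi> \<in> test_on R"
  shows "(\<lambda>t. a * \<phi> t + b * \<psi> t) \<in> test_on R"
  using test_smooth[OF test_functions_lincomb[OF assms[THEN test_on_test], of a b]] assms
  by (simp add: test_on_iff)

lemma test_on_zero: "(\<lambda>t. 0) \<in> test_on R"
  by (simp add: test_on_iff smooth_zero)

lemma test_on_add: "\<phi> \<in> test_on R \<Longrightarrow> \<psi> \<in> test_on R \<Longrightarrow> (\<lambda>t. \<phi> t + \<psi> t) \<in> test_on R"
  using test_on_lincomb[of \<phi> R \<psi> 1 1] by simp

lemma test_on_diff: "\<phi> \<in> test_on R \<Longrightarrow> \<psi> \<in> test_on R \<Longrightarrow> (\<lambda>t. \<phi> t - \<psi> t) \<in> test_on R"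
  using test_on_lincomb[of \<phi> R \<psi> 1 "-1"] by simp

lemma test_on_mult: "\<phi> \<in> test_on R \<Longrightarrow> (\<lambda>t. a * \<phi> t) \<in> test_on R"
  using test_on_lincomb[of \<phi> R \<phi> a 0] by simp

lemma test_on_scaleR: "\<phi> \<in> test_on R \<Longrightarrow> (\<lambda>t. a *\<^sub>R \<phi> t) \<in> test_on R"
  using test_on_mult[of \<phi> R "of_real a"] by (simp add: scaleR_conv_of_real)

lemma test_on_reflect:
  assumes "\<phi> \<in> test_on R" "\<bar>x\<bar> \<le> B"
  shows "(\<lambda>y. \<phi> (x - y)) \<in> test_on (R + B)"
  using assms smooth_reflect(1)[of \<phi> x] unfolding test_on_iff by simp

lemma test_on_translate:
  assumes "\<phi> \<in> test_on R" "\<bar>x\<bar> \<le> B"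
  shows "(\<lambda>y. \<phi> (y + x)) \<in> test_on (R + B)"
  using assms smooth_translate(1)[of \<phi> x] unfolding test_on_iff by simp

lemma test_reflect: "\<phi> \<in> test_functions \<Longrightarrow> (\<lambda>y. \<phi> (x - y)) \<in> test_functions"
  using test_on_reflect[of \<phi> _ x "\<bar>x\<bar>"] unfolding test_functions_iff by blast

lemma test_translate: "\<phi> \<in> test_functions \<Longrightarrow> (\<lambda>y. \<phi> (y + x)) \<in> test_functions"
  using test_on_translate[of \<phi> _ x "\<bar>x\<bar>"] unfolding test_functions_iff by blast

abbreviation derivs_le :: "nat \<Rightarrow> (real \<Rightarrow> 'b::real_normed_vector) \<Rightarrow> real \<Rightarrow> bool" where
  "derivs_le m f d \<equiv> \<forall>k\<le>m. \<forall>t. norm (iter_deriv k f t) \<le> d"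

section \<open>Distributions and their local order\<close>

locale banach_space_over =
  fixes scaleK :: "'k::{real_normed_field,euclidean_space} \<Rightarrow> 'x::banach \<Rightarrow> 'x"
  assumes normed_space_over: "normed_space_over scaleK"
begin

sublocale vector_space scaleK
  using normed_space_over by (simp add: normed_space_over_def)

lemma scaleK_of_real: "scaleK (of_real r) x = r *\<^sub>R x"
  using normed_space_over by (simp add: normed_space_over_def)

lemma norm_scaleK: "norm (scaleK c x) = norm c * norm x"
  using normed_space_over by (simp add: normed_space_over_def)

lemma bounded_bilinear_scaleK: "bounded_bilinear scaleK"
proof
  fix r :: real and a b :: 'k and x y :: 'x
  show "scaleK (a + b) x = scaleK a x + scaleK b x" "scaleK a (x + y) = scaleK a x + scaleK a y"
    by (rule scale_left_distrib scale_right_distrib)+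
  have r: "r *\<^sub>R y = scaleK (of_real r) y" for y by (simp add: scaleK_of_real)
  show "scaleK (r *\<^sub>R a) x = r *\<^sub>R scaleK a x" "scaleK a (r *\<^sub>R x) = r *\<^sub>R scaleK a x"
    unfolding r scaleR_conv_of_real by (simp_all add: mult.commute)
  show "\<exists>K. \<forall>a b. norm (scaleK a b) \<le> norm a * norm b * K"
    by (intro exI[of _ 1]) (simp add: norm_scaleK)
qed

abbreviation (input) "\<D>' \<equiv> distributions scaleK"

lemma dist_lincomb:
  assumes "T \<in> \<D>'" "\<phi> \<in> test_functions" "\<psi> \<in> test_functions"
  shows "T (\<lambda>t. a * \<phi> t + b * \<psi> t) = scaleK a (T \<phi>) + scaleK b (T \<psi>)"
  using assms by (simp add: distributions_def)

lemma dist_add: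
  assumes "T \<in> \<D>'" "\<phi> \<in> test_functions" "\<psi> \<in> test_functions"
  shows "T (\<lambda>t. \<phi> t + \<psi> t) = T \<phi> + T \<psi>"
  using dist_lincomb[OF assms, of 1 1] by simp

lemma dist_diff:
  assumes "T \<in> \<D>'" "\<phi> \<in> test_functions" "\<psi> \<in> test_functions"
  shows "T (\<lambda>t. \<phi> t - \<psi> t) = T \<phi> - T \<psi>"
  using dist_lincomb[OF assms, of 1 "-1"] by simp

lemma dist_mult:
  assumes "T \<in> \<D>'" "\<phi> \<in> test_functions"
  shows "T (\<lambda>t. a * \<phi> t) = scaleK a (T \<phi>)"
  using dist_lincomb[OF assms assms(2), of a 0] by simp

lemma dist_scaleR:
  assumes "T \<in> \<D>'" "\<phi> \<in> test_functions"
  shows "T (\<lambda>t. r *\<^sub>R \<phi> t) = r *\<^sub>R T \<phi>"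
  using dist_mult[OF assms, of "of_real r"] by (simp add: scaleK_of_real scaleR_conv_of_real[of r "\<phi> _"])

lemma dist_zero: "T \<in> \<D>' \<Longrightarrow> T (\<lambda>t. 0) = 0"
  using dist_mult[of T "\<lambda>t. 0" 0] test_on_test[OF test_on_zero[of 0]] by simp

lemma dist_sum:
  assumes T: "T \<in> \<D>'" and \<phi>: "\<And>i. i < N \<Longrightarrow> \<phi> i \<in> test_on R"
  shows "T (\<lambda>t. \<Sum>i<N. \<phi> i t) = (\<Sum>i<(N::nat). T (\<phi> i))" "(\<lambda>t. \<Sum>i<N. \<phi> i t) \<in> test_on R"
  using \<phi>
proof (induction N)
  case 0
  { case 1 show ?case by (simp add: dist_zero[OF T]) }
  { case 2 show ?case by (simp add: test_on_zero) }
next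
  case (Suc N)
  { case 1
    show ?case using Suc.IH 1 dist_add[OF T, of "\<lambda>t. \<Sum>i<N. \<phi> i t" "\<phi> N"]
      by (simp add: test_on_test[of _ R]) }
  { case 2
    show ?case using Suc.IH(2) 2 test_on_add[of "\<lambda>t. \<Sum>i<N. \<phi> i t" R "\<phi> N"] by simp }
qed

text \<open>Continuity for the inductive limit topology means finite order on each compact set.\<close>

lemma dist_bound:
  assumes T: "T \<in> \<D>'"
  shows "\<exists>m C. C \<ge> 0 \<and> (\<forall>\<phi> d. \<phi> \<in> test_on R \<longrightarrow>
    derivs_le m \<phi> d \<longrightarrow> norm (T \<phi>) \<le> C * d)"
proof -
  have "continuous_map test_topology euclidean T" using T by (simp add: distributions_def)
  then have "openin test_topology {\<phi> \<in> topspace test_topology. T \<phi> \<in> ball 0 1}"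
    unfolding continuous_map_def using open_openin open_ball by blast
  moreover have "(\<lambda>t. 0) \<in> {\<phi> \<in> topspace test_topology. T \<phi> \<in> ball 0 1}"
    using dist_zero[OF T] test_on_test[OF test_on_zero[of 0]] by (auto simp: topspace_test_topology)
  ultimately obtain V where V: "test_zero_nhd V" "\<And>\<psi>. \<psi> \<in> V \<Longrightarrow> norm (T \<psi>) < 1"
    unfolding openin_test_topology by fastforce
  obtain m \<delta> where \<delta>: "\<delta> > 0" and md: "\<And>\<phi>. \<phi> \<in> test_on R \<Longrightarrow>
      (\<And>k t. k \<le> m \<Longrightarrow> norm (iter_deriv k \<phi> t) < \<delta>) \<Longrightarrow> \<phi> \<in> V"
    using V(1) unfolding test_zero_nhd_def by (metis compact_Icc)
  have pos: "norm (T \<phi>) \<le> 2 / \<delta> * d" if \<phi>: "\<phi> \<in> test_on R" and d: "d > 0"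
    "\<And>k t. k \<le> m \<Longrightarrow> norm (iter_deriv k \<phi> t) \<le> d" for \<phi> d
  proof -
    define r where "r = \<delta> / (2 * d)"
    have r: "r > 0" using \<delta> d by (simp add: r_def)
    have "norm (iter_deriv k (\<lambda>t. r *\<^sub>R \<phi> t) t) < \<delta>" if "k \<le> m" for k t
    proof -
      have "norm (iter_deriv k (\<lambda>t. r *\<^sub>R \<phi> t) t) = r * norm (iter_deriv k \<phi> t)"
        using smooth_scaleR(2)[of \<phi> k r] \<phi> r by (simp add: test_on_iff)
      also have "\<dots> \<le> r * d" using d(2)[OF that] r by simp
      also have "\<dots> < \<delta>" using \<delta> d by (simp add: r_def)
      finally show ?thesis .
    qed
    then have "norm (T (\<lambda>t. r *\<^sub>R \<phi> t)) < 1" using md V(2) test_on_scaleR[OF \<phi>] by blast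
    then have "r * norm (T \<phi>) < 1" using r by (simp add: dist_scaleR[OF T test_on_test[OF \<phi>]])
    then show ?thesis using \<delta> d by (simp add: r_def field_simps)
  qed
  have "norm (T \<phi>) \<le> 2 / \<delta> * d" if \<phi>: "\<phi> \<in> test_on R" and
    d: "\<And>k t. k \<le> m \<Longrightarrow> norm (iter_deriv k \<phi> t) \<le> d" for \<phi> d
  proof (rule field_le_epsilon)
    fix e :: real assume e: "e > 0"
    have "0 \<le> d" using d[of 0 0] norm_ge_zero order_trans by blast
    then have "norm (T \<phi>) \<le> 2 / \<delta> * (d + e * \<delta> / 2)"
      using d e \<delta> by (intro pos[OF \<phi>]) (auto intro: add_nonneg_pos add_increasing2)
    then show "norm (T \<phi>) \<le> 2 / \<delta> * d + e" using \<delta> by (simp add: field_simps)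
  qed
  then show ?thesis using \<delta> by (intro exI[of _ m] exI[of _ "2 / \<delta>"]) simp
qed

lemma distributionsI:
  assumes ext: "T \<in> extensional test_functions"
    and lin: "\<And>\<phi> \<psi> a b. \<phi> \<in> test_functions \<Longrightarrow> \<psi> \<in> test_functions \<Longrightarrow>
        T (\<lambda>t. a * \<phi> t + b * \<psi> t) = scaleK a (T \<phi>) + scaleK b (T \<psi>)"
    and bnd: "\<And>R. \<exists>m C. \<forall>\<phi> d. \<phi> \<in> test_on R \<longrightarrow>
        derivs_le m \<phi> d \<longrightarrow> norm (T \<phi>) \<le> C * d"
  shows "T \<in> \<D>'"
proof -
  have V: "test_zero_nhd {\<psi> \<in> test_functions. norm (T \<psi>) < e}" if e: "e > 0" for e
    unfolding test_zero_nhd_def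
  proof (intro conjI ballI allI impI)
    fix \<phi> \<psi> :: "real \<Rightarrow> 'k" and a b :: 'k
    assume h: "\<phi> \<in> {\<psi> \<in> test_functions. norm (T \<psi>) < e}" "\<psi> \<in> {\<psi> \<in> test_functions. norm (T \<psi>) < e}"
      "norm a + norm b \<le> 1"
    have "norm (T (\<lambda>t. a * \<phi> t + b * \<psi> t)) \<le> norm a * norm (T \<phi>) + norm b * norm (T \<psi>)"
      using h lin norm_triangle_ineq[of "scaleK a (T \<phi>)" "scaleK b (T \<psi>)"] by (simp add: norm_scaleK)
    also have "\<dots> \<le> norm a * max (norm (T \<phi>)) (norm (T \<psi>)) + norm b * max (norm (T \<phi>)) (norm (T \<psi>))"
      by (intro add_mono mult_left_mono) auto
    also have "\<dots> \<le> 1 * max (norm (T \<phi>)) (norm (T \<psi>))"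
      using mult_right_mono[OF h(3), of "max (norm (T \<phi>)) (norm (T \<psi>))"]
      by (simp add: distrib_right le_max_iff_disj)
    also have "\<dots> < e" using h by auto
    finally show "(\<lambda>t. a * \<phi> t + b * \<psi> t) \<in> {\<psi> \<in> test_functions. norm (T \<psi>) < e}"
      using h test_functions_lincomb by auto
  next
    fix K :: "real set" assume "compact K"
    then obtain R where R: "\<And>x. x \<in> K \<Longrightarrow> \<bar>x\<bar> \<le> R"
      using compact_imp_bounded[of K] unfolding bounded_real by blast
    have KR: "test_functions_on K \<subseteq> (test_on R :: (real \<Rightarrow> 'k) set)"
    proof -
      have "K \<subseteq> {-R..R}" using R by (auto simp: abs_le_iff) (metis minus_le_iff)
      then show ?thesis by (auto simp: test_functions_on_def)
    qed
    obtain m C where mC: "\<And>\<phi> d. \<phi> \<in> test_on R \<Longrightarrow>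
        derivs_le m \<phi> d \<Longrightarrow> norm (T \<phi>) \<le> C * d"
      using bnd[of R] by blast
    define d where "d = e / (2 * (\<bar>C\<bar> + 1))"
    have d: "d > 0" using e by (simp add: d_def add_nonneg_pos)
    have "C * d < e"
    proof -
      have "C * d \<le> (\<bar>C\<bar> + 1) * d" using d by (intro mult_right_mono) auto
      also have "\<dots> = e / 2" by (simp add: d_def field_simps)
      finally show ?thesis using e by simp
    qed
    have "\<phi> \<in> {\<psi> \<in> test_functions. norm (T \<psi>) < e}"
      if \<phi>: "\<phi> \<in> test_functions_on K" "\<forall>k\<le>m. \<forall>t. norm (iter_deriv k \<phi> t) < d" for \<phi>
    proof -
      have R: "\<phi> \<in> test_on R" using \<phi>(1) KR by blast
      then have "norm (T \<phi>) \<le> C * d" by (rule mC) (use \<phi>(2) less_imp_le in blast)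
      then show ?thesis using \<open>C * d < e\<close> test_on_test[OF R] by simp
    qed
    with d show "\<exists>m. \<exists>\<delta>>0. \<forall>\<phi>\<in>test_functions_on K. (\<forall>k\<le>m. \<forall>t. norm (iter_deriv k \<phi> t) < \<delta>) \<longrightarrow>
        \<phi> \<in> {\<psi> \<in> test_functions. norm (T \<psi>) < e}"
      by blast
  qed auto
  have "continuous_map test_topology euclidean T"
    unfolding continuous_map_def
  proof (intro conjI allI impI)
    fix W :: "'x set" assume "openin euclidean W"
    then have W: "open W" by simp
    show "openin test_topology {\<phi> \<in> topspace test_topology. T \<phi> \<in> W}"
      unfolding openin_test_topology topspace_test_topology
    proof (intro conjI ballI)
      fix \<phi> assume \<phi>: "\<phi> \<in> {\<phi> \<in> test_functions. T \<phi> \<in> W}"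
      then obtain e where e: "e > 0" "ball (T \<phi>) e \<subseteq> W" using W open_contains_ball by blast
      have "(\<lambda>t. \<phi> t + \<psi> t) \<in> {\<phi> \<in> test_functions. T \<phi> \<in> W}"
        if "\<psi> \<in> {\<psi> \<in> test_functions. norm (T \<psi>) < e}" for \<psi>
        using that \<phi> e lin[of \<phi> \<psi> 1 1] test_functions_lincomb[of \<phi> \<psi> 1 1]
        by (auto simp: subset_iff dist_norm)
      with V[OF e(1)] show "\<exists>V. test_zero_nhd V \<and> (\<forall>\<psi>\<in>V. (\<lambda>t. \<phi> t + \<psi> t) \<in> {\<phi> \<in> test_functions. T \<phi> \<in> W})"
        by blast
    qed auto
  qed auto
  then show ?thesis using ext lin by (simp add: distributions_def)
qed

lemma dist_extensional: "T \<in> \<D>' \<Longrightarrow> T \<in> extensional test_functions"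
  by (simp add: distributions_def)

lemma dist_tendsto:
  assumes T: "T \<in> \<D>'" and \<phi>: "\<phi> \<in> test_on R" and \<Phi>: "\<forall>\<^sub>F i in F. \<Phi> i \<in> test_on R"
    and lim: "\<And>k. uniform_limit UNIV (\<lambda>i. iter_deriv k (\<Phi> i)) (iter_deriv k \<phi>) F"
  shows "((\<lambda>i. T (\<Phi> i)) \<longlongrightarrow> T \<phi>) F"
proof (rule tendstoI)
  fix e :: real assume e: "e > 0"
  obtain m C where C: "C \<ge> 0" and mC: "\<And>\<phi> d. \<phi> \<in> test_on R \<Longrightarrow>
      derivs_le m \<phi> d \<Longrightarrow> norm (T \<phi>) \<le> C * d"
    using dist_bound[OF T, of R] by blast
  define d where "d = e / (2 * (C + 1))"
  have "(C + 1) * d = e / 2" using C by (simp add: d_def divide_simps)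
  moreover have "d > 0" using e C by (simp add: d_def)
  ultimately have d: "d > 0" "C * d < e" using e by (simp_all add: distrib_right)
  have "\<forall>\<^sub>F i in F. \<forall>k\<in>{..m}. \<forall>t\<in>UNIV. dist (iter_deriv k (\<Phi> i) t) (iter_deriv k \<phi> t) < d"
    using lim d(1) by (intro eventually_ball_finite) (auto simp: uniform_limit_iff)
  with \<Phi> show "\<forall>\<^sub>F i in F. dist (T (\<Phi> i)) (T \<phi>) < e"
  proof eventually_elim
    case (elim i)
    have "norm (T (\<lambda>t. \<Phi> i t - \<phi> t)) \<le> C * d"
    proof (rule mC[OF test_on_diff[OF elim(1) \<phi>]], intro allI impI)
      fix k t assume "k \<le> m"
      then show "norm (iter_deriv k (\<lambda>t. \<Phi> i t - \<phi> t) t) \<le> d"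
        using elim(2) smooth_diff(2)[OF test_smooth[OF test_on_test[OF elim(1)]]
            test_smooth[OF test_on_test[OF \<phi>]], of k] by (simp add: dist_norm less_imp_le)
    qed
    then show ?case
      using d dist_diff[OF T test_on_test[OF elim(1)] test_on_test[OF \<phi>]] by (simp add: dist_norm)
  qed
qed

end

section \<open>Bochner integrals in non-separable spaces\<close>

text \<open>Sums and products of measurable functions need not be measurable without separability. A
  combination with a simple function is, because each of the finitely many pieces is.\<close>

lemma measurable_simple_combination:
  assumes s: "simple_function M s" and f: "\<And>c. f c \<in> borel_measurable M"
  shows "(\<lambda>t. f (s t) t) \<in> borel_measurable M"
proof (rule measurable_compose_countable'[of "s ` space M"])
  show "s \<in> measurable M (count_space (s ` space M))"
    using s by (subst measurable_count_space_eq_countable)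
      (auto simp: simple_function_def countable_finite)
  show "countable (s ` space M)" using s by (simp add: simple_function_def countable_finite)
qed (rule f)

lemma measurable_diff_simple:
  fixes f :: "'a \<Rightarrow> 'b::real_normed_vector"
  assumes "simple_function M s" and [measurable]: "f \<in> borel_measurable M"
  shows "(\<lambda>t. norm (f t - s t)) \<in> borel_measurable M"
proof -
  have "(\<lambda>t. norm (f t - c)) \<in> borel_measurable M" for c
    by (rule borel_measurable_continuous_on[OF _ assms(2), of "\<lambda>x. norm (x - c)"])
      (intro continuous_intros)
  from measurable_simple_combination[OF assms(1) this] show ?thesis .
qed

abbreviation "step_integrable \<equiv> Bochner_Integration.simple_bochner_integrable"
abbreviation "step_integral \<equiv> Bochner_Integration.simple_bochner_integral"

lemma step_integral_distance:
  fixes f :: "'a \<Rightarrow> 'b::real_normed_vector"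
  assumes f: "f \<in> borel_measurable M"
    and s: "step_integrable M s" and t: "step_integrable M t"
  shows "ennreal (norm (step_integral M s - step_integral M t)) \<le>
    (\<integral>\<^sup>+x. norm (f x - s x) \<partial>M) + (\<integral>\<^sup>+x. norm (f x - t x) \<partial>M)"
proof -
  have sm: "simple_function M s" "simple_function M t"
    using s t by (auto elim: simple_bochner_integrable.cases)
  have st: "step_integrable M (\<lambda>x. s x - t x)"
    using s t by (intro simple_bochner_integrable_compose2[of minus]) auto
  have nst: "step_integrable M (\<lambda>x. norm (s x - t x))"
    using s t by (intro simple_bochner_integrable_compose2[of "\<lambda>x y. norm (x - y)"]) auto
  have "norm (step_integral M s - step_integral M t) \<le> step_integral M (\<lambda>x. norm (s x - t x))"
    using simple_bochner_integral_norm_bound[OF st] simple_bochner_integral_diff[OF s t] by simp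
  then have "ennreal (norm (step_integral M s - step_integral M t)) \<le> (\<integral>\<^sup>+x. norm (s x - t x) \<partial>M)"
    by (simp add: simple_bochner_integral_eq_nn_integral[OF nst, symmetric] ennreal_leI)
  also have "\<dots> \<le> (\<integral>\<^sup>+x. ennreal (norm (f x - s x)) + ennreal (norm (f x - t x)) \<partial>M)"
  proof (intro nn_integral_mono)
    fix x
    have "norm (s x - t x) \<le> norm (f x - s x) + norm (f x - t x)"
      using norm_triangle_ineq4[of "f x - t x" "f x - s x"] by (simp add: add.commute)
    then show "ennreal (norm (s x - t x)) \<le> ennreal (norm (f x - s x)) + ennreal (norm (f x - t x))"
      by (simp flip: ennreal_plus)
  qed
  also have "\<dots> = (\<integral>\<^sup>+x. norm (f x - s x) \<partial>M) + (\<integral>\<^sup>+x. norm (f x - t x) \<partial>M)"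
    using measurable_diff_simple[OF sm(1) f] measurable_diff_simple[OF sm(2) f]
    by (intro nn_integral_add) auto
  finally show ?thesis .
qed

lemma bochner_has_integral_unique:
  assumes "bochner_has_integral M f x" "bochner_has_integral M f y"
  shows "x = y"
proof -
  obtain s where f: "f \<in> borel_measurable M" and s: "\<And>i. step_integrable M (s i)"
    "(\<lambda>i. \<integral>\<^sup>+t. norm (f t - s i t) \<partial>M) \<longlonglongrightarrow> 0" "(\<lambda>i::nat. step_integral M (s i)) \<longlonglongrightarrow> x"
    using assms(1) unfolding bochner_has_integral_def by blast
  obtain t where t: "\<And>i. step_integrable M (t i)"
    "(\<lambda>i. \<integral>\<^sup>+u. norm (f u - t i u) \<partial>M) \<longlonglongrightarrow> 0" "(\<lambda>i::nat. step_integral M (t i)) \<longlonglongrightarrow> y"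
    using assms(2) unfolding bochner_has_integral_def by blast
  have "(\<lambda>i. ennreal (norm (step_integral M (s i) - step_integral M (t i)))) \<longlonglongrightarrow> ennreal (norm (x - y))"
    by (intro tendsto_intros s t)
  moreover have "(\<lambda>i. (\<integral>\<^sup>+u. norm (f u - s i u) \<partial>M) + (\<integral>\<^sup>+u. norm (f u - t i u) \<partial>M)) \<longlonglongrightarrow> 0 + 0"
    by (intro tendsto_intros s t)
  ultimately have "ennreal (norm (x - y)) \<le> 0 + 0"
    by (rule LIMSEQ_le) (intro exI[of _ 0] allI impI step_integral_distance[OF f s(1) t(1)])
  then show ?thesis by simp
qed

lemma bochner_integral_eq: "bochner_has_integral M f x \<Longrightarrow> bochner_integral M f = x"
  unfolding bochner_integral_def using bochner_has_integral_unique by blast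

lemma bochner_has_integral_norm_bound:
  assumes "bochner_has_integral M f x" "(\<integral>\<^sup>+t. norm (f t) \<partial>M) \<le> ennreal B" "B \<ge> 0"
  shows "norm x \<le> B"
proof -
  obtain s where f: "f \<in> borel_measurable M" and s: "\<And>i. step_integrable M (s i)"
    "(\<lambda>i. \<integral>\<^sup>+t. norm (f t - s i t) \<partial>M) \<longlonglongrightarrow> 0" "(\<lambda>i::nat. step_integral M (s i)) \<longlonglongrightarrow> x"
    using assms(1) unfolding bochner_has_integral_def by blast
  have z: "step_integrable M (\<lambda>_. 0::'b)" "step_integral M (\<lambda>_. 0::'b) = 0"
    by (auto intro!: simple_bochner_integrable.intros sum.neutral simp: simple_bochner_integral_def)
  have "(\<lambda>i. ennreal (norm (step_integral M (s i) - 0))) \<longlonglongrightarrow> ennreal (norm (x - 0))"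
    by (intro tendsto_intros s)
  moreover have "(\<lambda>i. (\<integral>\<^sup>+u. norm (f u - s i u) \<partial>M) + (\<integral>\<^sup>+u. norm (f u - 0) \<partial>M)) \<longlonglongrightarrow> 0 + (\<integral>\<^sup>+u. norm (f u - 0) \<partial>M)"
    by (intro tendsto_intros s)
  ultimately have "ennreal (norm (x - 0)) \<le> 0 + (\<integral>\<^sup>+u. norm (f u - 0) \<partial>M)"
    by (rule LIMSEQ_le) (intro exI[of _ 0] allI impI step_integral_distance[OF f s(1) z(1), unfolded z(2)])
  also have "\<dots> \<le> ennreal B" using assms by simp
  finally show ?thesis using assms(3) by simp
qed

lemma bochner_integrableI_approx:
  fixes f :: "'a \<Rightarrow> 'b::banach"
  assumes f: "f \<in> borel_measurable M" and s: "\<And>i. step_integrable M (s i)"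
    and lim: "(\<lambda>i::nat. \<integral>\<^sup>+t. norm (f t - s i t) \<partial>M) \<longlonglongrightarrow> 0"
  shows "bochner_integrable M f"
proof -
  have "Cauchy (\<lambda>i. step_integral M (s i))"
  proof (rule metric_CauchyI)
    fix e :: real assume e: "e > 0"
    then have "\<forall>\<^sub>F i in sequentially. (\<integral>\<^sup>+t. norm (f t - s i t) \<partial>M) < ennreal (e / 2)"
      using lim by (intro order_tendstoD) auto
    then obtain N where N: "\<And>i. i \<ge> N \<Longrightarrow> (\<integral>\<^sup>+t. norm (f t - s i t) \<partial>M) < ennreal (e / 2)"
      unfolding eventually_sequentially by blast
    have "dist (step_integral M (s i)) (step_integral M (s j)) < e" if "i \<ge> N" "j \<ge> N" for i j
    proof -
      have "ennreal (norm (step_integral M (s i) - step_integral M (s j))) < ennreal (e / 2) + ennreal (e / 2)"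
        by (rule le_less_trans[OF step_integral_distance[OF f s s]])
          (intro add_strict_mono N that)
      also have "\<dots> = ennreal e" using e by (simp flip: ennreal_plus)
      finally show ?thesis using e by (simp add: dist_norm ennreal_less_iff)
    qed
    then show "\<exists>N. \<forall>i\<ge>N. \<forall>j\<ge>N. dist (step_integral M (s i)) (step_integral M (s j)) < e" by blast
  qed
  then obtain x where "(\<lambda>i. step_integral M (s i)) \<longlonglongrightarrow> x"
    using Cauchy_convergent_iff convergent_def by blast
  with f s lim show ?thesis
    unfolding bochner_integrable_def bochner_has_integral_def by blast
qed

text \<open>The step functions arise by rounding the argument down to a multiple of \<open>1 / n\<close>; the error is
  controlled by uniform continuity.\<close>

lemma step_approximation:
  fixes f :: "real \<Rightarrow> 'b::real_normed_vector"
  assumes f: "continuous_on UNIV f"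
  obtains s where "\<And>i. simple_function lebesgue (s i)" "\<And>i t. t \<notin> {a..b} \<Longrightarrow> s i t = 0"
    "\<And>i t. norm (indicator {a..b} t *\<^sub>R f t - s i t) \<le> inverse (real (Suc i))"
proof -
  have "\<exists>s. simple_function lebesgue s \<and> (\<forall>t. t \<notin> {a..b} \<longrightarrow> s t = 0) \<and>
      (\<forall>t. norm (indicator {a..b} t *\<^sub>R f t - s t) \<le> e)" if e: "e > 0" for e :: real
  proof -
    have "uniformly_continuous_on {a-1..b} f"
      by (intro compact_uniformly_continuous continuous_on_subset[OF f]) auto
    then obtain d where d: "d > 0" "\<And>x y. x \<in> {a-1..b} \<Longrightarrow> y \<in> {a-1..b} \<Longrightarrow> dist y x < d \<Longrightarrow> dist (f y) (f x) < e"
      using e unfolding uniformly_continuous_on_def by blast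
    obtain n :: nat where n: "n > 0" "inverse (real n) < min d 1"
      using ex_inverse_of_nat_less[of "min d 1"] d(1) by auto
    define q where "q t = of_int \<lfloor>real n * t\<rfloor> / real n" for t :: real
    have q: "q t \<le> t" "t - q t < min d 1" for t
    proof -
      have "of_int \<lfloor>real n * t\<rfloor> \<le> real n * t" by simp
      then show "q t \<le> t" using n by (simp add: q_def field_simps)
      have "real n * t < of_int \<lfloor>real n * t\<rfloor> + 1" by linarith
      then have "t < (of_int \<lfloor>real n * t\<rfloor> + 1) / real n"
        using n(1) by (simp add: pos_less_divide_eq mult.commute)
      then have "t - q t < inverse (real n)" by (simp add: q_def add_divide_distrib inverse_eq_divide)
      then show "t - q t < min d 1" using n by simp
    qed
    define s where "s t = (if t \<in> {a..b} then f (q t) else 0)" for t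
    have "simple_function lebesgue s"
    proof -
      have [measurable]: "q \<in> borel_measurable borel" unfolding q_def by measurable
      have fin: "finite (q ` {a..b})"
      proof (rule finite_subset)
        show "q ` {a..b} \<subseteq> (\<lambda>k. of_int k / real n) ` {\<lfloor>real n * a\<rfloor>..\<lfloor>real n * b\<rfloor>}"
          unfolding q_def by (auto intro!: imageI floor_mono mult_left_mono)
      qed simp
      \<comment> \<open>The value \<open>a - 1\<close> marks the points outside the interval: \<open>q\<close> exceeds it on \<open>{a..b}\<close>.\<close>
      define q' where "q' t = (if t \<in> {a..b} then q t else a - 1)" for t
      have "q' \<in> borel_measurable borel" unfolding q'_def by measurable
      then have "q' \<in> borel_measurable lebesgue" by (simp add: measurable_completion)
      moreover have "q' ` space lebesgue \<subseteq> insert (a - 1) (q ` {a..b})" by (auto simp: q'_def)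
      then have "finite (q' ` space lebesgue)" by (rule finite_subset) (simp add: fin)
      ultimately have "simple_function lebesgue q'" by (rule simple_function_borel_measurable)
      then have "simple_function lebesgue (\<lambda>t. if q' t = a - 1 then 0 else f (q' t))"
        by (rule simple_function_compose1)
      moreover have "(\<lambda>t. if q' t = a - 1 then 0 else f (q' t)) = s"
      proof
        fix t
        show "(if q' t = a - 1 then 0 else f (q' t)) = s t"
        proof (cases "t \<in> {a..b}")
          case True
          then have "q t \<noteq> a - 1" using q[of t] by auto
          then show ?thesis using True by (simp add: s_def q'_def)
        next
          case False
          then show ?thesis by (auto simp: s_def q'_def)
        qed
      qed
      ultimately show ?thesis by simp
    qed
    moreover have "norm (indicator {a..b} t *\<^sub>R f t - s t) \<le> e" for t
    proof (cases "t \<in> {a..b}")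
      case True
      then have "dist (f t) (f (q t)) < e"
        using q[of t] by (intro d) (auto simp: dist_real_def)
      then show ?thesis using True by (simp add: s_def dist_norm)
    qed (use e in \<open>auto simp: s_def\<close>)
    ultimately show ?thesis by (intro exI[of _ s]) (simp add: s_def)
  qed
  then have "\<forall>i. \<exists>s. simple_function lebesgue s \<and> (\<forall>t. t \<notin> {a..b} \<longrightarrow> s t = 0) \<and>
      (\<forall>t. norm (indicator {a..b} t *\<^sub>R f t - s t) \<le> inverse (real (Suc i)))"
    by simp
  then obtain s where "\<forall>i. simple_function lebesgue (s i) \<and> (\<forall>t. t \<notin> {a..b} \<longrightarrow> s i t = 0) \<and>
      (\<forall>t. norm (indicator {a..b} t *\<^sub>R f t - s i t) \<le> inverse (real (Suc i)))"
    by metis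
  then show ?thesis using that by blast
qed

lemma step_integrable_interval:
  assumes "simple_function lebesgue s" "\<And>t. t \<notin> {a..b::real} \<Longrightarrow> s t = 0"
  shows "step_integrable lebesgue s"
proof (rule simple_bochner_integrable.intros[OF assms(1)])
  have "{y \<in> space lebesgue. s y \<noteq> 0} = s -` (- {0}) \<inter> space lebesgue" by auto
  moreover have "\<dots> \<in> sets lebesgue" using simple_functionD(2)[OF assms(1)] .
  moreover have "{y \<in> space lebesgue. s y \<noteq> 0} \<subseteq> {a..b}" using assms(2) by blast
  ultimately have "emeasure lebesgue {y \<in> space lebesgue. s y \<noteq> 0} \<le> emeasure lebesgue {a..b}"
    by (intro emeasure_mono) auto
  also have "\<dots> < \<infinity>" by (cases "a \<le> b") auto
  finally show "emeasure lebesgue {y \<in> space lebesgue. s y \<noteq> 0} \<noteq> \<infinity>" by simp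
qed

lemma simple_has_integral:
  fixes s :: "real \<Rightarrow> 'b::banach"
  assumes "step_integrable lebesgue s"
  shows "(s has_integral step_integral lebesgue s) UNIV"
proof -
  have s: "simple_function lebesgue s" "emeasure lebesgue {y \<in> space lebesgue. s y \<noteq> 0} \<noteq> \<infinity>"
    using assms by (auto elim: simple_bochner_integrable.cases)
  have fin: "finite (range s)" using simple_functionD(1)[OF s(1)] by simp
  have "((\<lambda>t. indicator {x. s x = y} t *\<^sub>R y) has_integral measure lebesgue {x. s x = y} *\<^sub>R y) UNIV" for y
  proof (cases "y = 0")
    case False
    have m: "{x. s x = y} \<in> sets lebesgue"
      using simple_functionD(2)[OF s(1), of "{y}"] by (simp add: vimage_def)
    have m0: "{x. s x \<noteq> 0} \<in> sets lebesgue"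
      using simple_functionD(2)[OF s(1), of "-{0}"] by (simp add: vimage_def)
    have "emeasure lebesgue {x. s x = y} \<le> emeasure lebesgue {y \<in> space lebesgue. s y \<noteq> 0}"
      using False m0 by (intro emeasure_mono) auto
    also have "\<dots> < \<infinity>" using s(2) by (simp add: top.not_eq_extremum)
    finally have "{x. s x = y} \<in> lmeasurable" using m by (intro fmeasurableI) auto
    then show ?thesis
      by (intro has_integral_scaleR_left) (simp add: lmeasurable_iff_has_integral)
  qed simp
  then have "((\<lambda>t. \<Sum>y\<in>range s. indicator {x. s x = y} t *\<^sub>R y) has_integral
      (\<Sum>y\<in>range s. measure lebesgue {x. s x = y} *\<^sub>R y)) UNIV"
    by (intro has_integral_sum fin)
  moreover have "(\<lambda>t. \<Sum>y\<in>range s. indicator {x. s x = y} t *\<^sub>R y) = s"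
  proof
    fix t
    have "(\<Sum>y\<in>range s. indicator {x. s x = y} t *\<^sub>R y) = (\<Sum>y\<in>range s. if y = s t then y else 0)"
      by (intro sum.cong) (auto simp: indicator_def)
    then show "(\<Sum>y\<in>range s. indicator {x. s x = y} t *\<^sub>R y) = s t" using fin by simp
  qed
  ultimately show ?thesis by (simp add: simple_bochner_integral_def)
qed

lemma nn_integral_interval_bound:
  assumes "\<And>t. norm (f t) \<le> indicator {a..b::real} t * c" "c \<ge> 0" "a \<le> b"
  shows "(\<integral>\<^sup>+t. norm (f t) \<partial>lebesgue) \<le> ennreal (c * (b - a))"
proof -
  have "(\<integral>\<^sup>+t. norm (f t) \<partial>lebesgue) \<le> (\<integral>\<^sup>+t. ennreal c * indicator {a..b} t \<partial>lebesgue)"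
  proof (intro nn_integral_mono)
    fix t show "ennreal (norm (f t)) \<le> ennreal c * indicator {a..b} t"
      using assms(1)[of t] by (cases "t \<in> {a..b}") (auto intro: ennreal_leI)
  qed
  also have "\<dots> = ennreal c * ennreal (b - a)"
    using assms(3) by (subst nn_integral_cmult_indicator) auto
  finally show ?thesis using assms by (simp add: ennreal_mult')
qed

lemma bochner_integrable_continuous:
  fixes f :: "real \<Rightarrow> 'b::banach"
  assumes f: "continuous_on UNIV f" and K: "compact K"
  shows "bochner_integrable lebesgue (\<lambda>t. indicator K t *\<^sub>R f t)"
proof -
  obtain R where R: "\<And>x. x \<in> K \<Longrightarrow> \<bar>x\<bar> \<le> R"
    using compact_imp_bounded[OF K] unfolding bounded_real by blast
  define a b where "a = - \<bar>R\<bar>" and "b = \<bar>R\<bar>"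
  have ab: "a \<le> b" "K \<subseteq> {a..b}" using R by (fastforce simp: a_def b_def abs_le_iff)+
  obtain s where s: "\<And>i. simple_function lebesgue (s i)" "\<And>i t. t \<notin> {a..b} \<Longrightarrow> s i t = 0"
    "\<And>i t. norm (indicator {a..b} t *\<^sub>R f t - s i t) \<le> inverse (real (Suc i))"
    using step_approximation[OF f, of a b] by metis
  have Km: "K \<in> sets lebesgue" using K by (simp add: lmeasurable_compact fmeasurableD)
  define p where "p i t = indicator K t *\<^sub>R s i t" for i t
  have p: "simple_function lebesgue (p i)" for i
    unfolding p_def using Km s(1) by (intro simple_function_scaleR simple_function_indicator)
  have bound: "norm (indicator K t *\<^sub>R f t - p i t) \<le> indicator {a..b} t * inverse (real (Suc i))" for i t
  proof (cases "t \<in> K")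
    case True
    then have "t \<in> {a..b}" using ab(2) by blast
    with True show ?thesis using s(3)[of t i] by (simp add: p_def)
  qed (simp add: p_def)
  have f_meas: "(\<lambda>t. indicator K t *\<^sub>R f t) \<in> borel_measurable lebesgue"
  proof (rule borel_measurable_LIMSEQ_metric[of p])
    show "p i \<in> borel_measurable lebesgue" for i using p by (rule borel_measurable_simple_function)
    show "(\<lambda>i. p i t) \<longlonglongrightarrow> indicator K t *\<^sub>R f t" for t
    proof (rule Lim_null[THEN iffD2], rule Lim_null_comparison[OF always_eventually LIMSEQ_inverse_real_of_nat], rule allI)
      show "norm (p i t - indicator K t *\<^sub>R f t) \<le> inverse (real (Suc i))" for i
        using bound[of t i] unfolding norm_minus_commute[of "p i t"] by (cases "t \<in> {a..b}") simp_all
    qed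
  qed
  show ?thesis
  proof (rule bochner_integrableI_approx[OF f_meas])
    show "step_integrable lebesgue (p i)" for i
      using ab(2) s(2) by (intro step_integrable_interval[OF p]) (auto simp: p_def)
    show "(\<lambda>i. \<integral>\<^sup>+t. norm (indicator K t *\<^sub>R f t - p i t) \<partial>lebesgue) \<longlonglongrightarrow> 0"
    proof (rule tendsto_sandwich[OF always_eventually always_eventually tendsto_const])
      show "\<forall>i. (\<integral>\<^sup>+t. norm (indicator K t *\<^sub>R f t - p i t) \<partial>lebesgue) \<le> ennreal (inverse (real (Suc i)) * (b - a))"
        by (intro allI nn_integral_interval_bound bound ab) auto
      show "(\<lambda>i. ennreal (inverse (real (Suc i)) * (b - a))) \<longlonglongrightarrow> 0"
        using tendsto_mult_left_zero[OF LIMSEQ_inverse_real_of_nat, of "b - a"] tendsto_ennrealI by fastforce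
    qed simp
  qed
qed

lemma locally_bochner_continuous:
  fixes f :: "real \<Rightarrow> 'b::banach"
  shows "continuous_on UNIV f \<Longrightarrow> locally_bochner f"
  by (simp add: locally_bochner_def bochner_integrable_continuous)

lemma bochner_integral_continuous:
  fixes f :: "real \<Rightarrow> 'b::banach"
  assumes f: "continuous_on UNIV f" and ab: "a \<le> b"
  shows "bochner_integral lebesgue (\<lambda>t. indicator {a..b} t *\<^sub>R f t) = integral {a..b} f"
proof -
  obtain s where s: "\<And>i. simple_function lebesgue (s i)" "\<And>i t. t \<notin> {a..b} \<Longrightarrow> s i t = 0"
    "\<And>i t. norm (indicator {a..b} t *\<^sub>R f t - s i t) \<le> inverse (real (Suc i))"
    using step_approximation[OF f, of a b] by metis
  have si: "step_integrable lebesgue (s i)" for i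
    by (rule step_integrable_interval[OF s(1) s(2)])
  have bound: "norm (indicator {a..b} t *\<^sub>R f t - s i t) \<le> indicator {a..b} t * inverse (real (Suc i))" for i t
    using s(3)[of t i] s(2)[of t i] by (cases "t \<in> {a..b}") auto
  have to0: "(\<lambda>i. inverse (real (Suc i)) * (b - a)) \<longlonglongrightarrow> 0"
    using tendsto_mult_left_zero[OF LIMSEQ_inverse_real_of_nat] by blast
  have fi: "(f has_integral integral {a..b} f) {a..b}"
    by (intro integrable_integral integrable_continuous_real continuous_on_subset[OF f]) simp
  have "norm (step_integral lebesgue (s i) - integral {a..b} f) \<le> inverse (real (Suc i)) * (b - a)" for i
  proof -
    have "(s i has_integral step_integral lebesgue (s i)) {a..b}"
    proof -
      have "(\<lambda>t. if t \<in> {a..b} then s i t else 0) = s i" using s(2) by auto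
      then show ?thesis
        using simple_has_integral[OF si, of i] has_integral_restrict_UNIV[of "{a..b}" "s i"] by simp
    qed
    from has_integral_diff[OF this fi]
    have "norm (step_integral lebesgue (s i) - integral {a..b} f) \<le> inverse (real (Suc i)) * measure lborel {a..b}"
    proof (rule has_integral_bound_real[rotated 2])
      show "norm (s i t - f t) \<le> inverse (real (Suc i))" if "t \<in> {a..b} - {}" for t
        using bound[of t i] that unfolding norm_minus_commute[of "s i t"] by simp
    qed simp_all
    then show ?thesis using ab by simp
  qed
  then have "(\<lambda>i. step_integral lebesgue (s i)) \<longlonglongrightarrow> integral {a..b} f"
    by (rule_tac Lim_null[THEN iffD2], rule_tac Lim_null_comparison[OF always_eventually to0]) blast
  moreover have "(\<lambda>i. \<integral>\<^sup>+t. norm (indicator {a..b} t *\<^sub>R f t - s i t) \<partial>lebesgue) \<longlonglongrightarrow> 0"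
  proof (rule tendsto_sandwich[OF always_eventually always_eventually tendsto_const])
    show "\<forall>i. (\<integral>\<^sup>+t. norm (indicator {a..b} t *\<^sub>R f t - s i t) \<partial>lebesgue) \<le> ennreal (inverse (real (Suc i)) * (b - a))"
      by (intro allI nn_integral_interval_bound bound ab) auto
    show "(\<lambda>i. ennreal (inverse (real (Suc i)) * (b - a))) \<longlonglongrightarrow> 0"
      using tendsto_ennrealI[OF to0] by simp
  qed simp
  moreover have "(\<lambda>t. indicator {a..b} t *\<^sub>R f t) \<in> borel_measurable lebesgue"
    using bochner_integrable_continuous[OF f, of "{a..b}"]
    by (auto simp: bochner_integrable_def bochner_has_integral_def)
  ultimately have "bochner_has_integral lebesgue (\<lambda>t. indicator {a..b} t *\<^sub>R f t) (integral {a..b} f)"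
    using si unfolding bochner_has_integral_def by blast
  then show ?thesis by (rule bochner_integral_eq)
qed

lemma mean_continuous:
  fixes f :: "real \<Rightarrow> 'b::banach"
  assumes f: "continuous_on UNIV f" and h: "h > 0"
  shows "mean h f t = (1 / h) *\<^sub>R integral {t..t+h} f"
    "mean (- h) f t = (1 / h) *\<^sub>R integral {t-h..t} f"
proof -
  have c: "continuous_on UNIV (\<lambda>s. f (t + s))"
    by (intro continuous_on_compose2[OF f] continuous_intros) auto
  have shift: "integral {u..v} (\<lambda>s. f (t + s)) = integral {t+u..t+v} f" for u v
  proof -
    show ?thesis using integral_shift_real_ivl[of "t + u" t "t + v" f] by (simp add: add.commute)
  qed
  show "mean h f t = (1 / h) *\<^sub>R integral {t..t+h} f"
    using h bochner_integral_continuous[OF c, of 0 h] shift[of 0 h]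
    by (simp add: mean_def oriented_integral_def)
  show "mean (- h) f t = (1 / h) *\<^sub>R integral {t-h..t} f"
    using h bochner_integral_continuous[OF c, of "-h" 0] shift[of "-h" 0]
    by (simp add: mean_def oriented_integral_def)
qed

context banach_space_over
begin

text \<open>The product is integrable because products of simple functions approximating the two factors
  approximate it in \<open>L\<^sup>1\<close>; uniform convergence for \<open>\<phi>\<close> compensates for the mere \<open>L\<^sup>1\<close> convergence for \<open>g\<close>.\<close>

lemma pairing_bound:
  assumes g: "locally_bochner g" and C: "AE t in lebesgue. norm (g t) \<le> C" "C \<ge> 0"
    and \<phi>: "\<phi> \<in> test_on R" and R: "R \<ge> 0"
  shows "norm (bochner_integral lebesgue (\<lambda>t. scaleK (\<phi> t) (g t))) \<le> C * integral {-R..R} (\<lambda>t. norm (\<phi> t))"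
proof -
  define h where "h t = indicator {-R..R} t *\<^sub>R g t" for t
  have \<phi>h: "scaleK (\<phi> t) (g t) = scaleK (\<phi> t) (h t)" for t
    using \<phi> by (cases "t \<in> {-R..R}") (auto simp: h_def test_on_iff)
  have "bochner_integrable lebesgue h"
    using g unfolding h_def locally_bochner_def by simp
  then obtain u where h: "h \<in> borel_measurable lebesgue" and u: "\<And>i. step_integrable lebesgue (u i)"
    "(\<lambda>i. \<integral>\<^sup>+t. norm (h t - u i t) \<partial>lebesgue) \<longlonglongrightarrow> 0"
    unfolding bochner_integrable_def bochner_has_integral_def by blast
  have c\<phi>: "continuous_on UNIV \<phi>" using \<phi> by (simp add: test_on_iff continuous_on_smooth)
  obtain s where s: "\<And>i. simple_function lebesgue (s i)" "\<And>i t. t \<notin> {-R..R} \<Longrightarrow> s i t = 0"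
    "\<And>i t. norm (indicator {-R..R} t *\<^sub>R \<phi> t - s i t) \<le> inverse (real (Suc i))"
    using step_approximation[OF c\<phi>, of "-R" R] by metis
  have \<phi>1: "indicator {-R..R} t *\<^sub>R \<phi> t = \<phi> t" for t
    using \<phi> by (cases "t \<in> {-R..R}") (auto simp: test_on_iff)
  have s3: "norm (\<phi> t - s i t) \<le> inverse (real (Suc i))" for i t using s(3)[of t i] by (simp only: \<phi>1)
  obtain M where M: "M > 0" "\<And>t. norm (\<phi> t) \<le> M" using test_bounded[OF test_on_test[OF \<phi>]] by blast
  have sM: "norm (s i t) \<le> M + 1" for i t
  proof -
    have "norm (s i t) \<le> norm (\<phi> t) + norm (\<phi> t - s i t)" by (metis norm_minus_commute norm_triangle_sub)
    also have "inverse (real (Suc i)) \<le> 1" by (simp add: inverse_le_1_iff)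
    then have "norm (\<phi> t) + norm (\<phi> t - s i t) \<le> M + 1" using s3[of t i] M(2)[of t] by linarith
    finally show ?thesis .
  qed
  define p where "p i t = scaleK (s i t) (u i t)" for i t
  have us: "simple_function lebesgue (u i)" for i using u(1) by (auto elim: simple_bochner_integrable.cases)
  have "simple_function lebesgue (p i)" for i
    unfolding p_def by (rule simple_function_compose2[OF s(1) us])
  then have p: "step_integrable lebesgue (p i)" for i
    by (rule step_integrable_interval[of _ "-R" R]) (simp add: p_def s(2))
  have sh: "(\<lambda>t. scaleK (s i t) (h t)) \<in> borel_measurable lebesgue" for i
  proof -
    have "(\<lambda>t. scaleK c (h t)) \<in> borel_measurable lebesgue" for c
      by (rule borel_measurable_continuous_on[OF _ h])
        (intro bounded_linear.continuous_on[OF bounded_bilinear.bounded_linear_right[OF bounded_bilinear_scaleK]] continuous_intros)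
    from measurable_simple_combination[OF s(1) this] show ?thesis .
  qed
  have \<phi>h_meas: "(\<lambda>t. scaleK (\<phi> t) (h t)) \<in> borel_measurable lebesgue"
  proof (rule borel_measurable_LIMSEQ_metric[OF sh])
    show "(\<lambda>i. scaleK (s i t) (h t)) \<longlonglongrightarrow> scaleK (\<phi> t) (h t)" for t
    proof (rule bounded_bilinear.tendsto[OF bounded_bilinear_scaleK _ tendsto_const])
      show "(\<lambda>i. s i t) \<longlonglongrightarrow> \<phi> t"
        using s3[of t] unfolding norm_minus_commute[of "\<phi> t"]
        by (rule_tac Lim_null[THEN iffD2],
            rule_tac Lim_null_comparison[OF always_eventually LIMSEQ_inverse_real_of_nat]) blast
    qed
  qed
  have hC: "AE t in lebesgue. norm (h t) \<le> C * indicator {-R..R} t"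
    using C(1) by eventually_elim (auto simp: h_def indicator_def)
  have lim: "(\<lambda>i. \<integral>\<^sup>+t. norm (scaleK (\<phi> t) (h t) - p i t) \<partial>lebesgue) \<longlonglongrightarrow> 0"
  proof (rule tendsto_sandwich[OF always_eventually always_eventually tendsto_const])
    show "\<forall>i. (\<integral>\<^sup>+t. norm (scaleK (\<phi> t) (h t) - p i t) \<partial>lebesgue) \<le>
        ennreal (inverse (real (Suc i)) * (C * (2 * R))) + ennreal (M + 1) * (\<integral>\<^sup>+t. norm (h t - u i t) \<partial>lebesgue)"
    proof
      fix i
      have "AE t in lebesgue. ennreal (norm (scaleK (\<phi> t) (h t) - p i t)) \<le>
          ennreal (inverse (real (Suc i)) * C) * indicator {-R..R} t + ennreal (M + 1) * ennreal (norm (h t - u i t))"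
        using hC
      proof eventually_elim
        case (elim t)
        have "scaleK (\<phi> t) (h t) - p i t = scaleK (\<phi> t - s i t) (h t) + scaleK (s i t) (h t - u i t)"
          by (simp add: p_def scale_left_diff_distrib scale_right_diff_distrib)
        then have "norm (scaleK (\<phi> t) (h t) - p i t) \<le> norm (\<phi> t - s i t) * norm (h t) + norm (s i t) * norm (h t - u i t)"
          by (metis norm_scaleK norm_triangle_ineq)
        also have "\<dots> \<le> inverse (real (Suc i)) * (C * indicator {-R..R} t) + (M + 1) * norm (h t - u i t)"
          using M(1) by (intro add_mono mult_mono s3 sM elim) auto
        finally show ?case
          using C(2) M(1) by (cases "t \<in> {-R..R}")
            (auto simp flip: ennreal_mult ennreal_plus intro!: ennreal_leI)
      qed
      then have "(\<integral>\<^sup>+t. norm (scaleK (\<phi> t) (h t) - p i t) \<partial>lebesgue) \<le>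
          (\<integral>\<^sup>+t. ennreal (inverse (real (Suc i)) * C) * indicator {-R..R} t + ennreal (M + 1) * ennreal (norm (h t - u i t)) \<partial>lebesgue)"
        by (rule nn_integral_mono_AE)
      also have "\<dots> = ennreal (inverse (real (Suc i)) * C) * emeasure lebesgue {-R..R} + ennreal (M + 1) * (\<integral>\<^sup>+t. norm (h t - u i t) \<partial>lebesgue)"
      proof (subst nn_integral_add)
        show "(\<lambda>t. ennreal (inverse (real (Suc i)) * C) * indicator {-R..R} t) \<in> borel_measurable lebesgue"
          by (intro borel_measurable_times_ennreal borel_measurable_const borel_measurable_indicator) simp
      qed (use measurable_diff_simple[OF us h] in \<open>auto simp: nn_integral_cmult nn_integral_cmult_indicator\<close>)
      also have "ennreal (inverse (real (Suc i)) * C) * emeasure lebesgue {-R..R} = ennreal (inverse (real (Suc i)) * (C * (2 * R)))"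
        using R C(2) by (simp flip: ennreal_mult add: algebra_simps)
      finally show "(\<integral>\<^sup>+t. norm (scaleK (\<phi> t) (h t) - p i t) \<partial>lebesgue) \<le>
        ennreal (inverse (real (Suc i)) * (C * (2 * R))) + ennreal (M + 1) * (\<integral>\<^sup>+t. norm (h t - u i t) \<partial>lebesgue)" .
    qed
    have "(\<lambda>i. ennreal (inverse (real (Suc i)) * (C * (2 * R)))) \<longlonglongrightarrow> ennreal 0"
      by (intro tendsto_ennrealI tendsto_mult_left_zero LIMSEQ_inverse_real_of_nat)
    moreover have "(\<lambda>i. ennreal (M + 1) * (\<integral>\<^sup>+t. norm (h t - u i t) \<partial>lebesgue)) \<longlonglongrightarrow> ennreal (M + 1) * 0"
      by (intro ennreal_tendsto_cmult u) auto
    ultimately show "(\<lambda>i. ennreal (inverse (real (Suc i)) * (C * (2 * R))) + ennreal (M + 1) * (\<integral>\<^sup>+t. norm (h t - u i t) \<partial>lebesgue)) \<longlonglongrightarrow> 0"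
      using tendsto_add by fastforce
  qed simp
  obtain x where x: "bochner_has_integral lebesgue (\<lambda>t. scaleK (\<phi> t) (h t)) x"
    using bochner_integrableI_approx[OF \<phi>h_meas p lim] unfolding bochner_integrable_def by blast
  have I: "((\<lambda>t. C * norm (\<phi> t)) has_integral C * integral {-R..R} (\<lambda>t. norm (\<phi> t))) {-R..R}"
    by (intro has_integral_mult_right integrable_integral integrable_continuous_real continuous_intros
        continuous_on_subset[OF c\<phi>]) simp
  have "norm x \<le> C * integral {-R..R} (\<lambda>t. norm (\<phi> t))"
  proof (rule bochner_has_integral_norm_bound[OF x])
    have "(\<integral>\<^sup>+t. norm (scaleK (\<phi> t) (h t)) \<partial>lebesgue) \<le> (\<integral>\<^sup>+t. ennreal (C * norm (\<phi> t)) * indicator {-R..R} t \<partial>lebesgue)"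
      using hC by (intro nn_integral_mono_AE, eventually_elim)
        (auto simp: norm_scaleK indicator_def mult.commute[of C] split: if_splits intro!: ennreal_leI mult_left_mono)
    also have "\<dots> = (\<integral>\<^sup>+t. ennreal (C * norm (\<phi> t)) * indicator {-R..R} t \<partial>lborel)"
      by (rule nn_integral_completion)
    also have "\<dots> = ennreal (C * integral {-R..R} (\<lambda>t. norm (\<phi> t)))"
      using C(2) by (intro nn_integral_has_integral_lebesgue' I) auto
    finally show "(\<integral>\<^sup>+t. norm (scaleK (\<phi> t) (h t)) \<partial>lebesgue) \<le> ennreal (C * integral {-R..R} (\<lambda>t. norm (\<phi> t)))" .
    show "0 \<le> C * integral {-R..R} (\<lambda>t. norm (\<phi> t))"
      using C(2) by (intro has_integral_nonneg[OF I]) auto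
  qed
  then show ?thesis using bochner_integral_eq[OF x] by (simp add: \<phi>h)
qed

lemma continuous_on_scaleK:
  "continuous_on S f \<Longrightarrow> continuous_on S g \<Longrightarrow> continuous_on S (\<lambda>t. scaleK (f t) (g t))"
  by (rule bounded_bilinear.continuous_on[OF bounded_bilinear_scaleK])

lemma dist_of_continuous:
  assumes w: "continuous_on UNIV w" and \<phi>: "\<phi> \<in> test_functions"
    and ab: "a \<le> b" "\<And>t. t \<notin> {a..b} \<Longrightarrow> \<phi> t = 0"
  shows "dist_of scaleK w \<phi> = integral {a..b} (\<lambda>t. scaleK (\<phi> t) (w t))"
proof -
  have "continuous_on UNIV (\<lambda>t. scaleK (\<phi> t) (w t))"
    by (intro continuous_on_scaleK w continuous_on_smooth test_smooth \<phi>)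
  moreover have "indicator {a..b} t *\<^sub>R scaleK (\<phi> t) (w t) = scaleK (\<phi> t) (w t)" for t
    using ab(2) by (auto simp: indicator_def)
  ultimately show ?thesis
    using bochner_integral_continuous[OF _ ab(1)] \<phi> by (fastforce simp: dist_of_def)
qed

end

section \<open>Distributions commute with integrals\<close>

text \<open>On each piece of the partition the error is at most its length times the oscillation. Hence the
  rate of convergence depends on the modulus of continuity only, and is uniform over equicontinuous
  families.\<close>

lemma riemann_sum_error:
  fixes g :: "real \<Rightarrow> 'b::banach"
  assumes g: "continuous_on {a..a + real N * w} g" and w: "w \<ge> 0"
    and osc: "\<And>y y'. y \<in> {a..a + real N * w} \<Longrightarrow> y' \<in> {a..a + real N * w} \<Longrightarrow> \<bar>y - y'\<bar> \<le> w \<Longrightarrow>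
      norm (g y - g y') \<le> e"
    and "k \<le> N"
  shows "norm (integral {a..a + real k * w} g - (\<Sum>i<k. w *\<^sub>R g (a + real i * w))) \<le> real k * w * e"
  using \<open>k \<le> N\<close>
proof (induction k)
  case (Suc k)
  define u v where "u = a + real k * w" and "v = a + real (Suc k) * w"
  have "real (Suc k) * w \<le> real N * w" using Suc.prems w by (intro mult_right_mono) auto
  then have uv: "a \<le> u" "u \<le> v" "v \<le> a + real N * w" "v - u = w"
    using w by (auto simp: u_def v_def algebra_simps)
  have int: "g integrable_on {c..d}" if "a \<le> c" "d \<le> a + real N * w" for c d
    using that by (intro integrable_continuous_real continuous_on_subset[OF g]) auto
  have "integral {a..v} g = integral {a..u} g + integral {u..v} g"
    using uv by (intro Henstock_Kurzweil_Integration.integral_combine[symmetric] int) auto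
  moreover have "norm (integral {u..v} g - w *\<^sub>R g u) \<le> w * e"
  proof -
    have "((\<lambda>y. g y - g u) has_integral integral {u..v} g - (v - u) *\<^sub>R g u) {u..v}"
      using uv int[of u v] has_integral_const_real[of "g u" u v]
      by (intro has_integral_diff integrable_integral) auto
    then have "norm (integral {u..v} g - (v - u) *\<^sub>R g u) \<le> e * measure lborel {u..v}"
    proof (rule has_integral_bound_real[rotated 2])
      show "norm (g y - g u) \<le> e" if "y \<in> {u..v} - {}" for y
        using that uv by (intro osc) auto
      show "0 \<le> e" using osc[of a a] uv w norm_ge_zero by fastforce
    qed simp
    then show ?thesis using uv by (simp add: mult.commute)
  qed
  moreover have "norm (integral {a..u} g - (\<Sum>i<k. w *\<^sub>R g (a + real i * w))) \<le> real k * w * e"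
    using Suc unfolding u_def by simp
  ultimately have "norm (integral {a..v} g - (\<Sum>i<Suc k. w *\<^sub>R g (a + real i * w))) \<le> real k * w * e + w * e"
    using norm_triangle_ineq[of "integral {a..u} g - (\<Sum>i<k. w *\<^sub>R g (a + real i * w))" "integral {u..v} g - w *\<^sub>R g u"]
    by (simp add: u_def algebra_simps)
  then show ?case by (simp add: v_def algebra_simps)
qed simp

lemma riemann_sum_uniform_limit:
  fixes g :: "'i \<Rightarrow> real \<Rightarrow> 'b::banach"
  assumes ab: "a \<le> b" and g: "\<And>z. z \<in> Z \<Longrightarrow> continuous_on {a..b} (g z)"
    and equi: "\<And>e. e > 0 \<Longrightarrow> \<exists>d>0. \<forall>z\<in>Z. \<forall>y\<in>{a..b}. \<forall>y'\<in>{a..b}. \<bar>y - y'\<bar> \<le> d \<longrightarrow> norm (g z y - g z y') \<le> e"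
  shows "uniform_limit Z (\<lambda>N z. \<Sum>i<N. ((b - a) / real N) *\<^sub>R g z (a + real i * ((b - a) / real N)))
    (\<lambda>z. integral {a..b} (g z)) sequentially"
proof (rule uniform_limitI)
  fix e :: real assume e: "e > 0"
  define e' where "e' = e / (b - a + 1)"
  have e': "e' > 0" "(b - a) * e' < e" using e ab by (auto simp: e'_def divide_simps)
  obtain d where d: "d > 0" and osc: "\<And>z y y'. z \<in> Z \<Longrightarrow> y \<in> {a..b} \<Longrightarrow> y' \<in> {a..b} \<Longrightarrow> \<bar>y - y'\<bar> \<le> d \<Longrightarrow>
      norm (g z y - g z y') \<le> e'"
    using equi[OF e'(1)] by blast
  have "\<forall>\<^sub>F N in sequentially. N > 0 \<and> real N > (b - a) / d"
    using eventually_gt_at_top[of 0] filterlim_real_sequentially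
    by (auto simp: eventually_conj_iff filterlim_at_top_dense)
  then show "\<forall>\<^sub>F N in sequentially. \<forall>z\<in>Z. dist (\<Sum>i<N. ((b - a) / real N) *\<^sub>R g z (a + real i * ((b - a) / real N)))
      (integral {a..b} (g z)) < e"
  proof eventually_elim
    case (elim N)
    define w where "w = (b - a) / real N"
    have w: "w \<ge> 0" "real N * w = b - a" using ab elim by (auto simp: w_def)
    have "w \<le> d" using elim d by (simp add: w_def field_simps)
    show ?case
    proof
      fix z assume z: "z \<in> Z"
      have "norm (integral {a..a + real N * w} (g z) - (\<Sum>i<N. w *\<^sub>R g z (a + real i * w))) \<le> real N * w * e'"
        using w g[OF z] osc[OF z] \<open>w \<le> d\<close> by (intro riemann_sum_error) auto
      also have "\<dots> < e" using e' w by simp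
      finally show "dist (\<Sum>i<N. ((b - a) / real N) *\<^sub>R g z (a + real i * ((b - a) / real N)))
          (integral {a..b} (g z)) < e"
        unfolding w(2) by (simp add: w_def dist_norm norm_minus_commute)
    qed
  qed
qed

lemma test_on_integral:
  fixes \<psi> \<phi> :: "real \<Rightarrow> 'k::{real_normed_field,euclidean_space}"
  assumes \<psi>: "continuous_on UNIV \<psi>" and \<phi>: "\<phi> \<in> test_on R" and ab: "\<bar>a\<bar> \<le> B" "\<bar>b\<bar> \<le> B"
  defines "\<Theta> \<equiv> \<lambda>z. integral {a..b} (\<lambda>y. \<psi> y * \<phi> (y - z))"
  shows "\<Theta> \<in> test_on (R + B)"
    "iter_deriv k \<Theta> z = integral {a..b} (\<lambda>y. \<psi> y * iter_deriv k (\<lambda>z. \<phi> (y - z)) z)"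
proof -
  have s\<phi>: "smooth \<phi>" and z: "\<And>t. \<bar>t\<bar> > R \<Longrightarrow> \<phi> t = 0" using \<phi> by (auto simp: test_on_iff)
  define F where "F k z = integral {a..b} (\<lambda>y. \<psi> y * iter_deriv k (\<lambda>z. \<phi> (y - z)) z)" for k z
  have cF: "continuous_on (UNIV \<times> cbox a b) (\<lambda>(z, y). \<psi> y * iter_deriv k (\<lambda>z. \<phi> (y - z)) z)" for k
    unfolding smooth_reflect(2)[OF s\<phi>] split_beta
    by (intro continuous_intros continuous_on_compose2[OF \<psi>] continuous_on_compose2[OF continuous_on_iter_deriv[OF s\<phi>, of UNIV]]) auto
  have "(F k has_vector_derivative F (Suc k) z) (at z)" for k z
    unfolding F_def cbox_interval[symmetric]
  proof (rule leibniz_rule_vector_derivative[of UNIV a b _ _ z])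
    show "((\<lambda>z. \<psi> y * iter_deriv k (\<lambda>z. \<phi> (y - z)) z) has_vector_derivative \<psi> y * iter_deriv (Suc k) (\<lambda>z. \<phi> (y - z)) z) (at z within UNIV)"
      for z y
      by (intro has_vector_derivative_mult_right smooth_derivative smooth_reflect s\<phi>)
    show "(\<lambda>y. \<psi> y * iter_deriv k (\<lambda>z. \<phi> (y - z)) z) integrable_on cbox a b" for z
    proof (rule integrable_continuous)
      have "continuous_on (cbox a b) (\<lambda>y. (z, y))" by (intro continuous_intros)
      from continuous_on_compose2[OF cF[of k] this]
      show "continuous_on (cbox a b) (\<lambda>y. \<psi> y * iter_deriv k (\<lambda>z. \<phi> (y - z)) z)" by auto
    qed
  qed (use cF in auto)
  then have "smooth (F 0)" "iter_deriv k (F 0) = F k"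
    using smooth_tower[of F] by auto
  moreover have "F 0 = \<Theta>" by (rule ext) (simp add: F_def \<Theta>_def)
  moreover have "\<Theta> t = 0" if "\<bar>t\<bar> > R + B" for t
  proof -
    have "\<psi> y * \<phi> (y - t) = 0" if "y \<in> {a..b}" for y
    proof -
      have "\<bar>y - t\<bar> > R" using that \<open>\<bar>t\<bar> > R + B\<close> ab by (auto simp: abs_if split: if_splits)
      then show ?thesis by (simp add: z)
    qed
    then have "\<Theta> t = integral {a..b} (\<lambda>_. 0)" unfolding \<Theta>_def by (rule integral_cong)
    then show ?thesis by simp
  qed
  ultimately show "\<Theta> \<in> test_on (R + B)"
    "iter_deriv k \<Theta> z = integral {a..b} (\<lambda>y. \<psi> y * iter_deriv k (\<lambda>z. \<phi> (y - z)) z)"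
    unfolding test_on_iff F_def[symmetric] by simp_all
qed

context banach_space_over
begin

lemma continuous_on_convolution:
  assumes T: "T \<in> \<D>'" and \<phi>: "\<phi> \<in> test_functions"
  shows "continuous_on S (convolution T \<phi>)"
proof -
  obtain R where R: "\<phi> \<in> test_on R" using \<phi> test_functions_iff by blast
  have "(convolution T \<phi> \<longlongrightarrow> convolution T \<phi> x) (at x)" for x
    unfolding convolution_def
  proof (rule dist_tendsto[OF T])
    show "(\<lambda>y. \<phi> (x - y)) \<in> test_on (R + (\<bar>x\<bar> + 1))" by (rule test_on_reflect[OF R]) simp
    have "\<forall>\<^sub>F x' in at x. dist x' x < 1" by (simp add: eventually_at_ball'[of 1, simplified] eventually_at) (auto intro: exI[of _ 1])
    then show "\<forall>\<^sub>F x' in at x. (\<lambda>y. \<phi> (x' - y)) \<in> test_on (R + (\<bar>x\<bar> + 1))"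
      by eventually_elim (rule test_on_reflect[OF R], simp add: dist_real_def)
    show "uniform_limit UNIV (\<lambda>x'. iter_deriv k (\<lambda>y. \<phi> (x' - y))) (iter_deriv k (\<lambda>y. \<phi> (x - y))) (at x)" for k
    proof (rule uniform_limitI)
      fix e :: real assume e: "e > 0"
      obtain d where d: "d > 0" "\<And>s t. \<bar>s - t\<bar> \<le> d \<Longrightarrow> norm (iter_deriv k \<phi> s - iter_deriv k \<phi> t) \<le> e / 2"
        using test_uniformly_continuous[OF test_iter_deriv[OF \<phi>], of "e / 2"] e by (metis half_gt_zero)
      have "\<forall>\<^sub>F x' in at x. dist x' x < d" using d(1) by (auto simp: eventually_at)
      then show "\<forall>\<^sub>F x' in at x. \<forall>y\<in>UNIV. dist (iter_deriv k (\<lambda>y. \<phi> (x' - y)) y) (iter_deriv k (\<lambda>y. \<phi> (x - y)) y) < e"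
      proof eventually_elim
        case (elim x')
        have "norm (iter_deriv k \<phi> (x' - y) - iter_deriv k \<phi> (x - y)) \<le> e / 2" for y
          using elim by (intro d(2)) (simp add: dist_real_def)
        then have "norm (iter_deriv k \<phi> (x' - y) - iter_deriv k \<phi> (x - y)) < e" for y
          using e by (rule_tac le_less_trans[of _ "e / 2"]) auto
        then show ?case
          by (simp add: smooth_reflect(2)[OF test_smooth[OF \<phi>]] dist_norm norm_power flip: scaleR_diff_right)
      qed
    qed
  qed
  then show ?thesis by (intro continuous_at_imp_continuous_on) (simp add: isCont_def)
qed

text \<open>Both sides are limits of Riemann sums, on which they agree by linearity. On the left the sums
  converge in the space of test functions, because all derivatives of the integrand with respect to
  \<open>z\<close> are equicontinuous in \<open>y\<close>. The statement covers the mean of a convolution (\<open>\<psi>\<close> constant), its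
  derivative (via \<open>\<phi>'\<close>), and the associativity of iterated convolutions.\<close>

theorem dist_integral:
  assumes T: "T \<in> \<D>'" and \<phi>: "\<phi> \<in> test_functions" and \<psi>: "continuous_on UNIV \<psi>" and ab: "a \<le> b"
  shows "T (\<lambda>z. integral {a..b} (\<lambda>y. \<psi> y * \<phi> (y - z))) = integral {a..b} (\<lambda>y. scaleK (\<psi> y) (convolution T \<phi> y))"
proof -
  obtain R where R: "\<phi> \<in> test_on R" using \<phi> test_functions_iff by blast
  define B where "B = max \<bar>a\<bar> \<bar>b\<bar>"
  have B: "\<bar>a\<bar> \<le> B" "\<bar>b\<bar> \<le> B" by (auto simp: B_def)
  have yB: "\<bar>y\<bar> \<le> B" if "y \<in> {a..b}" for y using that by (auto simp: B_def)
  define w where "w N = (b - a) / real N" for N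
  define y where "y N i = a + real i * w N" for N i
  have y: "y N i \<in> {a..b}" if "i < N" for N i
  proof -
    have "real i * w N \<le> real N * w N" using that ab by (intro mult_right_mono) (auto simp: w_def)
    then show ?thesis using that ab by (auto simp: y_def w_def)
  qed
  define S where "S N z = (\<Sum>i<N. w N *\<^sub>R (\<psi> (y N i) * \<phi> (y N i - z)))" for N z
  have s\<phi>: "smooth \<phi>" using \<phi> by (rule test_smooth)
  have summand: "(\<lambda>z. w N *\<^sub>R (\<psi> (y N i) * \<phi> (y N i - z))) \<in> test_on (R + B)" if "i < N" for N i
    by (intro test_on_scaleR test_on_mult test_on_reflect[OF R] yB y that)
  have S_test: "S N \<in> test_on (R + B)" for N
    unfolding S_def by (rule dist_sum(2)[OF T summand])
  have S_deriv: "iter_deriv k (S N) z = (\<Sum>i<N. w N *\<^sub>R (\<psi> (y N i) * iter_deriv k (\<lambda>z. \<phi> (y N i - z)) z))" for N k z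
  proof -
    have "smooth (\<lambda>z. \<Sum>i<n. w N *\<^sub>R (\<psi> (y N i) * \<phi> (y N i - z))) \<and>
      iter_deriv k (\<lambda>z. \<Sum>i<n. w N *\<^sub>R (\<psi> (y N i) * \<phi> (y N i - z))) = (\<lambda>z. \<Sum>i<n. w N *\<^sub>R (\<psi> (y N i) * iter_deriv k (\<lambda>z. \<phi> (y N i - z)) z))" for n k
    proof (induction n)
      case (Suc n)
      have L: "bounded_linear (\<lambda>u. w N *\<^sub>R (\<psi> (y N n) * u))"
        by (intro bounded_linear_compose[OF bounded_linear_scaleR_right] bounded_linear_mult_right)
      have *: "smooth (\<lambda>z. w N *\<^sub>R (\<psi> (y N n) * \<phi> (y N n - z)))"
        "iter_deriv k (\<lambda>z. w N *\<^sub>R (\<psi> (y N n) * \<phi> (y N n - z))) = (\<lambda>z. w N *\<^sub>R (\<psi> (y N n) * iter_deriv k (\<lambda>z. \<phi> (y N n - z)) z))"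
        by (rule smooth_bounded_linear[OF smooth_reflect(1)[OF s\<phi>] L])+
      show ?case using smooth_add[OF conjunct1[OF Suc] *(1)] Suc * by simp
    qed (simp add: smooth_zero)
    then show ?thesis unfolding S_def by simp
  qed
  have "\<exists>M>0. \<forall>y\<in>{a..b}. norm (\<psi> y) \<le> M"
  proof -
    have "compact (\<psi> ` {a..b})" by (intro compact_continuous_image continuous_on_subset[OF \<psi>]) auto
    then obtain M where "\<And>y. y \<in> {a..b} \<Longrightarrow> norm (\<psi> y) \<le> M"
      using compact_imp_bounded[of "\<psi> ` {a..b}"] unfolding bounded_iff by (metis imageI)
    then show ?thesis by (intro exI[of _ "max M 1"]) (auto simp: le_max_iff_disj)
  qed
  then obtain M where M: "M > 0" "\<And>y. y \<in> {a..b} \<Longrightarrow> norm (\<psi> y) \<le> M" by blast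
  have lim: "uniform_limit UNIV (\<lambda>N. iter_deriv k (S N))
      (iter_deriv k (\<lambda>z. integral {a..b} (\<lambda>y. \<psi> y * \<phi> (y - z)))) sequentially" for k
  proof -
    define g where "g z y = \<psi> y * iter_deriv k (\<lambda>z. \<phi> (y - z)) z" for z y
    have g_eq: "g z y = \<psi> y * (- 1) ^ k *\<^sub>R iter_deriv k \<phi> (y - z)" for z y
      by (simp add: g_def smooth_reflect(2)[OF s\<phi>])
    have "uniform_limit UNIV (\<lambda>N z. \<Sum>i<N. ((b - a) / real N) *\<^sub>R g z (a + real i * ((b - a) / real N)))
        (\<lambda>z. integral {a..b} (g z)) sequentially"
    proof (rule riemann_sum_uniform_limit[OF ab])
      show "continuous_on {a..b} (g z)" for z
        unfolding g_eq
        by (intro continuous_intros continuous_on_subset[OF \<psi>] continuous_on_compose2[OF continuous_on_iter_deriv[OF s\<phi>, of UNIV]]) auto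
    next
      fix e :: real assume e: "e > 0"
      obtain L where L: "L > 0" "\<And>t. norm (iter_deriv k \<phi> t) \<le> L"
        using test_bounded[OF test_iter_deriv[OF \<phi>]] by blast
      have "uniformly_continuous_on {a..b} \<psi>"
        by (intro compact_uniformly_continuous continuous_on_subset[OF \<psi>]) auto
      then obtain d1 where d1: "d1 > 0" "\<And>u v. u \<in> {a..b} \<Longrightarrow> v \<in> {a..b} \<Longrightarrow> dist v u < d1 \<Longrightarrow> dist (\<psi> v) (\<psi> u) < e / (2 * L)"
        using e L(1) unfolding uniformly_continuous_on_def by (metis divide_pos_pos mult_pos_pos zero_less_numeral)
      obtain d2 where d2: "d2 > 0" "\<And>s t. \<bar>s - t\<bar> \<le> d2 \<Longrightarrow> norm (iter_deriv k \<phi> s - iter_deriv k \<phi> t) \<le> e / (2 * M)"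
        using test_uniformly_continuous[OF test_iter_deriv[OF \<phi>], of "e / (2 * M)"] e M(1)
        by (metis divide_pos_pos mult_pos_pos zero_less_numeral)
      have "norm (g z u - g z v) \<le> e" if uv: "u \<in> {a..b}" "v \<in> {a..b}" "\<bar>u - v\<bar> \<le> min (d1 / 2) d2" for z u v
      proof -
        have "g z u - g z v = (- 1) ^ k *\<^sub>R ((\<psi> u - \<psi> v) * iter_deriv k \<phi> (u - z) + \<psi> v * (iter_deriv k \<phi> (u - z) - iter_deriv k \<phi> (v - z)))"
          by (simp add: g_eq algebra_simps)
        then have "norm (g z u - g z v) = norm ((\<psi> u - \<psi> v) * iter_deriv k \<phi> (u - z) + \<psi> v * (iter_deriv k \<phi> (u - z) - iter_deriv k \<phi> (v - z)))"
          by (simp add: norm_power)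
        also have "\<dots> \<le> norm (\<psi> u - \<psi> v) * norm (iter_deriv k \<phi> (u - z)) + norm (\<psi> v) * norm (iter_deriv k \<phi> (u - z) - iter_deriv k \<phi> (v - z))"
          by (metis norm_mult norm_triangle_ineq)
        also have "\<dots> \<le> e / (2 * L) * L + M * (e / (2 * M))"
          using uv L M e d1(2)[of v u] d1(1) by (intro add_mono mult_mono d2 L M) (auto simp: dist_norm dist_real_def)
        also have "\<dots> = e" using L M by simp
        finally show ?thesis .
      qed
      then show "\<exists>d>0. \<forall>z\<in>UNIV. \<forall>y\<in>{a..b}. \<forall>y'\<in>{a..b}. \<bar>y - y'\<bar> \<le> d \<longrightarrow> norm (g z y - g z y') \<le> e"
        using d1(1) d2(1) by (intro exI[of _ "min (d1 / 2) d2"]) auto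
    qed
    moreover have "iter_deriv k (\<lambda>z. integral {a..b} (\<lambda>y. \<psi> y * \<phi> (y - z))) = (\<lambda>z. integral {a..b} (g z))"
      unfolding g_def by (rule ext) (rule test_on_integral(2)[OF \<psi> R B])
    moreover have "iter_deriv k (S N) = (\<lambda>z. \<Sum>i<N. ((b - a) / real N) *\<^sub>R g z (a + real i * ((b - a) / real N)))" for N
      unfolding w_def[symmetric] y_def[symmetric] g_def by (rule ext) (rule S_deriv)
    ultimately show ?thesis by simp
  qed
  have "(\<lambda>N. T (S N)) \<longlonglongrightarrow> T (\<lambda>z. integral {a..b} (\<lambda>y. \<psi> y * \<phi> (y - z)))"
    by (rule dist_tendsto[OF T test_on_integral(1)[OF \<psi> R B] always_eventually lim]) (rule allI, rule S_test)
  moreover have "(\<lambda>N. T (S N)) \<longlonglongrightarrow> integral {a..b} (\<lambda>y. scaleK (\<psi> y) (convolution T \<phi> y))"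
  proof -
    have "T (S N) = (\<Sum>i<N. w N *\<^sub>R scaleK (\<psi> (y N i)) (convolution T \<phi> (y N i)))" for N
    proof -
      have "T (S N) = (\<Sum>i<N. T (\<lambda>z. w N *\<^sub>R (\<psi> (y N i) * \<phi> (y N i - z))))"
        unfolding S_def by (rule dist_sum(1)[OF T summand])
      also have "\<dots> = (\<Sum>i<N. w N *\<^sub>R scaleK (\<psi> (y N i)) (convolution T \<phi> (y N i)))"
      proof (rule sum.cong[OF refl])
        fix i
        have "(\<lambda>z. \<psi> (y N i) * \<phi> (y N i - z)) \<in> test_functions"
          using test_on_mult[OF test_on_reflect[OF R order_refl]] test_on_test by blast
        then show "T (\<lambda>z. w N *\<^sub>R (\<psi> (y N i) * \<phi> (y N i - z))) = w N *\<^sub>R scaleK (\<psi> (y N i)) (convolution T \<phi> (y N i))"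
          by (simp add: dist_scaleR[OF T] dist_mult[OF T test_reflect[OF \<phi>]] convolution_def)
      qed
      finally show ?thesis .
    qed
    moreover have c: "continuous_on {a..b} (\<lambda>y. scaleK (\<psi> y) (convolution T \<phi> y))"
      by (intro continuous_on_scaleK continuous_on_subset[OF \<psi>] continuous_on_convolution T \<phi>) auto
    have "uniform_limit UNIV (\<lambda>N (z::unit). \<Sum>i<N. ((b - a) / real N) *\<^sub>R scaleK (\<psi> (a + real i * ((b - a) / real N))) (convolution T \<phi> (a + real i * ((b - a) / real N))))
        (\<lambda>z. integral {a..b} (\<lambda>y. scaleK (\<psi> y) (convolution T \<phi> y))) sequentially"
    proof (rule riemann_sum_uniform_limit[OF ab c])
      fix e :: real assume e: "e > 0"
      have "uniformly_continuous_on {a..b} (\<lambda>y. scaleK (\<psi> y) (convolution T \<phi> y))"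
        by (intro compact_uniformly_continuous c) simp
      then obtain d where "d > 0" "\<And>u v. u \<in> {a..b} \<Longrightarrow> v \<in> {a..b} \<Longrightarrow> dist v u < d \<Longrightarrow>
          dist (scaleK (\<psi> v) (convolution T \<phi> v)) (scaleK (\<psi> u) (convolution T \<phi> u)) < e"
        using e unfolding uniformly_continuous_on_def by blast
      then show "\<exists>d>0. \<forall>z\<in>UNIV::unit set. \<forall>y\<in>{a..b}. \<forall>y'\<in>{a..b}. \<bar>y - y'\<bar> \<le> d \<longrightarrow>
          norm (scaleK (\<psi> y) (convolution T \<phi> y) - scaleK (\<psi> y') (convolution T \<phi> y')) \<le> e"
        by (intro exI[of _ "d / 2"]) (force simp: dist_norm less_imp_le)
    qed
    from tendsto_uniform_limitI[OF this, of "()"]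
    have "(\<lambda>N. \<Sum>i<N. w N *\<^sub>R scaleK (\<psi> (y N i)) (convolution T \<phi> (y N i))) \<longlonglongrightarrow> integral {a..b} (\<lambda>y. scaleK (\<psi> y) (convolution T \<phi> y))"
      by (simp add: w_def y_def)
    ultimately show ?thesis by simp
  qed
  ultimately show ?thesis by (rule LIMSEQ_unique)
qed

end

section \<open>Means of smooth functions and of distributions\<close>

lemma mean_primitive:
  fixes f :: "real \<Rightarrow> 'b::banach"
  assumes F: "\<And>t. (F has_vector_derivative f t) (at t)" and f: "continuous_on UNIV f" and h: "h > 0"
  shows "mean h f t = (1 / h) *\<^sub>R (F (t + h) - F t)" "mean (- h) f t = (1 / h) *\<^sub>R (F t - F (t - h))"
  using mean_continuous[OF f h] integral_primitive[OF F] h by simp_all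

lemma mean_uminus:
  fixes f :: "real \<Rightarrow> 'b::banach"
  shows "continuous_on UNIV f \<Longrightarrow> h > 0 \<Longrightarrow> mean (- h) f t = mean h f (t - h)"
  by (simp add: mean_continuous)

lemma mean_norm_bound:
  fixes f :: "real \<Rightarrow> 'b::banach"
  assumes f: "continuous_on UNIV f" and h: "h > 0" and d: "\<And>t. norm (f t) \<le> d"
  shows "norm (mean h f t) \<le> d"
proof -
  have "norm (integral {t..t+h} f) \<le> d * (t + h - t)"
    using h d by (intro integral_bound continuous_on_subset[OF f]) auto
  then show ?thesis using h by (simp add: mean_continuous(1)[OF f h] field_simps)
qed

lemma smooth_mean:
  fixes f :: "real \<Rightarrow> 'b::banach"
  assumes f: "smooth f" and h: "h > 0"
  shows "smooth (mean h f)" "iter_deriv k (mean h f) = mean h (iter_deriv k f)"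
    "iter_deriv (Suc k) (mean h f) t = (1 / h) *\<^sub>R (iter_deriv k f (t + h) - iter_deriv k f t)"
proof -
  obtain F where F: "\<And>t. (F has_vector_derivative f t) (at t)"
    using continuous_has_primitive[OF continuous_on_smooth[OF f]] by blast
  have sF: "smooth F" and dF: "iter_deriv (Suc n) F = iter_deriv n f" for n
    using smooth_primitive[OF F f] by auto
  have eq: "mean h f = (\<lambda>t. (1 / h) *\<^sub>R (F (t + h) - F t))"
    by (rule ext) (rule mean_primitive[OF F continuous_on_smooth[OF f] h])
  have D: "smooth (\<lambda>t. F (t + h) - F t)"
    "iter_deriv n (\<lambda>t. F (t + h) - F t) = (\<lambda>t. iter_deriv n F (t + h) - iter_deriv n F t)" for n
    using smooth_diff[OF smooth_translate(1)[OF sF] sF] smooth_translate(2)[OF sF] by auto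
  show "smooth (mean h f)" unfolding eq by (rule smooth_scaleR(1)[OF D(1)])
  have M: "iter_deriv n (mean h f) = (\<lambda>t. (1 / h) *\<^sub>R (iter_deriv n F (t + h) - iter_deriv n F t))" for n
    unfolding eq smooth_scaleR(2)[OF D(1)] D(2) ..
  show "iter_deriv (Suc k) (mean h f) t = (1 / h) *\<^sub>R (iter_deriv k f (t + h) - iter_deriv k f t)"
    unfolding M dF ..
  have "(iter_deriv k F has_vector_derivative iter_deriv k f t) (at t)" for t
    using smooth_derivative[OF sF, of k t] by (simp only: dF)
  from mean_primitive(1)[OF this continuous_on_iter_deriv[OF f] h]
  show "iter_deriv k (mean h f) = mean h (iter_deriv k f)"
    unfolding M by (rule_tac ext) simp
qed

lemma mean_test_on:
  fixes \<phi> :: "real \<Rightarrow> 'k::{real_normed_field,euclidean_space}"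
  assumes \<phi>: "\<phi> \<in> test_on R" and h: "h > 0"
  shows "mean h \<phi> \<in> test_on (R + h)" "mean (- h) \<phi> \<in> test_on (R + h)"
proof -
  have s: "smooth \<phi>" and z: "\<And>t. \<bar>t\<bar> > R \<Longrightarrow> \<phi> t = 0" using \<phi> by (auto simp: test_on_iff)
  have c: "continuous_on UNIV \<phi>" using s by (rule continuous_on_smooth)
  have zero: "integral {u..v} \<phi> = 0" if "\<And>t. t \<in> {u..v} \<Longrightarrow> \<bar>t\<bar> > R" for u v
  proof -
    have "integral {u..v} \<phi> = integral {u..v} (\<lambda>_. 0)" by (rule integral_cong) (simp add: z that)
    then show ?thesis by simp
  qed
  have sm: "smooth (mean h \<phi>)" by (rule smooth_mean(1)[OF s h])
  have "integral {t..t+h} \<phi> = 0" if "\<bar>t\<bar> > R + h" for t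
    by (rule zero) (use that h in \<open>auto simp: abs_if split: if_splits\<close>)
  then show "mean h \<phi> \<in> test_on (R + h)"
    unfolding test_on_iff using sm by (simp add: mean_continuous(1)[OF c h])
  have "mean (- h) \<phi> = (\<lambda>t. mean h \<phi> (t + (- h)))" using mean_uminus[OF c h] by auto
  then have "smooth (mean (- h) \<phi>)" using smooth_translate(1)[OF sm, of "- h"] by simp
  moreover have "integral {t-h..t} \<phi> = 0" if "\<bar>t\<bar> > R + h" for t
    by (rule zero) (use that h in \<open>auto simp: abs_if split: if_splits\<close>)
  ultimately show "mean (- h) \<phi> \<in> test_on (R + h)"
    unfolding test_on_iff by (simp add: mean_continuous(2)[OF c h])
qed

lemma mean_test:
  fixes \<phi> :: "real \<Rightarrow> 'k::{real_normed_field,euclidean_space}"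
  assumes "\<phi> \<in> test_functions" "h > 0"
  shows "mean h \<phi> \<in> test_functions" "mean (- h) \<phi> \<in> test_functions"
  using assms mean_test_on test_on_test unfolding test_functions_iff by blast+

lemma mean_uminus_iter_deriv:
  fixes \<phi> :: "real \<Rightarrow> 'k::{real_normed_field,euclidean_space}"
  assumes s: "smooth \<phi>" and h: "h > 0"
  shows "iter_deriv k (mean (- h) \<phi>) t = mean h (iter_deriv k \<phi>) (t - h)"
proof -
  have "mean (- h) \<phi> = (\<lambda>t. mean h \<phi> (t + (- h)))"
    using mean_uminus[OF continuous_on_smooth[OF s] h] by auto
  then show ?thesis
    using smooth_translate(2)[OF smooth_mean(1)[OF s h], of k "- h"] smooth_mean(2)[OF s h] by simp
qed

lemma mean_lincomb:
  fixes \<phi> \<psi> :: "real \<Rightarrow> 'k::{real_normed_field,euclidean_space}"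
  assumes "continuous_on UNIV \<phi>" "continuous_on UNIV \<psi>" "h > 0"
  shows "mean (- h) (\<lambda>t. a * \<phi> t + b * \<psi> t) = (\<lambda>t. a * mean (- h) \<phi> t + b * mean (- h) \<psi> t)"
proof
  fix t
  have "\<phi> integrable_on {t-h..t}" "\<psi> integrable_on {t-h..t}"
    by (intro integrable_continuous_real continuous_on_subset[OF assms(1)] continuous_on_subset[OF assms(2)]; simp)+
  moreover have "continuous_on UNIV (\<lambda>t. a * \<phi> t + b * \<psi> t)"
    by (intro continuous_intros assms)
  ultimately show "mean (- h) (\<lambda>t. a * \<phi> t + b * \<psi> t) t = a * mean (- h) \<phi> t + b * mean (- h) \<psi> t"
    using assms by (simp add: mean_continuous integral_add integrable_on_mult_right algebra_simps)
qed

lemma mean_translate: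
  fixes f :: "real \<Rightarrow> 'b::banach"
  shows "mean h (translate a f) = translate a (mean h f)"
  by (rule ext) (simp add: mean_def translate_def add.assoc add.commute[of a])

lemma mean_double:
  fixes f :: "real \<Rightarrow> 'b::banach"
  assumes f: "continuous_on UNIV f" and h: "h > 0"
  shows "mean (- (2 * h)) f t = (1 / 2) *\<^sub>R (mean (- h) f t + mean (- h) f (t - h))"
proof -
  have "integral {t - 2*h..t - h} f + integral {t - h..t} f = integral {t - 2*h..t} f"
    using h by (intro Henstock_Kurzweil_Integration.integral_combine integrable_continuous_real continuous_on_subset[OF f]) auto
  moreover have "t - h - h = t - 2 * h" by simp
  ultimately show ?thesis
    using h mean_continuous(2)[OF f, of "2 * h" t] mean_continuous(2)[OF f h] 
    by (simp add: scaleR_add_right[symmetric] add.commute)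
qed

context banach_space_over
begin

lemma dist_mean_apply: "\<phi> \<in> test_functions \<Longrightarrow> dist_mean h T \<phi> = T (mean (- h) \<phi>)"
  by (simp add: dist_mean_def)

lemma distributions_compose:
  assumes T: "T \<in> \<D>'"
    and lin: "\<And>\<phi> \<psi> a b. \<phi> \<in> test_functions \<Longrightarrow> \<psi> \<in> test_functions \<Longrightarrow>
      L (\<lambda>t. a * \<phi> t + b * \<psi> t) = (\<lambda>t. a * L \<phi> t + b * L \<psi> t)"
    and supp: "\<And>R \<phi>. \<phi> \<in> test_on R \<Longrightarrow> L \<phi> \<in> test_on (R + c)"
    and bnd: "\<And>\<phi> k d t. \<phi> \<in> test_functions \<Longrightarrow> \<forall>t. norm (iter_deriv k \<phi> t) \<le> d \<Longrightarrow>
      norm (iter_deriv k (L \<phi>) t) \<le> d"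
  shows "(\<lambda>\<phi>\<in>test_functions. T (L \<phi>)) \<in> \<D>'"
proof (rule distributionsI)
  fix \<phi> \<psi> :: "real \<Rightarrow> 'k" and a b
  assume t: "\<phi> \<in> test_functions" "\<psi> \<in> test_functions"
  then have "L \<phi> \<in> test_functions" "L \<psi> \<in> test_functions"
    using supp test_on_test unfolding test_functions_iff by blast+
  from dist_lincomb[OF T this, of a b] t
  show "(\<lambda>\<phi>\<in>test_functions. T (L \<phi>)) (\<lambda>t. a * \<phi> t + b * \<psi> t) =
      scaleK a ((\<lambda>\<phi>\<in>test_functions. T (L \<phi>)) \<phi>) + scaleK b ((\<lambda>\<phi>\<in>test_functions. T (L \<phi>)) \<psi>)"
    by (simp add: test_functions_lincomb lin)
next
  fix R
  obtain m C where mC: "\<And>\<phi> d. \<phi> \<in> test_on (R + c) \<Longrightarrow> derivs_le m \<phi> d \<Longrightarrow> norm (T \<phi>) \<le> C * d"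
    using dist_bound[OF T, of "R + c"] by blast
  have "norm ((\<lambda>\<phi>\<in>test_functions. T (L \<phi>)) \<phi>) \<le> C * d"
    if \<phi>: "\<phi> \<in> test_on R" and d: "derivs_le m \<phi> d" for \<phi> d
    using mC[OF supp[OF \<phi>]] bnd[OF test_on_test[OF \<phi>]] d test_on_test[OF \<phi>] by simp
  then show "\<exists>m C. \<forall>\<phi> d. \<phi> \<in> test_on R \<longrightarrow> derivs_le m \<phi> d \<longrightarrow>
      norm ((\<lambda>\<phi>\<in>test_functions. T (L \<phi>)) \<phi>) \<le> C * d" by blast
qed simp

lemma dist_mean_distributions:
  assumes T: "T \<in> \<D>'" and h: "h > 0"
  shows "dist_mean h T \<in> \<D>'"
  unfolding dist_mean_def
proof (rule distributions_compose[OF T _ mean_test_on(2)[OF _ h]])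
  show "mean (- h) (\<lambda>t. a * \<phi> t + b * \<psi> t) = (\<lambda>t. a * mean (- h) \<phi> t + b * mean (- h) \<psi> t)"
    if "\<phi> \<in> test_functions" "\<psi> \<in> test_functions" for \<phi> \<psi> :: "real \<Rightarrow> 'k" and a b
    by (intro mean_lincomb continuous_on_smooth test_smooth that h)
  show "norm (iter_deriv k (mean (- h) \<phi>) t) \<le> d"
    if \<phi>: "\<phi> \<in> test_functions" and d: "\<forall>t. norm (iter_deriv k \<phi> t) \<le> d" for \<phi> :: "real \<Rightarrow> 'k" and k d t
    unfolding mean_uminus_iter_deriv[OF test_smooth[OF \<phi>] h]
    by (intro mean_norm_bound continuous_on_iter_deriv test_smooth \<phi> h) (use d in blast)
qed

text \<open>The increments of \<open>T * \<phi>\<close> are integrals of \<open>T * \<phi>'\<close>.\<close>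

lemma convolution_derivative:
  assumes T: "T \<in> \<D>'" and \<phi>: "\<phi> \<in> test_functions"
  shows "(convolution T \<phi> has_vector_derivative convolution T (iter_deriv 1 \<phi>) x) (at x)"
proof -
  define \<phi>' where "\<phi>' = iter_deriv 1 \<phi>"
  have \<phi>': "\<phi>' \<in> test_functions" unfolding \<phi>'_def by (rule test_iter_deriv[OF \<phi>])
  have c: "continuous_on S (convolution T \<phi>')" for S by (rule continuous_on_convolution[OF T \<phi>'])
  define a where "a = x - 1"
  have inc: "convolution T \<phi> y = convolution T \<phi> a + integral {a..y} (convolution T \<phi>')" if y: "a \<le> y" for y
  proof -
    have D: "((\<lambda>t. \<phi> (t - z)) has_vector_derivative \<phi>' (t - z)) (at t)" for z t
    proof -
      have "((\<lambda>t. \<phi> (t + (- z))) has_vector_derivative iter_deriv (Suc 0) (\<lambda>t. \<phi> (t + (- z))) t) (at t)"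
        using smooth_derivative[OF smooth_translate(1)[OF test_smooth[OF \<phi>]], of 0 "- z" t] by simp
      then show ?thesis unfolding smooth_translate(2)[OF test_smooth[OF \<phi>]] by (simp add: \<phi>'_def)
    qed
    have "integral {a..y} (\<lambda>t. 1 * \<phi>' (t - z)) = \<phi> (y - z) - \<phi> (a - z)" for z
      using integral_primitive[OF D y] by simp
    then have "T (\<lambda>z. \<phi> (y - z) - \<phi> (a - z)) = integral {a..y} (\<lambda>t. scaleK 1 (convolution T \<phi>' t))"
      using dist_integral[OF T \<phi>' continuous_on_const y, of 1] by simp
    moreover have "T (\<lambda>z. \<phi> (y - z) - \<phi> (a - z)) = convolution T \<phi> y - convolution T \<phi> a"
      unfolding convolution_def by (intro dist_diff[OF T] test_reflect \<phi>)
    ultimately show ?thesis by (simp add: algebra_simps)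
  qed
  have "((\<lambda>y. integral {a..y} (convolution T \<phi>')) has_vector_derivative convolution T \<phi>' x) (at x within {a..x+1})"
    by (intro integral_has_vector_derivative c) (simp add: a_def)
  then have "((\<lambda>y. integral {a..y} (convolution T \<phi>')) has_vector_derivative convolution T \<phi>' x) (at x)"
    by (simp add: at_within_Icc_at a_def)
  then have "((\<lambda>y. convolution T \<phi> a + integral {a..y} (convolution T \<phi>')) has_vector_derivative convolution T \<phi>' x) (at x)"
    by (auto intro!: derivative_eq_intros)
  then show ?thesis
    unfolding \<phi>'_def[symmetric]
  proof (rule has_vector_derivative_transform_within_open)
    show "open {a<..}" "x \<in> {a<..}" by (simp_all add: a_def)
    show "convolution T \<phi> a + integral {a..y} (convolution T \<phi>') = convolution T \<phi> y" if "y \<in> {a<..}" for y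
      using inc[of y] that by simp
  qed
qed

lemma smooth_convolution:
  assumes T: "T \<in> \<D>'" and \<phi>: "\<phi> \<in> test_functions"
  shows "smooth (convolution T \<phi>)" "iter_deriv n (convolution T \<phi>) = convolution T (iter_deriv n \<phi>)"
proof -
  have "(convolution T (iter_deriv n \<phi>) has_vector_derivative convolution T (iter_deriv (Suc n) \<phi>) t) (at t)" for n t
    using convolution_derivative[OF T test_iter_deriv[OF \<phi>]] by (simp add: iter_deriv_iter_deriv)
  from smooth_tower[of "\<lambda>n. convolution T (iter_deriv n \<phi>)", OF this]
  show "smooth (convolution T \<phi>)" "iter_deriv n (convolution T \<phi>) = convolution T (iter_deriv n \<phi>)" by simp_all
qed

lemma convolution_mean:
  assumes T: "T \<in> \<D>'" and \<phi>: "\<phi> \<in> test_functions" and h: "h > 0"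
  shows "convolution (dist_mean h T) \<phi> = convolution T (mean h \<phi>)"
    "convolution (dist_mean h T) \<phi> = mean h (convolution T \<phi>)"
proof -
  have s: "smooth \<phi>" using \<phi> by (rule test_smooth)
  obtain F where F: "\<And>t. (F has_vector_derivative \<phi> t) (at t)"
    using continuous_has_primitive[OF continuous_on_smooth[OF s]] by blast
  have m1: "mean (- h) (\<lambda>y. \<phi> (x - y)) = (\<lambda>z. (1 / h) *\<^sub>R (F (x - z + h) - F (x - z)))" for x
  proof
    fix z
    have "((\<lambda>y. - F (x - y)) has_vector_derivative \<phi> (x - y)) (at y)" for y
    proof -
      have "((\<lambda>y. x - y) has_vector_derivative -1) (at y)"
        by (auto intro!: derivative_eq_intros)
      from has_vector_derivative_minus[OF vector_diff_chain_at[OF this F[of "x - y"]]]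
      show ?thesis by (simp add: o_def)
    qed
    from mean_primitive(2)[OF this continuous_on_smooth[OF smooth_reflect(1)[OF s]] h]
    show "mean (- h) (\<lambda>y. \<phi> (x - y)) z = (1 / h) *\<^sub>R (F (x - z + h) - F (x - z))"
      by (simp add: algebra_simps)
  qed
  have m2: "mean h \<phi> (x - z) = (1 / h) *\<^sub>R (F (x - z + h) - F (x - z))" for x z
    by (rule mean_primitive(1)[OF F continuous_on_smooth[OF s] h])
  have m3: "integral {x..x+h} (\<lambda>y. of_real (1 / h) * \<phi> (y - z)) = (1 / h) *\<^sub>R (F (x - z + h) - F (x - z))" for x z
  proof -
    have "((\<lambda>y. F (y - z)) has_vector_derivative \<phi> (y - z)) (at y)" for y
    proof -
      have "((\<lambda>y. y - z) has_vector_derivative 1) (at y)"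
        by (auto intro!: derivative_eq_intros)
      from vector_diff_chain_at[OF this F[of "y - z"]] show ?thesis by (simp add: o_def)
    qed
    from integral_primitive[OF this, of x "x + h"] h
    have "integral {x..x+h} (\<lambda>y. \<phi> (y - z)) = F (x + h - z) - F (x - z)" by simp
    then show ?thesis by (simp add: add_diff_eq diff_add_eq scaleR_conv_of_real del: of_real_divide)
  qed
  show "convolution (dist_mean h T) \<phi> = convolution T (mean h \<phi>)"
    by (rule ext) (simp add: convolution_def dist_mean_apply test_reflect[OF \<phi>] m1 m2)
  show "convolution (dist_mean h T) \<phi> = mean h (convolution T \<phi>)"
  proof
    fix x
    have "convolution (dist_mean h T) \<phi> x = T (\<lambda>z. integral {x..x+h} (\<lambda>y. of_real (1 / h) * \<phi> (y - z)))"
      unfolding m3 by (simp add: convolution_def dist_mean_apply test_reflect[OF \<phi>] m1)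
    also have "\<dots> = integral {x..x+h} (\<lambda>y. scaleK (of_real (1 / h)) (convolution T \<phi> y))"
      using h by (intro dist_integral T \<phi>) auto
    also have "\<dots> = mean h (convolution T \<phi>) x"
      by (simp add: scaleK_of_real mean_continuous(1)[OF continuous_on_convolution[OF T \<phi>] h] del: of_real_divide)
    finally show "convolution (dist_mean h T) \<phi> x = mean h (convolution T \<phi>) x" .
  qed
qed

lemma difference_convolution:
  assumes T: "T \<in> \<D>'" and \<phi>: "\<phi> \<in> test_functions" and s: "s > 0"
  shows "difference s (convolution T \<phi>) = (\<lambda>t. s *\<^sub>R convolution (dist_mean s T) (iter_deriv 1 \<phi>) t)"
proof
  fix t
  have "mean s (convolution T (iter_deriv 1 \<phi>)) t = (1 / s) *\<^sub>R (convolution T \<phi> (t + s) - convolution T \<phi> t)"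
    by (rule mean_primitive(1)[OF convolution_derivative[OF T \<phi>] continuous_on_convolution[OF T test_iter_deriv[OF \<phi>]] s])
  then show "difference s (convolution T \<phi>) t = s *\<^sub>R convolution (dist_mean s T) (iter_deriv 1 \<phi>) t"
    using s by (simp add: convolution_mean(2)[OF T test_iter_deriv[OF \<phi>] s] difference_def translate_def)
qed

lemma dist_of_lincomb:
  assumes f: "continuous_on UNIV f" and g: "continuous_on UNIV g"
  shows "dist_of scaleK (\<lambda>t. a *\<^sub>R f t + b *\<^sub>R g t) =
    (\<lambda>\<phi>\<in>test_functions. a *\<^sub>R dist_of scaleK f \<phi> + b *\<^sub>R dist_of scaleK g \<phi>)"
proof
  fix \<phi> :: "real \<Rightarrow> 'k"
  show "dist_of scaleK (\<lambda>t. a *\<^sub>R f t + b *\<^sub>R g t) \<phi> =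
    (\<lambda>\<phi>\<in>test_functions. a *\<^sub>R dist_of scaleK f \<phi> + b *\<^sub>R dist_of scaleK g \<phi>) \<phi>"
  proof (cases "\<phi> \<in> test_functions")
    case True
    obtain R where R: "R \<ge> 0" "\<phi> \<in> test_on R" using test_functionsE[OF True] by blast
    have R': "-R \<le> R" using R(1) by simp
    note ab = R' test_on_outside[OF R(2)]
    have I: "(\<lambda>t. scaleK (\<phi> t) (w t)) integrable_on {-R..R}" if "continuous_on UNIV w" for w
      by (intro integrable_continuous_real continuous_on_scaleK continuous_on_smooth test_smooth[OF True]
          continuous_on_subset[OF that]) simp
    have c: "continuous_on UNIV (\<lambda>t. a *\<^sub>R f t + b *\<^sub>R g t)" by (intro continuous_intros f g)
    have "(\<lambda>t. scaleK (\<phi> t) (a *\<^sub>R f t + b *\<^sub>R g t)) = (\<lambda>t. a *\<^sub>R scaleK (\<phi> t) (f t) + b *\<^sub>R scaleK (\<phi> t) (g t))"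
      by (simp add: scale_right_distrib bounded_bilinear.scaleR_right[OF bounded_bilinear_scaleK])
    then have "dist_of scaleK (\<lambda>t. a *\<^sub>R f t + b *\<^sub>R g t) \<phi> =
        integral {-R..R} (\<lambda>t. a *\<^sub>R scaleK (\<phi> t) (f t) + b *\<^sub>R scaleK (\<phi> t) (g t))"
      using dist_of_continuous[OF c True ab] by simp
    also have "\<dots> = a *\<^sub>R integral {-R..R} (\<lambda>t. scaleK (\<phi> t) (f t)) + b *\<^sub>R integral {-R..R} (\<lambda>t. scaleK (\<phi> t) (g t))"
      using I[OF f] I[OF g] by (simp add: integral_add integrable_cmul)
    finally show ?thesis
      using True dist_of_continuous[OF f True ab] dist_of_continuous[OF g True ab] by simp
  qed (simp add: dist_of_def)
qed

text \<open>The mean is self-dual up to reflection: integrate by parts with primitives of \<open>\<phi>\<close> and \<open>w\<close>.\<close>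

lemma dist_mean_dist_of:
  assumes w: "continuous_on UNIV w" and h: "h > 0"
  shows "dist_mean h (dist_of scaleK w) = dist_of scaleK (mean h w)"
proof
  fix \<phi> :: "real \<Rightarrow> 'k"
  show "dist_mean h (dist_of scaleK w) \<phi> = dist_of scaleK (mean h w) \<phi>"
  proof (cases "\<phi> \<in> test_functions")
    case \<phi>: True
    obtain R where R: "R \<ge> 0" "\<phi> \<in> test_on R" using test_functionsE[OF \<phi>] by blast
    have c\<phi>: "continuous_on UNIV \<phi>" by (intro continuous_on_smooth test_smooth \<phi>)
    obtain F where F: "\<And>t. (F has_vector_derivative \<phi> t) (at t)"
      using continuous_has_primitive[OF c\<phi>] by blast
    obtain W where W: "\<And>t. (W has_vector_derivative w t) (at t)"
      using continuous_has_primitive[OF w] by blast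
    have cW: "continuous_on UNIV W"
      using W by (meson continuous_at_imp_continuous_on has_vector_derivative_continuous)
    have cWh: "continuous_on UNIV (\<lambda>t. W (t + h))"
      by (intro continuous_on_compose2[OF cW] continuous_intros) auto
    have mw: "mean h w = (\<lambda>t. (1 / h) *\<^sub>R W (t + h) + (- (1 / h)) *\<^sub>R W t)"
      by (rule ext) (simp add: mean_primitive(1)[OF W w h] scaleR_diff_right)
    define N where "N = R + h + 1"
    have m: "mean (- h) \<phi> \<in> test_on (R + h)" by (rule mean_test_on(2)[OF R(2) h])
    have mz: "mean (- h) \<phi> t = 0" if "t \<notin> {-N<..<N}" for t
      by (rule test_on_outside[OF m]) (use that in \<open>auto simp: N_def\<close>)
    have Rz: "\<phi> t = 0" if "t \<notin> {-N..N}" for t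
      by (rule test_on_outside[OF R(2)]) (use that h in \<open>auto simp: N_def\<close>)
    have Rz': "\<phi> t = 0" if "t \<notin> {-N-h..N-h}" for t
      by (rule test_on_outside[OF R(2)]) (use that h in \<open>auto simp: N_def\<close>)
    have N: "-N \<le> N" and Nh: "-N-h \<le> N-h" using R h by (simp_all add: N_def)
    define G where "G t = F t - F (t - h)" for t
    have G: "mean (- h) \<phi> t = (1 / h) *\<^sub>R G t" for t
      unfolding G_def by (rule mean_primitive(2)[OF F c\<phi> h])
    have G0: "G N = 0" "G (-N) = 0" using mz[of N] mz[of "-N"] G h by auto
    have Fh: "((\<lambda>t. F (t - h)) has_vector_derivative \<phi> (t - h)) (at t)" for t
    proof -
      have "((\<lambda>y. y - h) has_vector_derivative 1) (at t)"
        by (auto intro!: derivative_eq_intros)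
      from vector_diff_chain_at[OF this F[of "t - h"]] show ?thesis by (simp add: o_def)
    qed
    have dG: "(G has_vector_derivative \<phi> t - \<phi> (t - h)) (at t)" for t
      unfolding G_def by (intro has_vector_derivative_diff F Fh)
    have cG: "continuous_on S G" for S
      using dG by (meson continuous_at_imp_continuous_on has_vector_derivative_continuous)
    have int: "(\<lambda>t. scaleK (u t) (v t)) integrable_on {c..d}" if "continuous_on UNIV u" "continuous_on UNIV v" for u v and c d :: real
      by (intro integrable_continuous_real continuous_on_scaleK continuous_on_subset[OF that(1)] continuous_on_subset[OF that(2)]) auto
    have c\<phi>h: "continuous_on UNIV (\<lambda>t. \<phi> (t - h))"
      by (intro continuous_on_compose2[OF c\<phi>] continuous_intros) auto
    have "((\<lambda>t. scaleK (\<phi> t - \<phi> (t - h)) (W t)) has_integral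
        scaleK (G N) (W N) - scaleK (G (-N)) (W (-N)) - integral {-N..N} (\<lambda>t. scaleK (G t) (w t))) {-N..N}"
    proof (rule integration_by_parts[OF bounded_bilinear_scaleK N cG continuous_on_subset[OF cW] dG W])
      show "((\<lambda>t. scaleK (G t) (w t)) has_integral scaleK (G N) (W N) - scaleK (G (-N)) (W (-N)) -
          (scaleK (G N) (W N) - scaleK (G (-N)) (W (-N)) - integral {-N..N} (\<lambda>t. scaleK (G t) (w t)))) {-N..N}"
        using integrable_integral[OF int[OF cG w]] by simp
    qed auto
    then have parts: "integral {-N..N} (\<lambda>t. scaleK (G t) (w t)) = - integral {-N..N} (\<lambda>t. scaleK (\<phi> t - \<phi> (t - h)) (W t))"
      using integral_unique G0 by (simp add: integral_unique)
    have "integral {-N..N} (\<lambda>t. scaleK (\<phi> (t - h)) (W t)) = integral {-N-h..N-h} (\<lambda>t. scaleK (\<phi> t) (W (t + h)))"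
      using integral_shift_real_ivl[of "-N" h N "\<lambda>t. scaleK (\<phi> (t - h)) (W t)"] by simp
    also have "\<dots> = integral {-N..N} (\<lambda>t. scaleK (\<phi> t) (W (t + h)))"
      using dist_of_continuous[OF cWh \<phi> Nh Rz'] dist_of_continuous[OF cWh \<phi> N Rz] by simp
    finally have shift: "integral {-N..N} (\<lambda>t. scaleK (\<phi> (t - h)) (W t)) = integral {-N..N} (\<lambda>t. scaleK (\<phi> t) (W (t + h)))" .
    have "dist_mean h (dist_of scaleK w) \<phi> = dist_of scaleK w (mean (- h) \<phi>)"
      by (rule dist_mean_apply[OF \<phi>])
    also have "\<dots> = integral {-N..N} (\<lambda>t. scaleK (mean (- h) \<phi> t) (w t))"
      using mz by (intro dist_of_continuous w test_on_test[OF m] N) auto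
    also have "\<dots> = (1 / h) *\<^sub>R integral {-N..N} (\<lambda>t. scaleK (G t) (w t))"
      by (simp add: G bounded_bilinear.scaleR_left[OF bounded_bilinear_scaleK])
    also have "\<dots> = (1 / h) *\<^sub>R (integral {-N..N} (\<lambda>t. scaleK (\<phi> t) (W (t + h))) - integral {-N..N} (\<lambda>t. scaleK (\<phi> t) (W t)))"
      using int[OF c\<phi> cW] int[OF c\<phi>h cW] by (simp add: parts scale_left_diff_distrib integral_diff shift)
    also have "\<dots> = (1 / h) *\<^sub>R dist_of scaleK (\<lambda>t. W (t + h)) \<phi> + (- (1 / h)) *\<^sub>R dist_of scaleK W \<phi>"
      using dist_of_continuous[OF cWh \<phi> N Rz] dist_of_continuous[OF cW \<phi> N Rz] by (simp add: scaleR_diff_right)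
    also have "\<dots> = dist_of scaleK (mean h w) \<phi>"
      unfolding mw dist_of_lincomb[OF cWh cW] using \<phi> by simp
    finally show ?thesis .
  qed (simp add: dist_mean_def dist_of_def)
qed

end

section \<open>Classes closed under means\<close>

lemma dist_mean_class_mono: "B \<subseteq> C \<Longrightarrow> dist_mean_class scaleK B \<subseteq> dist_mean_class scaleK C"
  by (auto simp: dist_mean_class_def)

context banach_space_over
begin

lemma dist_of_lincomb_in:
  assumes "real_linear A" "continuous_on UNIV f" "continuous_on UNIV g"
    "dist_of scaleK f \<in> A" "dist_of scaleK g \<in> A"
  shows "dist_of scaleK (\<lambda>t. a *\<^sub>R f t + b *\<^sub>R g t) \<in> A"
  using assms unfolding dist_of_lincomb[OF assms(2,3)] real_linear_def by blast

text \<open>Both \<open>T * \<phi> - M\<^sub>1 (T * \<phi>)\<close>, by condition \<open>\<Delta>\<^sub>1\<close>, and \<open>M\<^sub>1 (T * \<phi>)\<close> belong to \<open>A\<close>.\<close>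

lemma dist_mean_class_distributional_class:
  assumes lin: "real_linear A" and \<Delta>: "Delta1 scaleK A"
  shows "dist_mean_class scaleK (distributional_class scaleK A) \<subseteq> distributional_class scaleK A"
proof
  fix T assume "T \<in> dist_mean_class scaleK (distributional_class scaleK A)"
  then have T: "T \<in> \<D>'" and M: "\<And>h \<phi>. h > 0 \<Longrightarrow> \<phi> \<in> test_functions \<Longrightarrow> dist_of scaleK (convolution (dist_mean h T) \<phi>) \<in> A"
    by (auto simp: dist_mean_class_def distributional_class_def)
  have "dist_of scaleK (convolution T \<phi>) \<in> A" if \<phi>: "\<phi> \<in> test_functions" for \<phi>
  proof -
    define f where "f = convolution T \<phi>"
    have f: "continuous_on UNIV f" unfolding f_def by (rule continuous_on_convolution[OF T \<phi>])
    have m1: "mean 1 f = convolution (dist_mean 1 T) \<phi>"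
      unfolding f_def by (rule convolution_mean(2)[OF T \<phi>, symmetric]) simp
    have c: "continuous_on UNIV (convolution (dist_mean s T) \<eta>)" if "s > 0" "\<eta> \<in> test_functions" for s \<eta>
      by (intro continuous_on_convolution dist_mean_distributions T that)
    have \<phi>': "iter_deriv 1 \<phi> \<in> test_functions" by (rule test_iter_deriv[OF \<phi>])
    have "dist_of scaleK (difference s f) \<in> A" if s: "s > 0" for s
      using dist_of_lincomb_in[OF lin c[OF s \<phi>'] c[OF s \<phi>'] M[OF s \<phi>'] M[OF s \<phi>'], of s 0]
      unfolding f_def difference_convolution[OF T \<phi> s] by simp
    then have "dist_of scaleK (\<lambda>t. f t - mean 1 f t) \<in> A"
      using \<Delta> locally_bochner_continuous[OF f] unfolding Delta1_def by blast
    moreover have "continuous_on UNIV (mean 1 f)" unfolding m1 by (intro c \<phi>) simp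
    moreover have "dist_of scaleK (mean 1 f) \<in> A" unfolding m1 by (intro M \<phi>) simp
    ultimately have "dist_of scaleK (\<lambda>t. 1 *\<^sub>R (f t - mean 1 f t) + 1 *\<^sub>R mean 1 f t) \<in> A"
      using f by (intro dist_of_lincomb_in[OF lin] continuous_intros) auto
    then show ?thesis by (simp add: f_def)
  qed
  with T show "T \<in> distributional_class scaleK A" by (simp add: distributional_class_def)
qed

lemma iterated_dist_mean_class_subset:
  assumes "real_linear A" "Delta1 scaleK A" "A \<subseteq> distributional_class scaleK A"
  shows "(dist_mean_class scaleK ^^ n) A \<subseteq> distributional_class scaleK A"
proof (induction n)
  case (Suc n)
  then show ?case
    using dist_mean_class_mono[OF Suc, of scaleK] dist_mean_class_distributional_class[OF assms(1,2)] by simp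
qed (simp add: assms)

lemma distributions_lincomb:
  assumes F: "F \<in> \<D>'" and G: "G \<in> \<D>'"
  shows "(\<lambda>\<phi>\<in>test_functions. s *\<^sub>R F \<phi> + t *\<^sub>R G \<phi>) \<in> \<D>'"
proof (rule distributionsI)
  fix \<phi> \<psi> :: "real \<Rightarrow> 'k" and a b
  assume "\<phi> \<in> test_functions" "\<psi> \<in> test_functions"
  moreover have r: "r *\<^sub>R scaleK c x = scaleK c (r *\<^sub>R x)" for r c x
    by (simp add: bounded_bilinear.scaleR_right[OF bounded_bilinear_scaleK])
  ultimately show "(\<lambda>\<phi>\<in>test_functions. s *\<^sub>R F \<phi> + t *\<^sub>R G \<phi>) (\<lambda>t. a * \<phi> t + b * \<psi> t) =
      scaleK a ((\<lambda>\<phi>\<in>test_functions. s *\<^sub>R F \<phi> + t *\<^sub>R G \<phi>) \<phi>) + scaleK b ((\<lambda>\<phi>\<in>test_functions. s *\<^sub>R F \<phi> + t *\<^sub>R G \<phi>) \<psi>)"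
    by (simp add: test_functions_lincomb dist_lincomb[OF F] dist_lincomb[OF G] scaleR_add_right r scale_right_distrib)
next
  fix R
  obtain m C where mC: "C \<ge> 0" "\<And>\<phi> d. \<phi> \<in> test_on R \<Longrightarrow>
      derivs_le m \<phi> d \<Longrightarrow> norm (F \<phi>) \<le> C * d"
    using dist_bound[OF F, of R] by blast
  obtain m' C' where mC': "C' \<ge> 0" "\<And>\<phi> d. \<phi> \<in> test_on R \<Longrightarrow>
      derivs_le m' \<phi> d \<Longrightarrow> norm (G \<phi>) \<le> C' * d"
    using dist_bound[OF G, of R] by blast
  have "norm ((\<lambda>\<phi>\<in>test_functions. s *\<^sub>R F \<phi> + t *\<^sub>R G \<phi>) \<phi>) \<le> (\<bar>s\<bar> * C + \<bar>t\<bar> * C') * d"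
    if \<phi>: "\<phi> \<in> test_on R" and d: "derivs_le (max m m') \<phi> d" for \<phi> d
  proof -
    have "norm (F \<phi>) \<le> C * d" "norm (G \<phi>) \<le> C' * d"
      by (intro mC(2)[OF \<phi>] mC'(2)[OF \<phi>]; use d in simp)+
    then have "norm (s *\<^sub>R F \<phi> + t *\<^sub>R G \<phi>) \<le> \<bar>s\<bar> * (C * d) + \<bar>t\<bar> * (C' * d)"
      by (intro order_trans[OF norm_triangle_ineq] add_mono) (simp_all add: mult_left_mono)
    then show ?thesis using test_on_test[OF \<phi>] by (simp add: algebra_simps)
  qed
  then show "\<exists>m C. \<forall>\<phi> d. \<phi> \<in> test_on R \<longrightarrow> derivs_le m \<phi> d \<longrightarrow>
      norm ((\<lambda>\<phi>\<in>test_functions. s *\<^sub>R F \<phi> + t *\<^sub>R G \<phi>) \<phi>) \<le> C * d" by blast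
qed simp

lemma translate_test_on: "\<phi> \<in> test_on R \<Longrightarrow> translate a \<phi> \<in> test_on (R + \<bar>a\<bar>)"
  unfolding translate_def by (rule test_on_translate) simp_all

lemma translate_test: "\<phi> \<in> test_functions \<Longrightarrow> translate a \<phi> \<in> test_functions"
  unfolding translate_def by (rule test_translate)

lemma distributions_translate:
  assumes F: "F \<in> \<D>'"
  shows "dist_translate a F \<in> \<D>'"
  unfolding dist_translate_def
proof (rule distributions_compose[OF F _ translate_test_on])
  show "norm (iter_deriv k (translate (- a) \<phi>) t) \<le> d"
    if \<phi>: "\<phi> \<in> test_functions" and d: "\<forall>t. norm (iter_deriv k \<phi> t) \<le> d" for \<phi> :: "real \<Rightarrow> 'k" and k d t
    unfolding translate_def smooth_translate(2)[OF test_smooth[OF \<phi>]] using d by blast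
qed (simp_all add: translate_def)

lemma real_linear_dist_mean_class:
  assumes "real_linear B"
  shows "real_linear (dist_mean_class scaleK B)"
  unfolding real_linear_def
proof (intro ballI allI)
  fix F G and s t :: real
  assume F: "F \<in> dist_mean_class scaleK B" and G: "G \<in> dist_mean_class scaleK B"
  have "dist_mean h (\<lambda>\<phi>\<in>test_functions. s *\<^sub>R F \<phi> + t *\<^sub>R G \<phi>) =
      (\<lambda>\<phi>\<in>test_functions. s *\<^sub>R dist_mean h F \<phi> + t *\<^sub>R dist_mean h G \<phi>)" if "h > 0" for h
    by (rule ext) (simp add: dist_mean_def mean_test(2)[OF _ that])
  then show "(\<lambda>\<phi>\<in>test_functions. s *\<^sub>R F \<phi> + t *\<^sub>R G \<phi>) \<in> dist_mean_class scaleK B"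
    using F G assms by (simp add: dist_mean_class_def distributions_lincomb real_linear_def)
qed

lemma positive_invariant_dist_mean_class:
  assumes "positive_invariant B"
  shows "positive_invariant (dist_mean_class scaleK B)"
  unfolding positive_invariant_def
proof (intro ballI allI impI)
  fix F and a :: real
  assume F: "F \<in> dist_mean_class scaleK B" and a: "a \<ge> 0"
  have "dist_mean h (dist_translate a F) = dist_translate a (dist_mean h F)" if "h > 0" for h
    by (rule ext) (simp add: dist_mean_def dist_translate_def mean_test(2)[OF _ that] translate_test mean_translate)
  then show "dist_translate a F \<in> dist_mean_class scaleK B"
    using F a assms by (simp add: dist_mean_class_def distributions_translate positive_invariant_def)
qed

lemma iterated_dist_mean_class_invariant:
  assumes "real_linear B" "positive_invariant B"
  shows "real_linear ((dist_mean_class scaleK ^^ n) B)" "positive_invariant ((dist_mean_class scaleK ^^ n) B)"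
  by (induction n) (auto simp: assms real_linear_dist_mean_class positive_invariant_dist_mean_class)

text \<open>By \<open>M\<^sub>2\<^sub>h = (M\<^sub>h + \<tau>\<^sub>h M\<^sub>h) / 2\<close>, where \<open>\<tau>\<^sub>h\<close> is the translation by \<open>h\<close>, the means over short
  intervals control all others.\<close>

lemma dist_mean_class_small:
  assumes lin: "real_linear B" and inv: "positive_invariant B" and T: "T \<in> \<D>'" and c: "c > 0"
    and small: "\<And>h. 0 < h \<Longrightarrow> h \<le> c \<Longrightarrow> dist_mean h T \<in> B"
  shows "T \<in> dist_mean_class scaleK B"
proof -
  have "dist_mean h T \<in> B" if "0 < h" "h \<le> c * 2 ^ n" for h n
    using that
  proof (induction n arbitrary: h)
    case (Suc n)
    define u where "u = h / 2"
    have u: "u > 0" "h = 2 * u" "u \<le> c * 2 ^ n" using Suc.prems by (auto simp: u_def)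
    define S where "S = dist_mean u T"
    have S: "S \<in> B" "dist_translate u S \<in> B"
      using Suc.IH[OF u(1,3)] u(1) inv by (auto simp: S_def positive_invariant_def)
    have "dist_mean h T = (\<lambda>\<phi>\<in>test_functions. (1/2) *\<^sub>R S \<phi> + (1/2) *\<^sub>R dist_translate u S \<phi>)"
    proof (rule ext)
      fix \<phi> :: "real \<Rightarrow> 'k"
      show "dist_mean h T \<phi> = (\<lambda>\<phi>\<in>test_functions. (1/2) *\<^sub>R S \<phi> + (1/2) *\<^sub>R dist_translate u S \<phi>) \<phi>"
      proof (cases "\<phi> \<in> test_functions")
        case True
        have c: "continuous_on UNIV \<phi>" by (intro continuous_on_smooth test_smooth True)
        have t: "mean (- u) \<phi> \<in> test_functions" "translate (- u) (mean (- u) \<phi>) \<in> test_functions"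
          by (intro translate_test mean_test True u)+
        have eq: "mean (- h) \<phi> = (\<lambda>t. (1/2) *\<^sub>R (mean (- u) \<phi> t + translate (- u) (mean (- u) \<phi>) t))"
          by (rule ext) (simp add: u(2) mean_double[OF c u(1), simplified] translate_def)
        have sum: "(\<lambda>t. mean (- u) \<phi> t + translate (- u) (mean (- u) \<phi>) t) \<in> test_functions"
          using test_functions_lincomb[OF t, of 1 1] by simp
        have "dist_mean h T \<phi> = T (\<lambda>t. (1/2) *\<^sub>R (mean (- u) \<phi> t + translate (- u) (mean (- u) \<phi>) t))"
          using dist_mean_apply[OF True, of h T] unfolding eq .
        also have "\<dots> = (1/2) *\<^sub>R (T (mean (- u) \<phi>) + T (translate (- u) (mean (- u) \<phi>)))"
          unfolding dist_scaleR[OF T sum] dist_add[OF T t] ..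
        also have "\<dots> = (1/2) *\<^sub>R S \<phi> + (1/2) *\<^sub>R dist_translate u S \<phi>"
          using True translate_test[OF True]
          by (simp add: S_def dist_mean_apply dist_translate_def mean_translate scaleR_add_right)
        finally show ?thesis using True by simp
      qed (simp add: dist_mean_def)
    qed
    then show ?case using S lin unfolding real_linear_def by metis
  qed (simp add: small)
  moreover have "\<exists>n. h \<le> c * 2 ^ n" for h
  proof -
    obtain n where "h / c < 2 ^ n" using real_arch_pow[of 2 "h / c"] by auto
    then show ?thesis using c by (intro exI[of _ n]) (simp add: field_simps)
  qed
  ultimately show ?thesis using T unfolding dist_mean_class_def by blast
qed

end

section \<open>Iterated means\<close>

fun means :: "real list \<Rightarrow> (real \<Rightarrow> 'b::real_normed_vector) \<Rightarrow> real \<Rightarrow> 'b" where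
  "means [] f = f"
| "means (h # hs) f = mean h (means hs f)"

fun dist_means :: "real list \<Rightarrow> ((real \<Rightarrow> 'k::{real_normed_field,euclidean_space}) \<Rightarrow> 'x::banach) \<Rightarrow> (real \<Rightarrow> 'k) \<Rightarrow> 'x" where
  "dist_means [] T = T"
| "dist_means (h # hs) T = dist_means hs (dist_mean h T)"

abbreviation positive :: "real list \<Rightarrow> bool" where
  "positive hs \<equiv> \<forall>h\<in>set hs. h > 0"

lemma dist_means_append: "dist_means (hs @ ks) T = dist_means ks (dist_means hs T)"
  by (induction hs arbitrary: T) auto

lemma means_test_on:
  fixes \<phi> :: "real \<Rightarrow> 'k::{real_normed_field,euclidean_space}"
  shows "positive hs \<Longrightarrow> \<phi> \<in> test_on R \<Longrightarrow> means hs \<phi> \<in> test_on (R + sum_list hs)"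
proof (induction hs)
  case (Cons h hs)
  then have "mean h (means hs \<phi>) \<in> test_on (R + sum_list hs + h)" by (intro mean_test_on) auto
  moreover have "R + sum_list hs + h = R + sum_list (h # hs)" by simp
  ultimately show ?case by (simp only: means.simps)
qed simp

lemma means_test:
  fixes \<phi> :: "real \<Rightarrow> 'k::{real_normed_field,euclidean_space}"
  shows "positive hs \<Longrightarrow> \<phi> \<in> test_functions \<Longrightarrow> means hs \<phi> \<in> test_functions"
  using means_test_on unfolding test_functions_iff by blast

lemma smooth_means:
  fixes f :: "real \<Rightarrow> 'b::banach"
  assumes "positive hs" "smooth f"
  shows "smooth (means hs f)" "iter_deriv k (means hs f) = means hs (iter_deriv k f)"
  using assms by (induction hs) (auto simp: smooth_mean)

lemma means_diff:
  fixes f g :: "real \<Rightarrow> 'b::banach"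
  assumes "positive hs" "smooth f" "smooth g"
  shows "means hs (\<lambda>t. f t - g t) = (\<lambda>t. means hs f t - means hs g t)"
  using assms(1)
proof (induction hs)
  case (Cons h hs)
  have c: "continuous_on UNIV (means hs f)" "continuous_on UNIV (means hs g)"
    using Cons.prems assms by (auto intro!: continuous_on_smooth smooth_means)
  have "means hs f integrable_on {t..t+h}" "means hs g integrable_on {t..t+h}" for t
    by (intro integrable_continuous_real continuous_on_subset[OF c(1)] continuous_on_subset[OF c(2)]; simp)+
  moreover have "continuous_on UNIV (\<lambda>t. means hs f t - means hs g t)" by (intro continuous_intros c)
  ultimately show ?case
    using Cons c by (auto simp: mean_continuous integral_diff scaleR_diff_right)
qed simp

text \<open>Each mean absorbs one derivative: the derivative of \<open>M\<^sub>h f\<close> is a difference quotient of \<open>f\<close>.\<close>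

lemma means_deriv_bound:
  fixes f :: "real \<Rightarrow> 'b::banach"
  assumes f: "smooth f" and d: "\<And>t. norm (f t) \<le> d" and hs: "\<forall>h\<in>set hs. 0 < h \<and> h \<le> 1"
  shows "j \<le> length hs \<Longrightarrow> norm (iter_deriv j (means hs f) t) \<le> d * (\<Prod>h\<leftarrow>hs. 2 / h)"
  using hs
proof (induction hs arbitrary: j t)
  case (Cons h hs)
  define g where "g = means hs f"
  define D where "D = d * (\<Prod>h\<leftarrow>hs. 2 / h)"
  have h: "0 < h" "h \<le> 1" and pos: "positive hs" using Cons.prems by auto
  have g: "smooth g" unfolding g_def by (rule smooth_means(1)[OF pos f])
  have IH: "norm (iter_deriv i g t) \<le> D" if "i \<le> length hs" for i t
    unfolding g_def D_def using Cons.IH[OF that] Cons.prems by auto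
  have D0: "D \<ge> 0" using IH[of 0 0] norm_ge_zero order_trans by blast
  have "norm (iter_deriv j (mean h g) t) \<le> (2 / h) * D"
  proof (cases j)
    case 0
    have "norm (mean h g t) \<le> D"
      using IH[of 0] by (intro mean_norm_bound continuous_on_smooth g h) simp
    also have "1 * D \<le> (2 / h) * D" using h D0 by (intro mult_right_mono) auto
    finally show ?thesis using 0 by simp
  next
    case (Suc i)
    have "norm (iter_deriv i g (t + h) - iter_deriv i g t) \<le> D + D"
      using Cons.prems Suc by (intro order_trans[OF norm_triangle_ineq4] add_mono IH) auto
    then have "(1 / h) * norm (iter_deriv i g (t + h) - iter_deriv i g t) \<le> (1 / h) * (D + D)"
      using h by (intro mult_left_mono) auto
    moreover have "(1 / h) * (D + D) = (2 / h) * D" by simp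
    moreover have "norm (iter_deriv j (mean h g) t) = (1 / h) * norm (iter_deriv i g (t + h) - iter_deriv i g t)"
      using h unfolding Suc smooth_mean(3)[OF g h(1)] norm_scaleR by simp
    ultimately show ?thesis by linarith
  qed
  then show ?case by (simp add: g_def D_def mult.left_commute)
qed (use d in simp)

context banach_space_over
begin

lemma dist_means_distributions: "positive hs \<Longrightarrow> T \<in> \<D>' \<Longrightarrow> dist_means hs T \<in> \<D>'"
  by (induction hs arbitrary: T) (auto simp: dist_mean_distributions)

lemma convolution_means:
  "positive hs \<Longrightarrow> T \<in> \<D>' \<Longrightarrow> \<phi> \<in> test_functions \<Longrightarrow>
    convolution (dist_means hs T) \<phi> = convolution T (means hs \<phi>)"
  by (induction hs arbitrary: T) (auto simp: dist_mean_distributions convolution_mean means_test)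

lemma dist_means_dist_of_convolution:
  "positive hs \<Longrightarrow> V \<in> \<D>' \<Longrightarrow> \<phi> \<in> test_functions \<Longrightarrow>
    dist_means hs (dist_of scaleK (convolution V \<phi>)) = dist_of scaleK (convolution (dist_means hs V) \<phi>)"
proof (induction hs arbitrary: V)
  case (Cons h hs)
  then have "dist_mean h (dist_of scaleK (convolution V \<phi>)) = dist_of scaleK (convolution (dist_mean h V) \<phi>)"
    using dist_mean_dist_of[OF continuous_on_convolution[of V \<phi>], of h] convolution_mean(2)[of V \<phi> h] by simp
  then show ?case using Cons by (simp add: dist_mean_distributions)
qed simp

text \<open>Replacing all means by those over short intervals one layer at a time requires the layers
  below to be linear and translation invariant.\<close>

lemma iterated_dist_mean_classI:
  assumes lin: "real_linear A" and inv: "positive_invariant A" and c: "c > 0"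
  shows "T \<in> \<D>' \<Longrightarrow> (\<And>hs. length hs = n \<Longrightarrow> \<forall>h\<in>set hs. 0 < h \<and> h \<le> c \<Longrightarrow> dist_means hs T \<in> A) \<Longrightarrow>
    T \<in> (dist_mean_class scaleK ^^ n) A"
proof (induction n arbitrary: T)
  case 0
  from "0.prems"(2)[of "[]"] show ?case by simp
next
  case (Suc n)
  have "dist_mean h T \<in> (dist_mean_class scaleK ^^ n) A" if h: "0 < h" "h \<le> c" for h
  proof (rule Suc.IH)
    show "dist_mean h T \<in> \<D>'" by (rule dist_mean_distributions[OF Suc.prems(1) h(1)])
    show "dist_means hs (dist_mean h T) \<in> A" if "length hs = n" "\<forall>h\<in>set hs. 0 < h \<and> h \<le> c" for hs
      using Suc.prems(2)[of "h # hs"] that h by simp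
  qed
  then show ?case
    using dist_mean_class_small[OF iterated_dist_mean_class_invariant[OF lin inv] Suc.prems(1) c] by simp
qed

end

section \<open>Mollifiers\<close>

text \<open>Since \<open>\<delta> \<le> 1\<close>, one domain of integration serves the kernels of all widths.\<close>

definition averaging_kernel :: "real \<Rightarrow> (real \<Rightarrow> real) \<Rightarrow> bool" where
  "averaging_kernel \<delta> r \<longleftrightarrow> \<delta> \<le> 1 \<and> continuous_on UNIV r \<and> (\<forall>t. r t \<ge> 0) \<and> (\<forall>t. \<bar>t\<bar> > \<delta> \<longrightarrow> r t = 0) \<and>
     integral {-1..1} r = 1"

definition average :: "(real \<Rightarrow> real) \<Rightarrow> (real \<Rightarrow> 'b::real_normed_vector) \<Rightarrow> real \<Rightarrow> 'b" where
  "average r w z = integral {-1..1} (\<lambda>u. r u *\<^sub>R w (z + u))"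

lemma average_error:
  fixes w :: "real \<Rightarrow> 'b::banach"
  assumes r: "averaging_kernel \<delta> r" and w: "continuous_on UNIV w"
    and e: "\<And>u. \<bar>u\<bar> \<le> \<delta> \<Longrightarrow> norm (w (z + u) - y) \<le> e"
  shows "norm (average r w z - y) \<le> e"
proof -
  have c: "continuous_on {-1..1} r" "continuous_on {-1..1} (\<lambda>u. w (z + u))" and r0: "\<And>t. r t \<ge> 0"
    and I: "integral {-1..1} r = 1" and z: "\<And>t. \<bar>t\<bar> > \<delta> \<Longrightarrow> r t = 0"
    using r by (auto simp: averaging_kernel_def intro: continuous_on_subset
        intro!: continuous_on_compose2[OF w] continuous_intros)
  have int: "(\<lambda>u. r u *\<^sub>R w (z + u)) integrable_on {-1..1}" "(\<lambda>u. r u *\<^sub>R y) integrable_on {-1..1}"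
    "(\<lambda>u. r u * e) integrable_on {-1..1}"
    by (intro integrable_continuous_real continuous_intros c)+
  have "average r w z - y = integral {-1..1} (\<lambda>u. r u *\<^sub>R w (z + u)) - integral {-1..1} (\<lambda>u. r u *\<^sub>R y)"
    using integral_linear[OF integrable_continuous_real[OF c(1)] bounded_linear_scaleR_left[of y]] I
    by (simp add: average_def o_def)
  also have "\<dots> = integral {-1..1} (\<lambda>u. r u *\<^sub>R (w (z + u) - y))"
    using int by (simp add: integral_diff[symmetric] scaleR_diff_right)
  finally have "norm (average r w z - y) = norm (integral {-1..1} (\<lambda>u. r u *\<^sub>R (w (z + u) - y)))" by simp
  also have "\<dots> \<le> integral {-1..1} (\<lambda>u. r u * e)"
  proof (rule Henstock_Kurzweil_Integration.integral_norm_bound_integral[OF _ int(3)])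
    show "(\<lambda>u. r u *\<^sub>R (w (z + u) - y)) integrable_on {-1..1}"
      by (intro integrable_continuous_real continuous_intros c)
    show "norm (r u *\<^sub>R (w (z + u) - y)) \<le> r u * e" for u
      using e[of u] z[of u] r0[of u] by (cases "\<bar>u\<bar> \<le> \<delta>") (auto simp: mult_left_mono)
  qed
  also have "\<dots> = e" by (simp add: I)
  finally show ?thesis .
qed

lemma average_bound:
  fixes w :: "real \<Rightarrow> 'b::banach"
  assumes "averaging_kernel \<delta> r" "continuous_on UNIV w" "\<And>t. norm (w t) \<le> M"
  shows "norm (average r w z) \<le> M"
  using average_error[OF assms(1,2), of z 0 M] assms(3) by simp

lemma averages_tendsto:
  fixes w :: "real \<Rightarrow> 'b::banach"
  assumes r: "\<And>n. averaging_kernel (\<delta> n) (r n)" and \<delta>: "\<delta> \<longlonglongrightarrow> 0" and w: "continuous_on UNIV w"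
  shows "(\<lambda>n. average (r n) w z) \<longlonglongrightarrow> w z"
proof (rule tendstoI)
  fix e :: real assume e: "e > 0"
  have "isCont w z" using w by (simp add: continuous_on_eq_continuous_at)
  then obtain d where d: "d > 0" "\<And>y. dist y z < d \<Longrightarrow> dist (w y) (w z) < e / 2"
    using e unfolding continuous_at_eps_delta by (metis half_gt_zero)
  have "\<forall>\<^sub>F n in sequentially. \<delta> n < d" using order_tendstoD(2)[OF \<delta> d(1)] .
  then show "\<forall>\<^sub>F n in sequentially. dist (average (r n) w z) (w z) < e"
  proof eventually_elim
    case (elim n)
    have "norm (average (r n) w z - w z) \<le> e / 2"
    proof (rule average_error[OF r w])
      show "norm (w (z + u) - w z) \<le> e / 2" if "\<bar>u\<bar> \<le> \<delta> n" for u
        using d(2)[of "z + u"] elim that by (simp add: dist_norm)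
    qed
    then show ?case using e by (simp add: dist_norm)
  qed
qed

lemma smooth_average:
  fixes \<phi> :: "real \<Rightarrow> 'k::{real_normed_field,euclidean_space}"
  assumes r: "averaging_kernel \<delta> r" and \<phi>: "\<phi> \<in> test_on R"
  shows "average r \<phi> \<in> test_on (R + 1)" "iter_deriv k (average r \<phi>) = average r (iter_deriv k \<phi>)"
proof -
  have s: "smooth \<phi>" and z: "\<And>t. \<bar>t\<bar> > R \<Longrightarrow> \<phi> t = 0" using \<phi> by (auto simp: test_on_iff)
  have cr: "continuous_on UNIV r" using r by (simp add: averaging_kernel_def)
  have cF: "continuous_on (UNIV \<times> cbox (-1) 1) (\<lambda>(z, u). r u *\<^sub>R iter_deriv k \<phi> (z + u))" for k
    unfolding split_beta
    by (intro continuous_intros continuous_on_compose2[OF cr] continuous_on_compose2[OF continuous_on_iter_deriv[OF s, of UNIV]]) auto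
  have "(average r (iter_deriv k \<phi>) has_vector_derivative average r (iter_deriv (Suc k) \<phi>) z) (at z)" for k z
    unfolding average_def cbox_interval[symmetric]
  proof (rule leibniz_rule_vector_derivative[of UNIV "-1" 1 _ _ z])
    show "((\<lambda>z. r u *\<^sub>R iter_deriv k \<phi> (z + u)) has_vector_derivative r u *\<^sub>R iter_deriv (Suc k) \<phi> (z + u)) (at z within UNIV)"
      for z u
    proof -
      have "((\<lambda>z. iter_deriv k \<phi> (z + u)) has_vector_derivative iter_deriv (Suc k) \<phi> (z + u)) (at z)"
        using smooth_derivative[OF smooth_translate(1)[OF s, of u], of k z] by (simp add: smooth_translate(2)[OF s])
      from bounded_linear.has_vector_derivative[OF bounded_linear_scaleR_right this]
      show ?thesis by simp
    qed
    show "(\<lambda>u. r u *\<^sub>R iter_deriv k \<phi> (z + u)) integrable_on cbox (-1) 1" for z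
      by (intro integrable_continuous continuous_intros continuous_on_compose2[OF cr]
          continuous_on_compose2[OF continuous_on_iter_deriv[OF s, of UNIV]]) auto
  qed (use cF in auto)
  from smooth_tower[of "\<lambda>k. average r (iter_deriv k \<phi>)", OF this]
  have sm: "smooth (average r \<phi>)" and it: "iter_deriv k (average r \<phi>) = average r (iter_deriv k \<phi>)" by simp_all
  show "iter_deriv k (average r \<phi>) = average r (iter_deriv k \<phi>)" by (rule it)
  have "average r \<phi> t = 0" if "\<bar>t\<bar> > R + 1" for t
  proof -
    have "average r \<phi> t = integral {-1..1::real} (\<lambda>_. 0)"
      unfolding average_def
    proof (rule integral_cong)
      fix u :: real assume "u \<in> {-1..1}"
      then have "\<bar>t + u\<bar> > R" using that by (auto simp: abs_if split: if_splits)
      then show "r u *\<^sub>R \<phi> (t + u) = 0" by (simp add: z)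
    qed
    then show ?thesis by simp
  qed
  then show "average r \<phi> \<in> test_on (R + 1)" unfolding test_on_iff using sm by simp
qed

text \<open>Averaging twice converges together with all derivatives, since averaging commutes with
  differentiation and displaces its argument by at most \<open>\<delta>\<close>.\<close>

lemma double_average_uniform_limit:
  fixes \<phi> :: "real \<Rightarrow> 'k::{real_normed_field,euclidean_space}"
  assumes r: "\<And>n. averaging_kernel (\<delta> n) (r n)" and \<delta>: "\<delta> \<longlonglongrightarrow> 0" and \<phi>: "\<phi> \<in> test_on R"
  shows "uniform_limit UNIV (\<lambda>n. iter_deriv k (average (r n) (average (r n) \<phi>))) (iter_deriv k \<phi>) sequentially"
proof (rule uniform_limitI)
  fix e :: real assume e: "e > 0"
  obtain M where M: "M > 0" "\<And>t. norm (iter_deriv (Suc 0) (iter_deriv k \<phi>) t) \<le> M"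
    using test_bounded[OF test_iter_deriv[OF test_iter_deriv[OF test_on_test[OF \<phi>]]]] by blast
  have err: "norm (average (r n) f z - f z) \<le> M * \<delta> n"
    if f: "smooth f" "\<And>t. norm (iter_deriv (Suc 0) f t) \<le> M" for f :: "real \<Rightarrow> 'k" and n z
  proof (rule average_error[OF r continuous_on_smooth[OF f(1)]])
    fix u assume "\<bar>u\<bar> \<le> \<delta> n"
    then have "M * \<bar>u\<bar> \<le> M * \<delta> n" using M(1) by simp
    then show "norm (f (z + u) - f z) \<le> M * \<delta> n"
      using smooth_lipschitz[OF f, of "z + u" z] by simp
  qed
  have "(\<lambda>n. 2 * (M * \<delta> n)) \<longlonglongrightarrow> 2 * (M * 0)" by (intro tendsto_intros \<delta>)
  then have "\<forall>\<^sub>F n in sequentially. 2 * (M * \<delta> n) < e" using e by (intro order_tendstoD) auto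
  then show "\<forall>\<^sub>F n in sequentially. \<forall>z\<in>UNIV. dist (iter_deriv k (average (r n) (average (r n) \<phi>)) z) (iter_deriv k \<phi> z) < e"
  proof eventually_elim
    case (elim n)
    define f where "f = iter_deriv k \<phi>"
    have f: "f \<in> test_on R" "smooth f" "\<And>t. norm (iter_deriv (Suc 0) f t) \<le> M"
      using test_on_iter_deriv[OF \<phi>] M by (auto simp: f_def test_on_iff)
    have a: "average (r n) f \<in> test_on (R + 1)" "iter_deriv (Suc 0) (average (r n) f) = average (r n) (iter_deriv (Suc 0) f)"
      by (rule smooth_average[OF r f(1)])+
    have aM: "norm (iter_deriv (Suc 0) (average (r n) f) t) \<le> M" for t
      unfolding a(2) by (rule average_bound[OF r continuous_on_iter_deriv[OF f(2)] f(3)])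
    have as: "smooth (average (r n) f)" using a(1) by (simp only: test_on_iff)
    have eq: "iter_deriv k (average (r n) (average (r n) \<phi>)) = average (r n) (average (r n) f)"
      unfolding f_def smooth_average(2)[OF r smooth_average(1)[OF r \<phi>]] smooth_average(2)[OF r \<phi>] ..
    have "norm (average (r n) (average (r n) f) z - f z) \<le> M * \<delta> n + M * \<delta> n" for z
      using norm_triangle_ineq[of "average (r n) (average (r n) f) z - average (r n) f z" "average (r n) f z - f z"]
        err[OF as aM, of n z] err[OF f(2,3), of n z] by simp
    then show ?case unfolding eq f_def[symmetric] dist_norm using elim
      by (auto intro: le_less_trans)
  qed
qed

text \<open>The kernels are \<open>r\<^sub>n(t) = N b(N t)\<close> with \<open>N = n + 1\<close> for a bump \<open>b\<close>. Although they do not converge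
  as functions, their second primitives \<open>S\<^sub>n\<close> do so uniformly: two derivatives are lost, and are
  recovered later by two additional means.\<close>

lemma ex_mollifiers:
  obtains r :: "nat \<Rightarrow> real \<Rightarrow> real" and S :: "nat \<Rightarrow> real \<Rightarrow> 'k::{real_normed_field,euclidean_space}"
    and \<delta> \<epsilon> :: "nat \<Rightarrow> real" where
    "\<And>n. averaging_kernel (\<delta> n) (r n)" "\<delta> \<longlonglongrightarrow> 0" "\<And>n. (\<lambda>t. of_real (r n t) :: 'k) \<in> test_on 1"
    "\<And>n. smooth (S n)" "\<And>n. iter_deriv 2 (S n) = (\<lambda>t. of_real (r n t))"
    "\<And>n m t. norm (S n t - S m t) \<le> \<epsilon> n + \<epsilon> m" "\<epsilon> \<longlonglongrightarrow> 0" "\<And>n. \<epsilon> n \<le> \<epsilon> 0" "\<And>n. \<epsilon> n > 0"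
proof -
  obtain b B1 B2 :: "real \<Rightarrow> real" and c where b:
    "smooth B2" "\<And>t. (B2 has_vector_derivative B1 t) (at t)" "\<And>t. (B1 has_vector_derivative b t) (at t)"
    "smooth b" "\<And>t. b t \<ge> 0" "\<And>t. \<bar>t\<bar> \<ge> 1 \<Longrightarrow> b t = 0" "integral {-1..1} b = 1"
    and c: "\<And>t. \<bar>B2 t - max 0 t\<bar> \<le> c"
    using ex_bump by metis
  define N where "N n = real (Suc n)" for n
  have N: "N n \<ge> 1" for n by (simp add: N_def)
  define \<delta> where "\<delta> n = inverse (N n)" for n
  define \<epsilon> where "\<epsilon> n = inverse (N n) * (\<bar>c\<bar> + 1)" for n
  define r where "r n t = N n * b (N n * t)" for n t
  define s where "s n t = inverse (N n) * B2 (N n * t)" for n t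
  define S :: "nat \<Rightarrow> real \<Rightarrow> 'k" where "S n t = of_real (s n t)" for n t
  have d2: "iter_deriv 2 B2 = b"
  proof -
    have "vector_derivative B2 (at t) = B1 t" "vector_derivative B1 (at t) = b t" for t
      by (rule vector_derivative_at b)+
    then show ?thesis by (simp add: iter_deriv_def numeral_2_eq_2 fun_eq_iff)
  qed
  have r_eq: "r n = (\<lambda>t. N n *\<^sub>R b (N n * t + 0))" for n by (simp add: r_def fun_eq_iff)
  have s_eq: "s n = (\<lambda>t. inverse (N n) *\<^sub>R B2 (N n * t + 0))" for n by (simp add: s_def fun_eq_iff)
  have sr: "smooth (r n)" for n
    unfolding r_eq by (intro smooth_scaleR(1) smooth_affine(1) b)
  have ss: "smooth (s n)" for n
    unfolding s_eq by (intro smooth_scaleR(1) smooth_affine(1) b)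
  have s2: "iter_deriv 2 (s n) = r n" for n
    unfolding s_eq smooth_scaleR(2)[OF smooth_affine(1)[OF b(1)]] smooth_affine(2)[OF b(1)] d2
    using N[of n] by (simp add: r_def fun_eq_iff power2_eq_square)
  have supp: "r n t = 0" if "\<bar>t\<bar> > \<delta> n" for n t
  proof -
    have "\<bar>N n * t\<bar> > 1" using that N[of n] by (simp add: \<delta>_def abs_mult field_simps)
    then show ?thesis using b(6) by (simp add: r_def)
  qed
  have \<delta>1: "\<delta> n \<le> 1" for n using N[of n] by (simp add: \<delta>_def inverse_le_1_iff)
  have kernel: "averaging_kernel (\<delta> n) (r n)" for n
  proof -
    have flat: "B1 u = B1 v" if "u \<le> v" "\<And>t. t \<in> {u..v} \<Longrightarrow> \<bar>t\<bar> \<ge> 1" for u v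
    proof -
      have "integral {u..v} b = integral {u..v} (\<lambda>_. 0)"
        using that by (intro integral_cong b) auto
      then show ?thesis using integral_primitive[OF b(3) that(1)] by simp
    qed
    have dB: "((\<lambda>t. B1 (N n * t)) has_vector_derivative r n t) (at t)" for t
    proof -
      have "((\<lambda>t. N n * t) has_vector_derivative N n) (at t)"
        unfolding has_real_derivative_iff_has_vector_derivative[symmetric]
        by (auto intro!: derivative_eq_intros)
      from vector_diff_chain_at[OF this b(3)[of "N n * t"]]
      show ?thesis by (simp add: o_def r_def)
    qed
    have "integral {-1..1} (r n) = B1 (N n) - B1 (- N n)"
      using integral_primitive[OF dB, of "-1" 1] by simp
    also have "\<dots> = B1 1 - B1 (-1)"
      using flat[of 1 "N n"] flat[of "- N n" "-1"] N[of n] by auto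
    also have "\<dots> = 1" using integral_primitive[OF b(3), of "-1" 1] b(7) by simp
    finally have "integral {-1..1} (r n) = 1" .
    moreover have "r n t \<ge> 0" for t using N[of n] b(5) by (simp add: r_def)
    ultimately show ?thesis
      unfolding averaging_kernel_def using \<delta>1 supp continuous_on_smooth[OF sr] by simp
  qed
  have of_real_smooth: "smooth (\<lambda>t. of_real (f t) :: 'k)" "iter_deriv k (\<lambda>t. of_real (f t) :: 'k) = (\<lambda>t. of_real (iter_deriv k f t))"
    if "smooth f" for f :: "real \<Rightarrow> real" and k
    by (rule smooth_bounded_linear[OF that bounded_linear_of_real])+
  have Sdist: "norm (S n t - S m t) \<le> \<epsilon> n + \<epsilon> m" for n m t
  proof -
    have near: "\<bar>s n t - max 0 t\<bar> \<le> \<epsilon> n" for n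
    proof -
      have "N n * max 0 t = max 0 (N n * t)" using N[of n] by (auto simp: max_def zero_le_mult_iff)
      then have "s n t - max 0 t = inverse (N n) * (B2 (N n * t) - max 0 (N n * t))"
        using N[of n] by (simp add: s_def field_simps)
      then have "\<bar>s n t - max 0 t\<bar> = inverse (N n) * \<bar>B2 (N n * t) - max 0 (N n * t)\<bar>"
        using N[of n] by (simp add: abs_mult)
      also have "\<dots> \<le> inverse (N n) * (\<bar>c\<bar> + 1)"
        using N[of n] c[of "N n * t"] by (intro mult_left_mono) auto
      finally show ?thesis by (simp add: \<epsilon>_def)
    qed
    have "norm (S n t - S m t) = \<bar>s n t - s m t\<bar>"
      unfolding S_def of_real_diff[symmetric] norm_of_real ..
    then show ?thesis using near[of n] near[of m] by linarith
  qed
  have inv: "(\<lambda>n. inverse (N n)) \<longlonglongrightarrow> 0" unfolding N_def by (rule LIMSEQ_inverse_real_of_nat)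
  show ?thesis
  proof (rule that[of \<delta> r S \<epsilon>])
    show "averaging_kernel (\<delta> n) (r n)" for n by (rule kernel)
    show "\<delta> \<longlonglongrightarrow> 0" unfolding \<delta>_def by (rule inv)
    show "(\<lambda>t. of_real (r n t) :: 'k) \<in> test_on 1" for n
      unfolding test_on_iff using of_real_smooth(1)[OF sr] supp[of n] \<delta>1[of n] by fastforce
    show "smooth (S n)" for n unfolding S_def by (rule of_real_smooth(1)[OF ss])
    show "iter_deriv 2 (S n) = (\<lambda>t. of_real (r n t))" for n
      unfolding S_def of_real_smooth(2)[OF ss] s2 ..
    show "norm (S n t - S m t) \<le> \<epsilon> n + \<epsilon> m" for n m t by (rule Sdist)
    show "\<epsilon> \<longlonglongrightarrow> 0" unfolding \<epsilon>_def by (rule tendsto_mult_left_zero[OF inv])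
    show "\<epsilon> n \<le> \<epsilon> 0" for n unfolding \<epsilon>_def using \<delta>1[of n]
      by (intro mult_right_mono) (auto simp: \<delta>_def N_def)
    show "\<epsilon> n > 0" for n using N[of n] by (simp add: \<epsilon>_def)
  qed
qed

lemma integral_same_support:
  fixes f :: "real \<Rightarrow> 'b::banach"
  assumes "\<And>t. t \<notin> {a..b} \<Longrightarrow> f t = 0" "\<And>t. t \<notin> {c..d} \<Longrightarrow> f t = 0"
  shows "integral {a..b} f = integral {c..d} f"
proof -
  have "(\<lambda>t. if t \<in> {a..b} then f t else 0) = f" "(\<lambda>t. if t \<in> {c..d} then f t else 0) = f"
    using assms by auto
  then show ?thesis
    using integral_restrict_UNIV[of "{a..b}" f] integral_restrict_UNIV[of "{c..d}" f] by simp
qed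

context banach_space_over
begin

lemma dist_of_kernel_translate:
  assumes w: "continuous_on UNIV w" and \<rho>: "(\<lambda>t. of_real (r t) :: 'k) \<in> test_on 1"
  shows "dist_of scaleK w (\<lambda>y. of_real (r (y - z))) = average r w z"
proof -
  have t: "(\<lambda>y. of_real (r (y - z)) :: 'k) \<in> test_functions"
    using test_translate[OF test_on_test[OF \<rho>], of "- z"] by simp
  have "r (y - z) = 0" if "y \<notin> {z-1..z+1}" for y
    using test_on_outside[OF \<rho>, of "y - z"] that by auto
  then have "dist_of scaleK w (\<lambda>y. of_real (r (y - z))) = integral {z-1..z+1} (\<lambda>y. r (y - z) *\<^sub>R w y)"
    using dist_of_continuous[OF w t, of "z - 1" "z + 1"] by (simp add: scaleK_of_real)
  also have "\<dots> = average r w z"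
    using integral_shift_real_ivl[of "z - 1" z "z + 1" "\<lambda>y. r (y - z) *\<^sub>R w y"]
    by (simp add: average_def add.commute)
  finally show ?thesis .
qed

lemma dist_of_convolution_kernel:
  assumes S: "S \<in> \<D>'" and \<phi>: "\<phi> \<in> test_functions" and \<rho>: "(\<lambda>t. of_real (r t) :: 'k) \<in> test_on 1"
  shows "dist_of scaleK (convolution S (\<lambda>t. of_real (r t))) \<phi> = S (average r \<phi>)"
proof -
  obtain R where R: "R \<ge> 0" "\<phi> \<in> test_on R" using test_functionsE[OF \<phi>] by blast
  have R': "-R \<le> R" using R(1) by simp
  have c\<phi>: "continuous_on UNIV \<phi>" by (intro continuous_on_smooth test_smooth \<phi>)
  note \<rho>t = test_on_test[OF \<rho>]
  have "integral {-R..R} (\<lambda>y. \<phi> y * of_real (r (y - z))) = average r \<phi> z" for z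
  proof -
    have "r (y - z) = 0" if "y \<notin> {z-1..z+1}" for y
      using test_on_outside[OF \<rho>, of "y - z"] that by auto
    then have "integral {-R..R} (\<lambda>y. \<phi> y * of_real (r (y - z))) = integral {z-1..z+1} (\<lambda>y. \<phi> y * of_real (r (y - z)))"
      using test_on_outside[OF R(2)] by (intro integral_same_support) auto
    also have "\<dots> = average r \<phi> z"
      using integral_shift_real_ivl[of "z - 1" z "z + 1" "\<lambda>y. \<phi> y * of_real (r (y - z))"]
      by (simp add: average_def add.commute scaleR_conv_of_real mult.commute)
    finally show ?thesis .
  qed
  then have "S (average r \<phi>) = integral {-R..R} (\<lambda>y. scaleK (\<phi> y) (convolution S (\<lambda>t. of_real (r t)) y))"
    using dist_integral[OF S \<rho>t c\<phi> R'] by (simp add: fun_eq_iff[symmetric] ext)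
  also have "\<dots> = dist_of scaleK (convolution S (\<lambda>t. of_real (r t))) \<phi>"
    by (rule dist_of_continuous[OF continuous_on_convolution[OF S \<rho>t] \<phi> R' test_on_outside[OF R(2)], symmetric])
  finally show ?thesis ..
qed

text \<open>The values of \<open>w\<close> are limits of averages. These depend only on the distribution, hence are
  averages of an essentially bounded function as well.\<close>

lemma bounded_if_dist_of_Linf:
  assumes w: "continuous_on UNIV w" and L: "dist_of scaleK w \<in> Linf scaleK"
  shows "\<exists>C. \<forall>x. norm (w x) \<le> C"
proof -
  obtain g C where g: "dist_of scaleK w = dist_of scaleK g" "locally_bochner g" "AE t in lebesgue. norm (g t) \<le> C"
    using L unfolding Linf_def by blast
  have C: "AE t in lebesgue. norm (g t) \<le> max C 0" using g(3) by eventually_elim auto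
  obtain r :: "nat \<Rightarrow> real \<Rightarrow> real" and \<delta> where r: "\<And>n. averaging_kernel (\<delta> n) (r n)" "\<delta> \<longlonglongrightarrow> 0"
    "\<And>n. (\<lambda>t. of_real (r n t) :: 'k) \<in> test_on 1"
    using ex_mollifiers[where 'k = 'k] by metis
  have "norm (w x) \<le> max C 0" for x
  proof (rule LIMSEQ_le_const2)
    show "(\<lambda>n. norm (average (r n) w x)) \<longlonglongrightarrow> norm (w x)"
      by (intro tendsto_norm averages_tendsto[OF r(1,2) w])
    have "norm (average (r n) w x) \<le> max C 0" for n
    proof -
      define \<rho> where "\<rho> y = (of_real (r n (y - x)) :: 'k)" for y
      have \<rho>: "\<rho> \<in> test_on (1 + \<bar>x\<bar>)"
        using test_on_translate[OF r(3)[of n], of "- x" "\<bar>x\<bar>"] by (simp add: \<rho>_def[abs_def])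
      have "norm (dist_of scaleK g \<rho>) \<le> max C 0 * integral {- (1 + \<bar>x\<bar>)..1 + \<bar>x\<bar>} (\<lambda>t. norm (\<rho> t))"
        using pairing_bound[OF g(2) C _ \<rho>] test_on_test[OF \<rho>] by (simp add: dist_of_def)
      also have "integral {- (1 + \<bar>x\<bar>)..1 + \<bar>x\<bar>} (\<lambda>t. norm (\<rho> t)) = integral {x-1..x+1} (\<lambda>t. norm (\<rho> t))"
      proof (rule integral_same_support)
        show "norm (\<rho> t) = 0" if "t \<notin> {- (1 + \<bar>x\<bar>)..1 + \<bar>x\<bar>}" for t
          using test_on_outside[OF \<rho> that] by simp
        show "norm (\<rho> t) = 0" if "t \<notin> {x-1..x+1}" for t
          using test_on_outside[OF r(3)[of n], of "t - x"] that by (auto simp: \<rho>_def)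
      qed
      also have "\<dots> = integral {-1..1} (r n)"
        using integral_shift_real_ivl[of "x - 1" x "x + 1" "\<lambda>t. norm (\<rho> t)"] r(1)[of n]
        by (simp add: \<rho>_def averaging_kernel_def)
      also have "\<dots> = 1" using r(1)[of n] by (simp add: averaging_kernel_def)
      finally have "norm (dist_of scaleK w \<rho>) \<le> max C 0" by (simp add: g(1))
      then show ?thesis
        using dist_of_kernel_translate[OF w r(3)[of n], of x] by (simp add: \<rho>_def[abs_def])
    qed
    then show "\<exists>N. \<forall>n\<ge>N. norm (average (r n) w x) \<le> max C 0" by blast
  qed
  then show ?thesis by blast
qed

end

section \<open>Uniform boundedness for bilinear maps on test functions\<close>

text \<open>The test functions on \<open>{-R..R}\<close> as sequences of bounded continuous functions, one for each
  derivative. The sequences arising in this way form a closed subset of a complete metric space, so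
  that the Baire category theorem applies.\<close>

definition derivative_sequences :: "real \<Rightarrow> (nat \<Rightarrow> real \<Rightarrow>\<^sub>C 'k::{real_normed_field,euclidean_space}) set" where
  "derivative_sequences R = {F. apply_bcontfun (F 0) \<in> test_on R \<and>
     (\<forall>n. apply_bcontfun (F n) = iter_deriv n (apply_bcontfun (F 0)))}"

definition derivative_sequence :: "(real \<Rightarrow> 'k::{real_normed_field,euclidean_space}) \<Rightarrow> nat \<Rightarrow> real \<Rightarrow>\<^sub>C 'k" where
  "derivative_sequence \<phi> n = Bcontfun (iter_deriv n \<phi>)"

lemma apply_derivative_sequence:
  fixes \<phi> :: "real \<Rightarrow> 'k::{real_normed_field,euclidean_space}"
  assumes "\<phi> \<in> test_functions"
  shows "apply_bcontfun (derivative_sequence \<phi> n) = iter_deriv n \<phi>"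
proof -
  obtain M where "\<And>t. norm (iter_deriv n \<phi> t) \<le> M"
    using test_bounded[OF test_iter_deriv[OF assms]] by blast
  then have "iter_deriv n \<phi> \<in> bcontfun"
    using continuous_on_iter_deriv[OF test_smooth[OF assms]]
    by (auto simp: bcontfun_def bounded_iff)
  then show ?thesis by (simp add: derivative_sequence_def Bcontfun_inverse)
qed

lemma derivative_sequence_in:
  "\<phi> \<in> test_on R \<Longrightarrow> derivative_sequence \<phi> \<in> derivative_sequences R"
  by (simp add: derivative_sequences_def apply_derivative_sequence test_on_test)

lemma derivative_sequencesD:
  assumes "F \<in> derivative_sequences R"
  shows "apply_bcontfun (F 0) \<in> test_on R" "apply_bcontfun (F n) = iter_deriv n (apply_bcontfun (F 0))"
  using assms unfolding derivative_sequences_def by blast+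

lemma derivative_sequence_coordinate_tendsto:
  fixes F :: "nat \<Rightarrow> nat \<Rightarrow> real \<Rightarrow>\<^sub>C 'k::{real_normed_field,euclidean_space}"
  assumes "F \<longlonglongrightarrow> G"
  shows "uniform_limit UNIV (\<lambda>j. apply_bcontfun (F j n)) (apply_bcontfun (G n)) sequentially"
proof -
  have "(\<lambda>j. F j n) \<longlonglongrightarrow> G n"
    using continuous_on_tendsto_compose[OF continuous_on_product_coordinates[of n] assms] by auto
  show ?thesis
  proof (rule uniform_limitI)
    fix e :: real assume "e > 0"
    with \<open>(\<lambda>j. F j n) \<longlonglongrightarrow> G n\<close> have "\<forall>\<^sub>F j in sequentially. dist (F j n) (G n) < e" by (rule tendstoD)
    then show "\<forall>\<^sub>F j in sequentially. \<forall>t\<in>UNIV. dist (apply_bcontfun (F j n) t) (apply_bcontfun (G n) t) < e"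
      by eventually_elim (rule ballI, rule le_less_trans[OF dist_bounded])
  qed
qed

lemma closed_derivative_sequences: "closed (derivative_sequences R :: (nat \<Rightarrow> real \<Rightarrow>\<^sub>C 'k::{real_normed_field,euclidean_space}) set)"
  unfolding closed_sequential_limits
proof (intro allI impI, elim conjE)
  fix F :: "nat \<Rightarrow> nat \<Rightarrow> real \<Rightarrow>\<^sub>C 'k" and G
  assume F: "\<forall>j. F j \<in> derivative_sequences R" and lim: "F \<longlonglongrightarrow> G"
  define f where "f n j = apply_bcontfun (F j n)" for n j
  define g where "g n = apply_bcontfun (G n)" for n
  have ul: "uniform_limit UNIV (f n) (g n) sequentially" for n
    unfolding f_def[abs_def] g_def by (rule derivative_sequence_coordinate_tendsto[OF lim])
  have f: "f 0 j \<in> test_on R" "f n j = iter_deriv n (f 0 j)" for n j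
    using derivative_sequencesD F unfolding f_def by blast+
  have fd: "(f n j has_vector_derivative f (Suc n) j t) (at t)" for n j t
    using smooth_derivative[of "f 0 j" n t] f(1)[of j] f(2)[of n j] f(2)[of "Suc n" j] by (simp add: test_on_iff)
  have gd: "(g n has_vector_derivative g (Suc n) t) (at t)" for n t
  proof -
    have "\<exists>h. \<forall>x\<in>UNIV. (\<lambda>j. f n j x) \<longlonglongrightarrow> h x \<and> (h has_derivative (\<lambda>u. u *\<^sub>R g (Suc n) x)) (at x within UNIV)"
    proof (rule has_derivative_sequence[where f' = "\<lambda>j x u. u *\<^sub>R f (Suc n) j x" and ?x0.0 = 0])
      show "(f n j has_derivative (\<lambda>u. u *\<^sub>R f (Suc n) j x)) (at x within UNIV)" for j x
        using fd[of n j x] by (simp add: has_vector_derivative_def)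
      show "\<forall>\<^sub>F j in sequentially. \<forall>x\<in>UNIV. \<forall>u. norm (u *\<^sub>R f (Suc n) j x - u *\<^sub>R g (Suc n) x) \<le> e * norm u"
        if "e > 0" for e
      proof -
        have "\<forall>\<^sub>F j in sequentially. \<forall>x\<in>UNIV. dist (f (Suc n) j x) (g (Suc n) x) < e"
          using ul[of "Suc n"] that unfolding uniform_limit_iff by blast
        then show ?thesis
        proof eventually_elim
          case (elim j)
          have "norm (u *\<^sub>R f (Suc n) j x - u *\<^sub>R g (Suc n) x) \<le> e * norm u" for x u
          proof -
            have "norm (f (Suc n) j x - g (Suc n) x) \<le> e"
              using elim by (simp add: dist_norm less_imp_le)
            then have "\<bar>u\<bar> * norm (f (Suc n) j x - g (Suc n) x) \<le> \<bar>u\<bar> * e" by (rule mult_left_mono) simp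
            then show ?thesis unfolding scaleR_diff_right[symmetric] norm_scaleR by (simp add: mult.commute)
          qed
          then show ?case by blast
        qed
      qed
      show "(\<lambda>j. f n j 0) \<longlonglongrightarrow> g n 0" by (rule tendsto_uniform_limitI[OF ul]) simp
    qed auto
    then obtain h where h: "\<And>x. (\<lambda>j. f n j x) \<longlonglongrightarrow> h x" "\<And>x. (h has_derivative (\<lambda>u. u *\<^sub>R g (Suc n) x)) (at x)"
      by auto
    have "h x = g n x" for x
      by (rule LIMSEQ_unique[OF h(1) tendsto_uniform_limitI[OF ul]]) simp
    then have "h = g n" by auto
    then show ?thesis using h(2)[of t] by (simp add: has_vector_derivative_def)
  qed
  have "smooth (g 0)" "g n = iter_deriv n (g 0)" for n
    using smooth_tower[of g, OF gd] by auto
  moreover have "g 0 t = 0" if "\<bar>t\<bar> > R" for t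
  proof -
    have "(\<lambda>j. f 0 j t) \<longlonglongrightarrow> g 0 t" by (rule tendsto_uniform_limitI[OF ul]) simp
    moreover have "f 0 j t = 0" for j using f(1)[of j] that by (simp add: test_on_iff)
    ultimately show ?thesis by (simp add: LIMSEQ_const_iff)
  qed
  ultimately show "G \<in> derivative_sequences R"
    unfolding derivative_sequences_def mem_Collect_eq g_def[symmetric] test_on_iff by blast
qed

text \<open>A neighbourhood in the product topology constrains finitely many coordinates, that is,
  derivatives up to some order \<open>m\<close>; this is where the order comes from.\<close>

lemma open_derivative_neighbourhood:
  fixes F0 :: "nat \<Rightarrow> real \<Rightarrow>\<^sub>C 'k::{real_normed_field,euclidean_space}"
  assumes "open V" "F0 \<in> V"
  obtains m e where "e > 0" "\<And>F. (\<And>n. n \<le> m \<Longrightarrow> dist (F n) (F0 n) < e) \<Longrightarrow> F \<in> V"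
proof -
  have "openin (product_topology (\<lambda>_. euclidean) UNIV) V"
    using assms(1) by (simp add: euclidean_product_topology)
  then obtain U where U: "finite {i. U i \<noteq> UNIV}" "\<And>i. open (U i)" "F0 \<in> Pi\<^sub>E UNIV U" "Pi\<^sub>E UNIV U \<subseteq> V"
    using assms(2) unfolding openin_product_topology_alt by (auto simp: open_openin[symmetric])
  have "\<exists>e>0. ball (F0 i) e \<subseteq> U i" for i
    using U(2,3) open_contains_ball[of "U i"] by (auto simp: PiE_iff)
  then obtain e where e: "\<And>i. e i > 0" "\<And>i. ball (F0 i) (e i) \<subseteq> U i" by metis
  obtain m where m: "\<And>i. U i \<noteq> UNIV \<Longrightarrow> i \<le> m"
    using U(1) finite_nat_set_iff_bounded_le by auto
  define d where "d = Min (e ` {..m})"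
  have "d > 0" using e(1) by (simp add: d_def)
  moreover have "F \<in> V" if F: "\<And>n. n \<le> m \<Longrightarrow> dist (F n) (F0 n) < d" for F
  proof -
    have "F i \<in> U i" for i
    proof (cases "U i = UNIV")
      case False
      then have "i \<le> m" by (rule m)
      moreover from this have "d \<le> e i" by (simp add: d_def)
      ultimately have "F i \<in> ball (F0 i) (e i)" using F[of i] by (simp add: dist_commute)
      then show ?thesis using e(2) by blast
    qed simp
    then show ?thesis using U(4) by (auto simp: PiE_iff)
  qed
  ultimately show ?thesis using that by blast
qed

lemma norm_le_norm_expansion:
  fixes x :: "'x::real_normed_vector"
  assumes "x = y + p + (q + r)"
  shows "norm y \<le> norm x + (norm p + norm q + norm r)"
proof -
  have "y = x - p - q - r" using assms by simp
  then show ?thesis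
    using norm_triangle_ineq4[of "x - p - q" r] norm_triangle_ineq4[of "x - p" q] norm_triangle_ineq4[of x p] by simp
qed

lemma norm_second_difference:
  fixes p :: "'x::real_normed_vector"
  shows "norm ((p - q) - (r - s)) \<le> norm p + norm q + norm r + norm s"
  using norm_triangle_ineq4[of "p - q" "r - s"] norm_triangle_ineq4[of p q] norm_triangle_ineq4[of r s] by simp

text \<open>The closed sets \<open>L N\<close> where all \<open>B\<^sub>i\<close> are bounded by \<open>N\<close> exhaust the complete space of pairs, so one
  of them has an interior point \<open>(\<phi>\<^sub>0, \<psi>\<^sub>0)\<close>. The second difference of \<open>B\<^sub>i\<close> at this point with increments
  \<open>\<phi>\<close> and \<open>\<psi>\<close> is \<open>B\<^sub>i(\<phi>, \<psi>)\<close>, which is therefore at most \<open>4 N\<close> for small \<open>\<phi>\<close> and \<open>\<psi>\<close>.\<close>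

theorem bilinear_uniform_boundedness:
  fixes B :: "'i \<Rightarrow> (real \<Rightarrow> 'k::{real_normed_field,euclidean_space}) \<Rightarrow> (real \<Rightarrow> 'k) \<Rightarrow> 'x::real_normed_vector"
  assumes add_left: "\<And>i \<phi> \<phi>' \<psi>. \<phi> \<in> test_on R \<Longrightarrow> \<phi>' \<in> test_on R \<Longrightarrow> \<psi> \<in> test_on R \<Longrightarrow>
      B i (\<lambda>t. \<phi> t + \<phi>' t) \<psi> = B i \<phi> \<psi> + B i \<phi>' \<psi>"
    and add_right: "\<And>i \<phi> \<psi> \<psi>'. \<phi> \<in> test_on R \<Longrightarrow> \<psi> \<in> test_on R \<Longrightarrow> \<psi>' \<in> test_on R \<Longrightarrow>
      B i \<phi> (\<lambda>t. \<psi> t + \<psi>' t) = B i \<phi> \<psi> + B i \<phi> \<psi>'"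
    and scale_left: "\<And>i \<phi> \<psi> a. \<phi> \<in> test_on R \<Longrightarrow> \<psi> \<in> test_on R \<Longrightarrow> B i (\<lambda>t. a *\<^sub>R \<phi> t) \<psi> = a *\<^sub>R B i \<phi> \<psi>"
    and scale_right: "\<And>i \<phi> \<psi> a. \<phi> \<in> test_on R \<Longrightarrow> \<psi> \<in> test_on R \<Longrightarrow> B i \<phi> (\<lambda>t. a *\<^sub>R \<psi> t) = a *\<^sub>R B i \<phi> \<psi>"
    and cont: "\<And>i. \<exists>m C. \<forall>\<phi>\<in>test_on R. \<forall>\<psi>\<in>test_on R. \<forall>d>0. \<forall>e>0.
      derivs_le m \<phi> d \<longrightarrow> derivs_le m \<psi> e \<longrightarrow>
      norm (B i \<phi> \<psi>) \<le> C * d * e"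
    and bounded: "\<And>\<phi> \<psi>. \<phi> \<in> test_on R \<Longrightarrow> \<psi> \<in> test_on R \<Longrightarrow> \<exists>C. \<forall>i. norm (B i \<phi> \<psi>) \<le> C"
  shows "\<exists>m C. \<forall>i. \<forall>\<phi>\<in>test_on R. \<forall>\<psi>\<in>test_on R. \<forall>d>0. \<forall>e>0.
      derivs_le m \<phi> d \<longrightarrow> derivs_le m \<psi> e \<longrightarrow>
      norm (B i \<phi> \<psi>) \<le> C * d * e"
proof -
  let ?E = "derivative_sequences R :: (nat \<Rightarrow> real \<Rightarrow>\<^sub>C 'k) set"
  let ?X = "top_of_set (?E \<times> ?E)"
  define \<beta> where "\<beta> i p = B i (apply_bcontfun (fst p 0)) (apply_bcontfun (snd p 0))"
    for i and p :: "(nat \<Rightarrow> real \<Rightarrow>\<^sub>C 'k) \<times> (nat \<Rightarrow> real \<Rightarrow>\<^sub>C 'k)"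
  define L where "L N = {p \<in> ?E \<times> ?E. \<forall>i. norm (\<beta> i p) \<le> real N}" for N
  have closed_L: "closedin ?X (L N)" for N
  proof -
    have "closed (L N)"
      unfolding closed_sequential_limits
    proof (intro allI impI, elim conjE)
      fix p :: "nat \<Rightarrow> (nat \<Rightarrow> real \<Rightarrow>\<^sub>C 'k) \<times> (nat \<Rightarrow> real \<Rightarrow>\<^sub>C 'k)" and q
      assume p: "\<forall>j. p j \<in> L N" and lim: "p \<longlonglongrightarrow> q"
      have "closed (?E \<times> ?E)" by (intro closed_Times closed_derivative_sequences)
      moreover have "\<forall>j. p j \<in> ?E \<times> ?E" using p by (simp add: L_def)
      ultimately have q: "q \<in> ?E \<times> ?E" using lim unfolding closed_sequential_limits by blast
      define u v where "u j n = apply_bcontfun (fst (p j) n)" and "v j n = apply_bcontfun (snd (p j) n)" for j n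
      define u' v' where "u' n = apply_bcontfun (fst q n)" and "v' n = apply_bcontfun (snd q n)" for n
      have lims: "uniform_limit UNIV (\<lambda>j. u j n) (u' n) sequentially" "uniform_limit UNIV (\<lambda>j. v j n) (v' n) sequentially" for n
        unfolding u_def v_def u'_def v'_def
        by (intro derivative_sequence_coordinate_tendsto tendsto_fst tendsto_snd lim)+
      have E: "u j 0 \<in> test_on R" "v j 0 \<in> test_on R" "u j n = iter_deriv n (u j 0)" "v j n = iter_deriv n (v j 0)" for j n
      proof -
        have "fst (p j) \<in> ?E" "snd (p j) \<in> ?E" using p by (simp_all add: L_def mem_Times_iff)
        then show "u j 0 \<in> test_on R" "v j 0 \<in> test_on R" "u j n = iter_deriv n (u j 0)" "v j n = iter_deriv n (v j 0)"
          unfolding u_def v_def by (blast intro: derivative_sequencesD)+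
      qed
      have E': "u' 0 \<in> test_on R" "v' 0 \<in> test_on R" "u' n = iter_deriv n (u' 0)" "v' n = iter_deriv n (v' 0)" for n
      proof -
        have "fst q \<in> ?E" "snd q \<in> ?E" using q by (simp_all add: mem_Times_iff)
        then show "u' 0 \<in> test_on R" "v' 0 \<in> test_on R" "u' n = iter_deriv n (u' 0)" "v' n = iter_deriv n (v' 0)"
          unfolding u'_def v'_def by (blast intro: derivative_sequencesD)+
      qed
      have "norm (\<beta> i q) \<le> real N" for i
      proof (rule field_le_epsilon)
        fix \<epsilon> :: real assume \<epsilon>: "\<epsilon> > 0"
        obtain m C where mC: "\<And>\<phi> \<psi> d e. \<phi> \<in> test_on R \<Longrightarrow> \<psi> \<in> test_on R \<Longrightarrow> d > 0 \<Longrightarrow> e > 0 \<Longrightarrow>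
            derivs_le m \<phi> d \<Longrightarrow> derivs_le m \<psi> e \<Longrightarrow>
            norm (B i \<phi> \<psi>) \<le> C * d * e"
          using cont[of i] by blast
        obtain M1 where M1: "M1 > 0" "\<And>k t. k \<le> m \<Longrightarrow> norm (iter_deriv k (u' 0) t) \<le> M1"
          using test_bounded_upto[OF test_on_test[OF E'(1)], of m] by blast
        obtain M2 where M2: "M2 > 0" "\<And>k t. k \<le> m \<Longrightarrow> norm (iter_deriv k (v' 0) t) \<le> M2"
          using test_bounded_upto[OF test_on_test[OF E'(2)], of m] by blast
        define K where "K = \<bar>C\<bar> * (M1 + M2 + 1)"
        define d where "d = min 1 (\<epsilon> / (K + 1))"
        have K: "K \<ge> 0" using M1 M2 by (simp add: K_def)
        have d: "d > 0" "d \<le> 1" using \<epsilon> K by (auto simp: d_def)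
        have "\<forall>\<^sub>F j in sequentially. \<forall>k\<in>{..m}. \<forall>t\<in>UNIV. dist (u j k t) (u' k t) < d"
          "\<forall>\<^sub>F j in sequentially. \<forall>k\<in>{..m}. \<forall>t\<in>UNIV. dist (v j k t) (v' k t) < d"
          using lims d(1) by (intro eventually_ball_finite; auto simp: uniform_limit_iff)+
        from eventually_conj[OF this] obtain j where j: "\<And>k t. k \<le> m \<Longrightarrow> norm (u j k t - u' k t) \<le> d" "\<And>k t. k \<le> m \<Longrightarrow> norm (v j k t - v' k t) \<le> d"
          unfolding eventually_sequentially dist_norm by (meson UNIV_I atMost_iff le_refl less_imp_le)
        define a b where "a t = u j 0 t - u' 0 t" and "b t = v j 0 t - v' 0 t" for t
        have ab: "a \<in> test_on R" "b \<in> test_on R"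
          unfolding a_def b_def by (intro test_on_diff E E')+
        have sm: "smooth (u j 0)" "smooth (u' 0)" "smooth (v j 0)" "smooth (v' 0)"
          using E(1,2) E'(1,2) by (auto simp: test_on_iff)
        have da: "norm (iter_deriv k a t) \<le> d" "norm (iter_deriv k b t) \<le> d" if "k \<le> m" for k t
          using j[OF that, of t] smooth_diff(2)[OF sm(1,2), of k] smooth_diff(2)[OF sm(3,4), of k]
          by (simp_all add: a_def[abs_def] b_def[abs_def] E(3,4)[symmetric] E'(3,4)[symmetric])
        have ua: "(\<lambda>t. u' 0 t + a t) = u j 0" "(\<lambda>t. v' 0 t + b t) = v j 0" by (auto simp: a_def b_def)
        have "B i (u j 0) (v j 0) = B i (u' 0) (v' 0) + B i (u' 0) b + (B i a (v' 0) + B i a b)"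
          using add_left[OF E'(1) ab(1) E(2), of i j] add_right[OF E'(1,2) ab(2), of i] add_right[OF ab(1) E'(2) ab(2), of i]
          by (simp add: ua)
        then have "norm (B i (u' 0) (v' 0)) \<le> norm (B i (u j 0) (v j 0)) + (norm (B i (u' 0) b) + norm (B i a (v' 0)) + norm (B i a b))"
          by (rule norm_le_norm_expansion)
        also have "\<dots> \<le> real N + (C * M1 * d + C * d * M2 + C * d * d)"
        proof (intro add_mono)
          show "norm (B i (u j 0) (v j 0)) \<le> real N"
            using p unfolding L_def \<beta>_def u_def v_def by simp
          show "norm (B i (u' 0) b) \<le> C * M1 * d"
            by (rule mC[OF E'(1) ab(2) M1(1) d(1)]) (use M1(2) da(2) in blast)+
          show "norm (B i a (v' 0)) \<le> C * d * M2"
            by (rule mC[OF ab(1) E'(2) d(1) M2(1)]) (use M2(2) da(1) in blast)+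
          show "norm (B i a b) \<le> C * d * d"
            by (rule mC[OF ab d(1) d(1)]) (use da in blast)+
        qed
        also have "C * M1 * d + C * d * M2 + C * d * d = C * (M1 + M2 + d) * d" by (simp add: algebra_simps)
        also have "\<dots> \<le> K * d"
          unfolding K_def using M1 M2 d by (intro mult_right_mono mult_mono) auto
        also have "K * d \<le> \<epsilon>"
        proof -
          have "K * d \<le> (K + 1) * d" using d by (simp add: mult_right_mono)
          also have "\<dots> \<le> (K + 1) * (\<epsilon> / (K + 1))" using K by (intro mult_left_mono) (auto simp: d_def)
          finally show ?thesis using K by simp
        qed
        finally show "norm (\<beta> i q) \<le> real N + \<epsilon>" by (simp add: \<beta>_def u'_def v'_def)
      qed
      then show "q \<in> L N" using q by (simp add: L_def)
    qed
    then show ?thesis by (auto simp: closedin_closed L_def)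
  qed
  have "\<Union> (range L) = ?E \<times> ?E"
  proof -
    have "\<exists>N. p \<in> L N" if p: "p \<in> ?E \<times> ?E" for p
    proof -
      have "fst p \<in> ?E" "snd p \<in> ?E" using p by (simp_all add: mem_Times_iff)
      from bounded[OF this[THEN derivative_sequencesD(1)]]
      obtain C where C: "\<And>i. norm (\<beta> i p) \<le> C"
        unfolding \<beta>_def by blast
      obtain N where "C \<le> real N" using real_arch_simple by blast
      then have "norm (\<beta> i p) \<le> real N" for i using C[of i] by simp
      then show ?thesis using p unfolding L_def by blast
    qed
    then show ?thesis by (auto simp: L_def)
  qed
  moreover have "completely_metrizable_space ?X"
  proof (rule completely_metrizable_space_closedin[OF completely_metrizable_space_euclidean])
    show "closedin euclidean (?E \<times> ?E)"
      using closed_Times[OF closed_derivative_sequences closed_derivative_sequences] by simp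
  qed
  moreover have "(derivative_sequence (\<lambda>t. 0), derivative_sequence (\<lambda>t. 0)) \<in> ?E \<times> ?E"
    by (simp add: derivative_sequence_in test_on_zero)
  moreover have "?X interior_of (?E \<times> ?E) = ?E \<times> ?E"
    by (metis interior_of_topspace topspace_euclidean_subtopology)
  ultimately obtain N where "?X interior_of (L N) \<noteq> {}"
    using Baire_category_alt[of ?X "range L"] closed_L by fastforce
  then obtain F0 G0 where "(F0, G0) \<in> ?X interior_of (L N)" by (metis ex_in_conv prod.collapse)
  then obtain W where W: "open W" "(F0, G0) \<in> W" "(F0, G0) \<in> ?E \<times> ?E" "W \<inter> (?E \<times> ?E) \<subseteq> L N"
    unfolding interior_of_def openin_open by auto
  obtain V1 V2 where V: "open V1" "open V2" "F0 \<in> V1" "G0 \<in> V2" "V1 \<times> V2 \<subseteq> W"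
    using open_prod_elim[OF W(1,2)] by (metis mem_Sigma_iff)
  obtain m1 e1 where e1: "e1 > 0" "\<And>F. (\<And>n. n \<le> m1 \<Longrightarrow> dist (F n) (F0 n) < e1) \<Longrightarrow> F \<in> V1"
    using open_derivative_neighbourhood[OF V(1,3)] by metis
  obtain m2 e2 where e2: "e2 > 0" "\<And>F. (\<And>n. n \<le> m2 \<Longrightarrow> dist (F n) (G0 n) < e2) \<Longrightarrow> F \<in> V2"
    using open_derivative_neighbourhood[OF V(2,4)] by metis
  define m \<delta> where "m = max m1 m2" and "\<delta> = min e1 e2 / 2"
  have \<delta>: "\<delta> > 0" "\<delta> < e1" "\<delta> < e2" using e1(1) e2(1) by (auto simp: \<delta>_def min_def)
  define \<phi>0 \<psi>0 where "\<phi>0 = apply_bcontfun (F0 0)" and "\<psi>0 = apply_bcontfun (G0 0)"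
  have F0: "\<phi>0 \<in> test_on R" "\<And>n. apply_bcontfun (F0 n) = iter_deriv n \<phi>0"
    and G0: "\<psi>0 \<in> test_on R" "\<And>n. apply_bcontfun (G0 n) = iter_deriv n \<psi>0"
    using W(3) unfolding \<phi>0_def \<psi>0_def mem_Times_iff fst_conv snd_conv
    by (blast intro: derivative_sequencesD)+
  have near: "dist (derivative_sequence (\<lambda>t. \<omega>0 t + \<eta> t) n) (H n) \<le> \<delta>"
    if "\<omega>0 \<in> test_on R" "\<And>n. apply_bcontfun (H n) = iter_deriv n \<omega>0" "\<eta> \<in> test_on R" "\<And>t. norm (iter_deriv n \<eta> t) \<le> \<delta>"
    for \<omega>0 \<eta> :: "real \<Rightarrow> 'k" and H n
  proof (rule dist_bound)
    fix t
    have "smooth \<omega>0" "smooth \<eta>" using that by (auto simp: test_on_iff)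
    then show "dist (apply_bcontfun (derivative_sequence (\<lambda>t. \<omega>0 t + \<eta> t) n) t) (apply_bcontfun (H n) t) \<le> \<delta>"
      using that(4)[of t]
      by (simp add: apply_derivative_sequence[OF test_on_test[OF test_on_add[OF that(1,3)]]] that(2) smooth_add dist_norm)
  qed
  have bN: "norm (B i (\<lambda>t. \<phi>0 t + \<phi> t) (\<lambda>t. \<psi>0 t + \<psi> t)) \<le> real N"
    if \<phi>: "\<phi> \<in> test_on R" "\<And>k t. k \<le> m \<Longrightarrow> norm (iter_deriv k \<phi> t) \<le> \<delta>"
      and \<psi>: "\<psi> \<in> test_on R" "\<And>k t. k \<le> m \<Longrightarrow> norm (iter_deriv k \<psi> t) \<le> \<delta>" for i \<phi> \<psi>
  proof -
    define F where "F = derivative_sequence (\<lambda>t. \<phi>0 t + \<phi> t)"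
    define G where "G = derivative_sequence (\<lambda>t. \<psi>0 t + \<psi> t)"
    have t: "(\<lambda>t. \<phi>0 t + \<phi> t) \<in> test_on R" "(\<lambda>t. \<psi>0 t + \<psi> t) \<in> test_on R"
      by (intro test_on_add F0 G0 \<phi> \<psi>)+
    have "F \<in> V1" unfolding F_def
    proof (rule e1(2))
      fix n assume "n \<le> m1"
      then have "n \<le> m" by (simp add: m_def)
      then have "dist (derivative_sequence (\<lambda>t. \<phi>0 t + \<phi> t) n) (F0 n) \<le> \<delta>"
        by (intro near[OF F0 \<phi>(1)] \<phi>(2))
      then show "dist (derivative_sequence (\<lambda>t. \<phi>0 t + \<phi> t) n) (F0 n) < e1" using \<delta>(2) by simp
    qed
    moreover have "G \<in> V2" unfolding G_def
    proof (rule e2(2))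
      fix n assume "n \<le> m2"
      then have "n \<le> m" by (simp add: m_def)
      then have "dist (derivative_sequence (\<lambda>t. \<psi>0 t + \<psi> t) n) (G0 n) \<le> \<delta>"
        by (intro near[OF G0 \<psi>(1)] \<psi>(2))
      then show "dist (derivative_sequence (\<lambda>t. \<psi>0 t + \<psi> t) n) (G0 n) < e2" using \<delta>(3) by simp
    qed
    moreover have "F \<in> ?E" "G \<in> ?E" unfolding F_def G_def by (intro derivative_sequence_in t)+
    ultimately have "(F, G) \<in> L N" using V(5) W(4) by blast
    then have "norm (\<beta> i (F, G)) \<le> real N" by (simp add: L_def)
    then show ?thesis
      by (simp add: \<beta>_def F_def G_def apply_derivative_sequence[OF test_on_test[OF t(1)]] apply_derivative_sequence[OF test_on_test[OF t(2)]])
  qed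
  have b4: "norm (B i \<phi> \<psi>) \<le> 4 * real N"
    if \<phi>: "\<phi> \<in> test_on R" "\<And>k t. k \<le> m \<Longrightarrow> norm (iter_deriv k \<phi> t) \<le> \<delta>"
      and \<psi>: "\<psi> \<in> test_on R" "\<And>k t. k \<le> m \<Longrightarrow> norm (iter_deriv k \<psi> t) \<le> \<delta>" for i \<phi> \<psi>
  proof -
    let ?z = "\<lambda>t::real. 0 :: 'k"
    have z: "?z \<in> test_on R" "\<And>k t. k \<le> m \<Longrightarrow> norm (iter_deriv k ?z t) \<le> \<delta>"
      using \<delta>(1) by (simp_all add: test_on_zero smooth_zero)
    have "B i \<phi> \<psi> = (B i (\<lambda>t. \<phi>0 t + \<phi> t) (\<lambda>t. \<psi>0 t + \<psi> t) - B i (\<lambda>t. \<phi>0 t + \<phi> t) \<psi>0) - (B i \<phi>0 (\<lambda>t. \<psi>0 t + \<psi> t) - B i \<phi>0 \<psi>0)"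
      using add_left[OF F0(1) \<phi>(1) test_on_add[OF G0(1) \<psi>(1)], of i] add_left[OF F0(1) \<phi>(1) G0(1), of i]
        add_right[OF \<phi>(1) G0(1) \<psi>(1), of i] by simp
    then have "norm (B i \<phi> \<psi>) \<le> norm (B i (\<lambda>t. \<phi>0 t + \<phi> t) (\<lambda>t. \<psi>0 t + \<psi> t)) + norm (B i (\<lambda>t. \<phi>0 t + \<phi> t) \<psi>0)
        + norm (B i \<phi>0 (\<lambda>t. \<psi>0 t + \<psi> t)) + norm (B i \<phi>0 \<psi>0)"
      by (simp only: norm_second_difference)
    also have "\<dots> \<le> real N + real N + real N + real N"
      using bN[OF \<phi> \<psi>, of i] bN[OF \<phi> z, of i] bN[OF z \<psi>, of i] bN[OF z z, of i] by (intro add_mono) simp_all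
    finally show ?thesis by simp
  qed
  have final: "norm (B i \<phi> \<psi>) \<le> (4 * real N / \<delta>\<^sup>2) * d * e"
    if \<phi>: "\<phi> \<in> test_on R" "derivs_le m \<phi> d" and d: "d > 0"
      and \<psi>: "\<psi> \<in> test_on R" "derivs_le m \<psi> e" and e: "e > 0" for i \<phi> \<psi> d e
  proof -
    define a b where "a = \<delta> / d" and "b = \<delta> / e"
    have ab: "a > 0" "b > 0" using \<delta> d e by (auto simp: a_def b_def)
    have sc: "norm (iter_deriv k (\<lambda>t. a *\<^sub>R f t) t) \<le> \<delta>"
      if "smooth f" "norm (iter_deriv k f t) \<le> d" "a = \<delta> / d" "d > 0" for f :: "real \<Rightarrow> 'k" and k t d a
      using that \<delta>(1) mult_left_mono[OF that(2), of "\<delta> / d"] by (simp add: smooth_scaleR(2))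
    have "norm (B i (\<lambda>t. a *\<^sub>R \<phi> t) (\<lambda>t. b *\<^sub>R \<psi> t)) \<le> 4 * real N"
    proof (rule b4)
      have "smooth \<phi>" "smooth \<psi>" using \<phi>(1) \<psi>(1) by (simp_all add: test_on_iff)
      then show "norm (iter_deriv k (\<lambda>t. a *\<^sub>R \<phi> t) t) \<le> \<delta>" "norm (iter_deriv k (\<lambda>t. b *\<^sub>R \<psi> t) t) \<le> \<delta>"
        if "k \<le> m" for k t
        using that \<phi>(2) \<psi>(2) d e sc[of \<phi> k t d a] sc[of \<psi> k t e b] by (simp_all add: a_def b_def)
    qed (intro test_on_scaleR \<phi> \<psi>)+
    then have "a * (b * norm (B i \<phi> \<psi>)) \<le> 4 * real N"
      using scale_left[OF \<phi>(1) test_on_scaleR[OF \<psi>(1)], of i a b] scale_right[OF \<phi>(1) \<psi>(1), of i b] ab by simp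
    then show ?thesis using d e \<delta>(1) by (simp add: a_def b_def field_simps power2_eq_square)
  qed
  show ?thesis
    by (intro exI[of _ m] exI[of _ "4 * real N / \<delta>\<^sup>2"] allI ballI impI) (rule final)
qed

section \<open>Distributions with regularisations in a given class\<close>

context banach_space_over
begin

lemma convolution_linear:
  assumes T: "T \<in> \<D>'" and \<phi>: "\<phi> \<in> test_functions" "\<psi> \<in> test_functions"
  shows "convolution T (\<lambda>t. \<phi> t + \<psi> t) = (\<lambda>x. convolution T \<phi> x + convolution T \<psi> x)"
    "convolution T (\<lambda>t. a *\<^sub>R \<phi> t) = (\<lambda>x. a *\<^sub>R convolution T \<phi> x)"
  unfolding convolution_def
  by (simp_all add: dist_add[OF T test_reflect[OF \<phi>(1)] test_reflect[OF \<phi>(2)]] dist_scaleR[OF T test_reflect[OF \<phi>(1)]])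

text \<open>Only the values of \<open>T * \<phi>\<close> on a compact neighbourhood of \<open>x\<close> matter, and on that \<open>T\<close> has finite order.\<close>

lemma double_convolution_bound:
  assumes T: "T \<in> \<D>'" and R: "R \<ge> 0"
  shows "\<exists>m C. \<forall>\<phi>\<in>test_on R. \<forall>\<psi>\<in>test_on R. \<forall>d>0. \<forall>e>0.
      derivs_le m \<phi> d \<longrightarrow> derivs_le m \<psi> e \<longrightarrow>
      norm (convolution (dist_of scaleK (convolution T \<phi>)) \<psi> x) \<le> C * d * e"
proof -
  define K where "K = R + (\<bar>x\<bar> + R)"
  obtain m C where C: "C \<ge> 0" and mC: "\<And>\<phi> d. \<phi> \<in> test_on K \<Longrightarrow>
      derivs_le m \<phi> d \<Longrightarrow> norm (T \<phi>) \<le> C * d"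
    using dist_bound[OF T, of K] by blast
  have "norm (convolution (dist_of scaleK (convolution T \<phi>)) \<psi> x) \<le> (C * (2 * R)) * d * e"
    if \<phi>: "\<phi> \<in> test_on R" "derivs_le m \<phi> d" and d: "d > 0"
      and \<psi>: "\<psi> \<in> test_on R" "derivs_le m \<psi> e" and e: "e > 0" for \<phi> \<psi> d e
  proof -
    have t\<phi>: "\<phi> \<in> test_functions" and t\<psi>: "(\<lambda>y. \<psi> (x - y)) \<in> test_functions"
      using test_on_test[OF \<phi>(1)] test_reflect[OF test_on_test[OF \<psi>(1)]] by auto
    have cT: "continuous_on UNIV (convolution T \<phi>)" by (rule continuous_on_convolution[OF T t\<phi>])
    have xR: "x - R \<le> x + R" using R by simp
    have out: "\<psi> (x - y) = 0" if "y \<notin> {x-R..x+R}" for y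
      by (rule test_on_outside[OF \<psi>(1)]) (use that in auto)
    have "convolution (dist_of scaleK (convolution T \<phi>)) \<psi> x =
        integral {x-R..x+R} (\<lambda>y. scaleK (\<psi> (x - y)) (convolution T \<phi> y))"
      unfolding convolution_def[of "dist_of _ _"]
      by (rule dist_of_continuous[OF cT t\<psi> xR out])
    also have "norm \<dots> \<le> (e * (C * d)) * (x + R - (x - R))"
    proof (rule integral_bound[OF xR])
      show "continuous_on {x-R..x+R} (\<lambda>y. scaleK (\<psi> (x - y)) (convolution T \<phi> y))"
        by (intro continuous_on_scaleK continuous_on_smooth[OF test_smooth[OF t\<psi>]] continuous_on_subset[OF cT]) simp
      show "norm (scaleK (\<psi> (x - y)) (convolution T \<phi> y)) \<le> e * (C * d)" if y: "y \<in> {x-R..x+R}" for y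
      proof -
        have "\<bar>y\<bar> \<le> \<bar>x\<bar> + R" using y by (auto simp: abs_if split: if_splits)
        then have "(\<lambda>z. \<phi> (y - z)) \<in> test_on K" unfolding K_def by (rule test_on_reflect[OF \<phi>(1)])
        then have "norm (convolution T \<phi> y) \<le> C * d"
          unfolding convolution_def
        proof (rule mC, intro allI impI)
          fix k t assume "k \<le> m"
          then show "norm (iter_deriv k (\<lambda>z. \<phi> (y - z)) t) \<le> d"
            using \<phi>(2) by (simp add: smooth_reflect(2)[OF test_smooth[OF t\<phi>]] norm_power)
        qed
        moreover have "norm (\<psi> (x - y)) \<le> e" using \<psi>(2)[rule_format, of 0 "x - y"] by simp
        ultimately show ?thesis unfolding norm_scaleK using e by (intro mult_mono) auto
      qed
    qed
    finally show ?thesis by (simp add: algebra_simps)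
  qed
  then show ?thesis by blast
qed

text \<open>For fixed \<open>\<phi>\<close> and \<open>\<psi>\<close> the function \<open>(T * \<phi>) * \<psi>\<close> is bounded, being a regularisation of
  \<open>T * \<phi> \<in> A\<close>. Boundedness of \<open>T * \<phi>\<close> itself is not at hand, which is why the bilinear form is
  considered instead of the linear one.\<close>

lemma double_convolution_uniform_bound:
  assumes T: "T \<in> distributional_class scaleK A" and A: "A \<subseteq> distributional_class scaleK (Linf scaleK)" and R: "R \<ge> 0"
  shows "\<exists>m C. \<forall>x. \<forall>\<phi>\<in>test_on R. \<forall>\<psi>\<in>test_on R. \<forall>d>0. \<forall>e>0.
      derivs_le m \<phi> d \<longrightarrow> derivs_le m \<psi> e \<longrightarrow>
      norm (convolution (dist_of scaleK (convolution T \<phi>)) \<psi> x) \<le> C * d * e"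
proof -
  have TD: "T \<in> \<D>'" and TA: "\<And>\<phi>. \<phi> \<in> test_functions \<Longrightarrow> dist_of scaleK (convolution T \<phi>) \<in> A"
    using T by (auto simp: distributional_class_def)
  have S: "dist_of scaleK (convolution T \<phi>) \<in> \<D>'"
    "\<And>\<psi>. \<psi> \<in> test_functions \<Longrightarrow> dist_of scaleK (convolution (dist_of scaleK (convolution T \<phi>)) \<psi>) \<in> Linf scaleK"
    if "\<phi> \<in> test_functions" for \<phi>
    using TA[OF that] A by (auto simp: distributional_class_def)
  note t = test_on_test[where R = R]
  have c: "continuous_on UNIV (convolution T \<phi>)" if "\<phi> \<in> test_on R" for \<phi>
    by (rule continuous_on_convolution[OF TD t[OF that]])
  have dist_add: "dist_of scaleK (\<lambda>t. f t + g t) \<psi> = dist_of scaleK f \<psi> + dist_of scaleK g \<psi>"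
    and dist_scale: "dist_of scaleK (\<lambda>t. a *\<^sub>R f t) \<psi> = a *\<^sub>R dist_of scaleK f \<psi>"
    if "continuous_on UNIV f" "continuous_on UNIV g" "\<psi> \<in> test_functions" for f g \<psi> a
    using dist_of_lincomb[OF that(1,2), of 1 1] dist_of_lincomb[OF that(1,1), of a 0] that(3) by auto
  show ?thesis
  proof (rule bilinear_uniform_boundedness)
    fix x and \<phi> \<phi>' \<psi> :: "real \<Rightarrow> 'k"
    assume h: "\<phi> \<in> test_on R" "\<phi>' \<in> test_on R" "\<psi> \<in> test_on R"
    show "convolution (dist_of scaleK (convolution T (\<lambda>t. \<phi> t + \<phi>' t))) \<psi> x =
        convolution (dist_of scaleK (convolution T \<phi>)) \<psi> x + convolution (dist_of scaleK (convolution T \<phi>')) \<psi> x"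
      unfolding convolution_linear(1)[OF TD t[OF h(1)] t[OF h(2)]]
      by (simp add: convolution_def[of "dist_of _ _"] dist_add[OF c[OF h(1)] c[OF h(2)] test_reflect[OF t[OF h(3)]]])
  next
    fix x and \<phi> \<psi> \<psi>' :: "real \<Rightarrow> 'k"
    assume h: "\<phi> \<in> test_on R" "\<psi> \<in> test_on R" "\<psi>' \<in> test_on R"
    show "convolution (dist_of scaleK (convolution T \<phi>)) (\<lambda>t. \<psi> t + \<psi>' t) x =
        convolution (dist_of scaleK (convolution T \<phi>)) \<psi> x + convolution (dist_of scaleK (convolution T \<phi>)) \<psi>' x"
      unfolding convolution_linear(1)[OF S(1)[OF t[OF h(1)]] t[OF h(2)] t[OF h(3)]] ..
  next
    fix x a and \<phi> \<psi> :: "real \<Rightarrow> 'k"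
    assume h: "\<phi> \<in> test_on R" "\<psi> \<in> test_on R"
    show "convolution (dist_of scaleK (convolution T (\<lambda>t. a *\<^sub>R \<phi> t))) \<psi> x =
        a *\<^sub>R convolution (dist_of scaleK (convolution T \<phi>)) \<psi> x"
      unfolding convolution_linear(2)[OF TD t[OF h(1)] t[OF h(1)]]
      by (simp add: convolution_def[of "dist_of _ _"] dist_scale[OF c[OF h(1)] c[OF h(1)] test_reflect[OF t[OF h(2)]]])
    show "convolution (dist_of scaleK (convolution T \<phi>)) (\<lambda>t. a *\<^sub>R \<psi> t) x =
        a *\<^sub>R convolution (dist_of scaleK (convolution T \<phi>)) \<psi> x"
      unfolding convolution_linear(2)[OF S(1)[OF t[OF h(1)]] t[OF h(2)] t[OF h(2)]] ..
  next
    fix x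
    show "\<exists>m C. \<forall>\<phi>\<in>test_on R. \<forall>\<psi>\<in>test_on R. \<forall>d>0. \<forall>e>0.
      derivs_le m \<phi> d \<longrightarrow> derivs_le m \<psi> e \<longrightarrow>
      norm (convolution (dist_of scaleK (convolution T \<phi>)) \<psi> x) \<le> C * d * e"
      by (rule double_convolution_bound[OF TD R])
  next
    fix \<phi> \<psi> :: "real \<Rightarrow> 'k"
    assume h: "\<phi> \<in> test_on R" "\<psi> \<in> test_on R"
    show "\<exists>C. \<forall>x. norm (convolution (dist_of scaleK (convolution T \<phi>)) \<psi> x) \<le> C"
      by (rule bounded_if_dist_of_Linf[OF continuous_on_convolution[OF S(1) t] S(2)]) (intro t h)+
  qed
qed

lemma dist_of_uniform_limit:
  assumes f: "\<And>n. continuous_on UNIV (f n)" and lim: "uniform_limit UNIV f g sequentially" and \<phi>: "\<phi> \<in> test_functions"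
  shows "(\<lambda>n. dist_of scaleK (f n) \<phi>) \<longlonglongrightarrow> dist_of scaleK g \<phi>"
proof -
  obtain R where R: "R \<ge> 0" "\<phi> \<in> test_on R" using test_functionsE[OF \<phi>] by blast
  have R': "-R \<le> R" using R(1) by simp
  have g: "continuous_on UNIV g"
    by (rule uniform_limit_theorem[OF _ lim]) (simp_all add: f)
  obtain M where M: "M > 0" "\<And>t. norm (\<phi> t) \<le> M" using test_bounded[OF \<phi>] by blast
  have int: "(\<lambda>t. scaleK (\<phi> t) (w t)) integrable_on {-R..R}" if "continuous_on UNIV w" for w
    by (intro integrable_continuous_real continuous_on_scaleK continuous_on_smooth test_smooth \<phi> continuous_on_subset[OF that]) simp
  show ?thesis
  proof (rule tendstoI)
    fix e :: real assume e: "e > 0"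
    define d where "d = e / (M * (2 * R) + 1)"
    have "M * (2 * R) \<ge> 0" using M R by simp
    then have d: "d > 0" "M * d * (2 * R) < e" using e by (auto simp: d_def field_simps add_nonneg_pos)
    have "\<forall>\<^sub>F n in sequentially. \<forall>t\<in>UNIV. dist (f n t) (g t) < d"
      using lim d(1) unfolding uniform_limit_iff by blast
    then show "\<forall>\<^sub>F n in sequentially. dist (dist_of scaleK (f n) \<phi>) (dist_of scaleK g \<phi>) < e"
    proof eventually_elim
      case (elim n)
      have "dist_of scaleK (f n) \<phi> - dist_of scaleK g \<phi> = integral {-R..R} (\<lambda>t. scaleK (\<phi> t) (f n t - g t))"
        using dist_of_continuous[OF f \<phi> R' test_on_outside[OF R(2)], of n] dist_of_continuous[OF g \<phi> R' test_on_outside[OF R(2)]]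
          int[OF f, of n] int[OF g] by (simp add: integral_diff scale_right_diff_distrib)
      also have "norm \<dots> \<le> (M * d) * (R - (- R))"
      proof (rule integral_bound[OF R'])
        show "continuous_on {-R..R} (\<lambda>t. scaleK (\<phi> t) (f n t - g t))"
          by (intro continuous_on_scaleK continuous_intros continuous_on_smooth test_smooth \<phi>
              continuous_on_subset[OF f] continuous_on_subset[OF g]) auto
        show "norm (scaleK (\<phi> t) (f n t - g t)) \<le> M * d" for t
          unfolding norm_scaleK using elim M by (intro mult_mono) (auto simp: dist_norm less_imp_le)
      qed
      finally show ?case using d(2) by (simp add: dist_norm)
    qed
  qed
qed

text \<open>With \<open>m\<close> the order of the bilinear form on the test functions supported in \<open>{-2..2}\<close>, the number of
  means is \<open>n = 2 (m + 2)\<close>: one block of \<open>m + 2\<close> means for each of the two arguments. The bound \<open>c\<close> on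
  the lengths keeps the supports inside \<open>{-2..2}\<close>.\<close>

lemma distributional_class_iterated_means:
  assumes A: "A \<subseteq> distributional_class scaleK (Linf scaleK)" and closed: "smooth_uniformly_closed scaleK A"
    and conv: "convolution_set scaleK A \<subseteq> A" and T: "T \<in> distributional_class scaleK A"
  shows "\<exists>n c. c > 0 \<and> (\<forall>hs. length hs = n \<longrightarrow> (\<forall>h\<in>set hs. 0 < h \<and> h \<le> c) \<longrightarrow> dist_means hs T \<in> A)"
proof -
  have TD: "T \<in> \<D>'" and TA: "\<And>\<phi>. \<phi> \<in> test_functions \<Longrightarrow> dist_of scaleK (convolution T \<phi>) \<in> A"
    using T by (auto simp: distributional_class_def)
  have AD: "S \<in> \<D>'" if "S \<in> A" for S using that A by (auto simp: distributional_class_def)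
  obtain r :: "nat \<Rightarrow> real \<Rightarrow> real" and S :: "nat \<Rightarrow> real \<Rightarrow> 'k" and \<delta> \<epsilon> :: "nat \<Rightarrow> real" where
    r: "\<And>n. averaging_kernel (\<delta> n) (r n)" "\<delta> \<longlonglongrightarrow> 0" "\<And>n. (\<lambda>t. of_real (r n t) :: 'k) \<in> test_on 1"
    and S: "\<And>n. smooth (S n)" "\<And>n. iter_deriv 2 (S n) = (\<lambda>t. of_real (r n t))"
    "\<And>n m t. norm (S n t - S m t) \<le> \<epsilon> n + \<epsilon> m"
    and \<epsilon>: "\<epsilon> \<longlonglongrightarrow> 0" "\<And>n. \<epsilon> n \<le> \<epsilon> 0" "\<And>n. \<epsilon> n > 0"
    by (rule ex_mollifiers[where 'k = 'k], rule that, assumption+)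
  define \<rho> where "\<rho> n t = (of_real (r n t) :: 'k)" for n t
  have \<rho>: "\<rho> n \<in> test_on 1" for n unfolding \<rho>_def[abs_def] by (rule r(3))
  note \<rho>t = test_on_test[OF \<rho>]
  define B where "B \<phi> \<psi> x = convolution (dist_of scaleK (convolution T \<phi>)) \<psi> x" for \<phi> \<psi> x
  have two: "0 \<le> (2::real)" by simp
  obtain m C where "\<forall>x. \<forall>\<phi>\<in>test_on 2. \<forall>\<psi>\<in>test_on 2. \<forall>d>0. \<forall>e>0.
      derivs_le m \<phi> d \<longrightarrow> derivs_le m \<psi> e \<longrightarrow>
      norm (B \<phi> \<psi> x) \<le> C * d * e"
    using double_convolution_uniform_bound[OF T A two, folded B_def] by (elim exE) (rule that)
  note mC = this[THEN spec, THEN bspec, THEN bspec, THEN spec, THEN mp, THEN spec, THEN mp, THEN mp, THEN mp]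
  define l where "l = m + 2"
  define c where "c = 1 / real l"
  have l: "l > 0" by (simp add: l_def)
  have c: "0 < c" "c \<le> 1" using l by (simp_all add: c_def)

  \<comment> \<open>A difference of mollifiers is the second derivative of a uniformly small function, so that \<open>m\<close> further
    derivatives can be absorbed by the \<open>m + 2\<close> means.\<close>
  have cauchy: "\<exists>\<kappa> M. \<kappa> > 0 \<and> M > 0 \<and> (\<forall>i. means hs (\<rho> i) \<in> test_on 2) \<and>
      (\<forall>i. derivs_le m (means hs (\<rho> i)) M) \<and>
      (\<forall>i j. derivs_le m (\<lambda>t. means hs (\<rho> i) t - means hs (\<rho> j) t) ((\<epsilon> i + \<epsilon> j) * \<kappa>))"
    if len: "length hs = l" and hs: "\<forall>h\<in>set hs. 0 < h \<and> h \<le> c" for hs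
  proof -
    have pos: "positive hs" and hs1: "\<forall>h\<in>set hs. 0 < h \<and> h \<le> 1" using hs c by force+
    have "sum_list hs \<le> 1"
    proof -
      have "sum_list hs \<le> real (length hs) * c"
        using sum_list_mono[of hs "\<lambda>h. h" "\<lambda>_. c"] hs by (simp add: sum_list_triv)
      then show ?thesis using len l by (simp add: c_def)
    qed
    then have t2: "means hs (\<rho> i) \<in> test_on 2" for i
      by (intro test_on_mono[OF means_test_on[OF pos \<rho>]]) simp
    define \<kappa> where "\<kappa> = (\<Prod>h\<leftarrow>hs. 2 / h)"
    have \<kappa>: "\<kappa> > 0" unfolding \<kappa>_def using hs1 by (induction hs) auto
    have diff: "norm (iter_deriv k (\<lambda>t. means hs (\<rho> i) t - means hs (\<rho> j) t) t) \<le> (\<epsilon> i + \<epsilon> j) * \<kappa>"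
      if k: "k \<le> m" for i j k t
    proof -
      define f where "f t = S i t - S j t" for t
      have f: "smooth f" unfolding f_def by (rule smooth_diff(1)[OF S(1) S(1)])
      have f2: "iter_deriv 2 f = (\<lambda>t. \<rho> i t - \<rho> j t)"
        unfolding f_def smooth_diff(2)[OF S(1) S(1)] S(2) \<rho>_def ..
      have "(\<lambda>t. means hs (\<rho> i) t - means hs (\<rho> j) t) = means hs (iter_deriv 2 f)"
        unfolding f2 by (rule means_diff[OF pos, symmetric]) (rule test_smooth[OF \<rho>t])+
      also have "\<dots> = iter_deriv 2 (means hs f)" by (rule smooth_means(2)[OF pos f, symmetric])
      finally have "iter_deriv k (\<lambda>t. means hs (\<rho> i) t - means hs (\<rho> j) t) = iter_deriv (k + 2) (means hs f)"
        by (simp add: iter_deriv_iter_deriv)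
      moreover have "norm (iter_deriv (k + 2) (means hs f) t) \<le> (\<epsilon> i + \<epsilon> j) * (\<Prod>h\<leftarrow>hs. 2 / h)"
        by (rule means_deriv_bound[OF f _ hs1]) (use S(3) k len in \<open>auto simp: f_def l_def\<close>)
      ultimately show ?thesis by (simp add: \<kappa>_def)
    qed
    obtain M0 where M0: "M0 > 0" "\<And>k t. k \<le> m \<Longrightarrow> norm (iter_deriv k (means hs (\<rho> 0)) t) \<le> M0"
      using test_bounded_upto[OF test_on_test[OF t2[of 0]], of m] by blast
    have bound: "norm (iter_deriv k (means hs (\<rho> i)) t) \<le> M0 + 2 * \<epsilon> 0 * \<kappa>" if k: "k \<le> m" for i k t
    proof -
      have sm: "smooth (means hs (\<rho> i))" for i by (rule test_smooth[OF test_on_test[OF t2]])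
      have "norm (iter_deriv k (means hs (\<rho> i)) t - iter_deriv k (means hs (\<rho> 0)) t) \<le> (\<epsilon> i + \<epsilon> 0) * \<kappa>"
        using diff[OF k, of i 0 t] by (simp add: smooth_diff(2)[OF sm sm])
      also have "\<dots> \<le> (2 * \<epsilon> 0) * \<kappa>" using \<epsilon>(2)[of i] \<kappa> by (intro mult_right_mono) auto
      finally show ?thesis
        using M0(2)[OF k, of t] norm_triangle_sub[of "iter_deriv k (means hs (\<rho> i)) t" "iter_deriv k (means hs (\<rho> 0)) t"] by linarith
    qed
    have "M0 + 2 * \<epsilon> 0 * \<kappa> > 0" using M0(1) \<epsilon>(3)[of 0] \<kappa> by (simp add: add_pos_pos)
    with \<kappa> t2 diff bound show ?thesis by blast
  qed

  have "dist_means hs T \<in> A" if len: "length hs = 2 * l" and hs: "\<forall>h\<in>set hs. 0 < h \<and> h \<le> c" for hs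
  proof -
    define hs1 hs2 where "hs1 = take l hs" and "hs2 = drop l hs"
    have hs12: "hs = hs1 @ hs2" "length hs1 = l" "length hs2 = l" using len by (simp_all add: hs1_def hs2_def)
    have h1: "\<forall>h\<in>set hs1. 0 < h \<and> h \<le> c" and h2: "\<forall>h\<in>set hs2. 0 < h \<and> h \<le> c"
      using hs hs12(1) by auto
    have pos: "positive hs" "positive hs1" "positive hs2" using hs h1 h2 by auto
    define \<Phi> where "\<Phi> i = means hs1 (\<rho> i)" for i
    define \<Psi> where "\<Psi> i = means hs2 (\<rho> i)" for i
    obtain \<kappa>1 M1 where 1: "\<kappa>1 > 0" "M1 > 0" "\<And>i. \<Phi> i \<in> test_on 2"
      "\<And>i. derivs_le m (\<Phi> i) M1"
      "\<And>i j. derivs_le m (\<lambda>t. \<Phi> i t - \<Phi> j t) ((\<epsilon> i + \<epsilon> j) * \<kappa>1)"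
      using cauchy[OF hs12(2) h1] unfolding \<Phi>_def by blast
    obtain \<kappa>2 M2 where 2: "\<kappa>2 > 0" "M2 > 0" "\<And>i. \<Psi> i \<in> test_on 2"
      "\<And>i. derivs_le m (\<Psi> i) M2"
      "\<And>i j. derivs_le m (\<lambda>t. \<Psi> i t - \<Psi> j t) ((\<epsilon> i + \<epsilon> j) * \<kappa>2)"
      using cauchy[OF hs12(3) h2] unfolding \<Psi>_def by blast
    note \<Phi>t = test_on_test[OF 1(3)] and \<Psi>t = test_on_test[OF 2(3)]
    define g where "g i = B (\<Phi> i) (\<Psi> i)" for i
    have g_eq: "g i = convolution (dist_of scaleK (convolution T (\<Phi> i))) (\<Psi> i)" for i
      by (rule ext) (simp add: g_def B_def)
    define K where "K = \<bar>C\<bar> * (\<kappa>1 * M2 + M1 * \<kappa>2)"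
    have K: "K \<ge> 0" using 1 2 by (simp add: K_def)
    have g_diff: "norm (g i x - g j x) \<le> (\<epsilon> i + \<epsilon> j) * K" for i j x
    proof -
      have e: "\<epsilon> i + \<epsilon> j > 0" using \<epsilon>(3)[of i] \<epsilon>(3)[of j] by simp
      have SD: "dist_of scaleK (convolution T \<phi>) \<in> \<D>'" if "\<phi> \<in> test_functions" for \<phi>
        by (rule AD[OF TA[OF that]])
      have left: "B (\<lambda>t. \<Phi> i t - \<Phi> j t) (\<Psi> i) x = B (\<Phi> i) (\<Psi> i) x - B (\<Phi> j) (\<Psi> i) x"
      proof -
        have cc: "continuous_on UNIV (convolution T (\<Phi> i))" for i by (rule continuous_on_convolution[OF TD \<Phi>t])
        have "convolution T (\<lambda>t. \<Phi> i t - \<Phi> j t) = (\<lambda>x. 1 *\<^sub>R convolution T (\<Phi> i) x + (- 1) *\<^sub>R convolution T (\<Phi> j) x)"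
          unfolding convolution_def
          by (simp add: dist_diff[OF TD test_reflect[OF \<Phi>t] test_reflect[OF \<Phi>t]])
        then show ?thesis
          unfolding B_def convolution_def[of "dist_of _ _"]
          by (simp only: dist_of_lincomb[OF cc cc] restrict_apply test_reflect[OF \<Psi>t] if_True) simp
      qed
      have right: "B (\<Phi> j) (\<lambda>t. \<Psi> i t - \<Psi> j t) x = B (\<Phi> j) (\<Psi> i) x - B (\<Phi> j) (\<Psi> j) x"
        unfolding B_def convolution_def[of "dist_of _ _"]
        by (rule dist_diff[OF SD[OF \<Phi>t] test_reflect[OF \<Psi>t] test_reflect[OF \<Psi>t]])
      have "norm (g i x - g j x) \<le> norm (B (\<lambda>t. \<Phi> i t - \<Phi> j t) (\<Psi> i) x) + norm (B (\<Phi> j) (\<lambda>t. \<Psi> i t - \<Psi> j t) x)"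
        using norm_triangle_ineq[of "B (\<lambda>t. \<Phi> i t - \<Phi> j t) (\<Psi> i) x" "B (\<Phi> j) (\<lambda>t. \<Psi> i t - \<Psi> j t) x"]
        by (simp add: left right g_def)
      also have "\<dots> \<le> C * ((\<epsilon> i + \<epsilon> j) * \<kappa>1) * M2 + C * M1 * ((\<epsilon> i + \<epsilon> j) * \<kappa>2)"
        using e 1(1,2) 2(1,2)
        by (intro add_mono mC test_on_diff 1(3) 2(3) 1(4) 2(4) 1(5) 2(5)) simp_all
      also have "\<dots> = C * ((\<epsilon> i + \<epsilon> j) * (\<kappa>1 * M2 + M1 * \<kappa>2))" by (simp add: algebra_simps)
      also have "\<dots> \<le> \<bar>C\<bar> * ((\<epsilon> i + \<epsilon> j) * (\<kappa>1 * M2 + M1 * \<kappa>2))"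
        using e 1 2 by (intro mult_right_mono) (auto intro!: mult_nonneg_nonneg add_nonneg_nonneg simp: less_imp_le)
      finally show ?thesis by (simp add: K_def algebra_simps)
    qed
    have "uniformly_convergent_on UNIV g"
    proof (rule Cauchy_uniformly_convergent, rule uniformly_Cauchy_onI)
      fix e :: real assume e: "e > 0"
      have "(\<lambda>i. \<epsilon> i * (2 * K)) \<longlonglongrightarrow> 0 * (2 * K)" by (intro tendsto_intros \<epsilon>)
      then have "\<forall>\<^sub>F i in sequentially. \<epsilon> i * (2 * K) < e" using e by (intro order_tendstoD) auto
      then obtain N where N: "\<And>i. i \<ge> N \<Longrightarrow> \<epsilon> i * (2 * K) < e" unfolding eventually_sequentially by blast
      have "dist (g i x) (g j x) < e" if "i \<ge> N" "j \<ge> N" for i j x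
        using g_diff[of i x j] N[OF that(1)] N[OF that(2)] by (simp add: dist_norm algebra_simps)
      then show "\<exists>M. \<forall>x\<in>UNIV. \<forall>m\<ge>M. \<forall>n\<ge>M. dist (g m x) (g n x) < e" by blast
    qed
    then obtain G where G: "uniform_limit UNIV g G sequentially" unfolding uniformly_convergent_on_def by blast
    have SiA: "dist_of scaleK (convolution T (\<Phi> i)) \<in> A" for i by (rule TA[OF \<Phi>t])
    have gs: "smooth (g i)" for i unfolding g_eq by (rule smooth_convolution(1)[OF AD[OF SiA] \<Psi>t])
    have gA: "dist_of scaleK (g i) \<in> A" for i
      unfolding g_eq using conv SiA \<Psi>t unfolding convolution_set_def by blast
    have GA: "dist_of scaleK G \<in> A"
      using closed gs gA G unfolding smooth_uniformly_closed_def by blast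

    \<comment> \<open>All means can be moved from the mollifiers to \<open>T\<close>, so that \<open>g i\<close> is \<open>U\<close> mollified twice.\<close>
    define V where "V = dist_means hs1 T"
    define U where "U = dist_means hs T"
    have VD: "V \<in> \<D>'" and UD: "U \<in> \<D>'"
      unfolding V_def U_def by (intro dist_means_distributions TD pos)+
    have UV: "U = dist_means hs2 V" unfolding U_def V_def hs12(1) dist_means_append ..
    have Q: "dist_of scaleK (convolution U (\<rho> i)) \<in> \<D>'" and gQ: "g i = convolution (dist_of scaleK (convolution U (\<rho> i))) (\<rho> i)" for i
    proof -
      have \<Phi>V: "convolution T (\<Phi> i) = convolution V (\<rho> i)"
        unfolding \<Phi>_def V_def by (rule convolution_means[OF pos(2) TD \<rho>t, symmetric])
      have SD: "dist_of scaleK (convolution V (\<rho> i)) \<in> \<D>'" using AD[OF SiA[of i]] by (simp only: \<Phi>V)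
      have eq: "dist_means hs2 (dist_of scaleK (convolution V (\<rho> i))) = dist_of scaleK (convolution U (\<rho> i))"
        unfolding UV by (rule dist_means_dist_of_convolution[OF pos(3) VD \<rho>t])
      show "dist_of scaleK (convolution U (\<rho> i)) \<in> \<D>'"
        unfolding eq[symmetric] by (rule dist_means_distributions[OF pos(3) SD])
      show "g i = convolution (dist_of scaleK (convolution U (\<rho> i))) (\<rho> i)"
        unfolding g_eq \<Phi>V \<Psi>_def eq[symmetric] by (rule convolution_means[OF pos(3) SD \<rho>t, symmetric])
    qed
    have "U \<phi> = dist_of scaleK G \<phi>" if \<phi>: "\<phi> \<in> test_functions" for \<phi>
    proof (rule LIMSEQ_unique)
      obtain R where R: "\<phi> \<in> test_on R" using \<phi> test_functions_iff by blast
      have a1: "average (r i) \<phi> \<in> test_on (R + 1)" for i by (rule smooth_average(1)[OF r(1) R])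
      have a2: "average (r i) (average (r i) \<phi>) \<in> test_on (R + 1 + 1)" for i by (rule smooth_average(1)[OF r(1) a1])
      have "dist_of scaleK (g i) \<phi> = U (average (r i) (average (r i) \<phi>))" for i
        unfolding gQ using dist_of_convolution_kernel[OF Q \<phi> r(3), of i i] dist_of_convolution_kernel[OF UD test_on_test[OF a1] r(3), of i i]
        by (simp add: \<rho>_def[abs_def])
      moreover have "(\<lambda>i. U (average (r i) (average (r i) \<phi>))) \<longlonglongrightarrow> U \<phi>"
      proof (rule dist_tendsto[OF UD, where R = "R + 1 + 1"])
        show "\<phi> \<in> test_on (R + 1 + 1)" by (rule test_on_mono[OF R]) simp
        show "\<forall>\<^sub>F i in sequentially. average (r i) (average (r i) \<phi>) \<in> test_on (R + 1 + 1)"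
          by (rule always_eventually, rule allI, rule a2)
        show "uniform_limit UNIV (\<lambda>i. iter_deriv k (average (r i) (average (r i) \<phi>))) (iter_deriv k \<phi>) sequentially" for k
          by (rule double_average_uniform_limit[OF r(1,2) R])
      qed
      ultimately show "(\<lambda>i. dist_of scaleK (g i) \<phi>) \<longlonglongrightarrow> U \<phi>" by simp
      show "(\<lambda>i. dist_of scaleK (g i) \<phi>) \<longlonglongrightarrow> dist_of scaleK G \<phi>"
        by (rule dist_of_uniform_limit[OF continuous_on_smooth[OF gs] G \<phi>])
    qed
    then have "U = dist_of scaleK G"
      using dist_extensional[OF UD] by (intro extensionalityI[of _ test_functions]) (auto simp: dist_of_def)
    then show ?thesis using GA by (simp add: U_def)
  qed
  then show ?thesis using c(1) by blast
qed

end

theorem corollary2p15: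
  fixes scaleK :: "'k::{real_normed_field,euclidean_space} \<Rightarrow> 'x::banach \<Rightarrow> 'x"
    and A :: "((real \<Rightarrow> 'k) \<Rightarrow> 'x) set"
  assumes "normed_space_over scaleK"
    and "A \<subseteq> distributional_class scaleK (Linf scaleK)"
    and "real_linear A"
    and "positive_invariant A"
    and "smooth_uniformly_closed scaleK A"
    and "convolution_set scaleK A \<subseteq> A"
    and "A \<subseteq> mean_class scaleK A"
    and "Delta1 scaleK A"
  shows "distributional_class scaleK A = (\<Union>n. (dist_mean_class scaleK ^^ n) A)"
proof -
  interpret banach_space_over scaleK by unfold_locales (rule assms(1))
  have "A \<subseteq> distributional_class scaleK A"
    using assms(2,6) by (fastforce simp: distributional_class_def convolution_set_def)
  then have "(\<Union>n. (dist_mean_class scaleK ^^ n) A) \<subseteq> distributional_class scaleK A"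
    using iterated_dist_mean_class_subset[OF assms(3,8)] by blast
  moreover have "distributional_class scaleK A \<subseteq> (\<Union>n. (dist_mean_class scaleK ^^ n) A)"
  proof
    fix T assume T: "T \<in> distributional_class scaleK A"
    then obtain n c where "c > 0" "\<And>hs. length hs = n \<Longrightarrow> \<forall>h\<in>set hs. 0 < h \<and> h \<le> c \<Longrightarrow> dist_means hs T \<in> A"
      using distributional_class_iterated_means[OF assms(2,5,6)] by blast
    then have "T \<in> (dist_mean_class scaleK ^^ n) A"
      using T by (intro iterated_dist_mean_classI[OF assms(3,4)]) (auto simp: distributional_class_def)
    then show "T \<in> (\<Union>n. (dist_mean_class scaleK ^^ n) A)" by blast
  qed
  ultimately show ?thesis by blast
qed

end
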